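(* Let $(\mathcal{T},\sigma(\mathcal{T}),\sigma)$ be a primitive topological substitution, let $T\in\mathcal{T}$ be a tile, and let $x=(\mathbb{M},\Gamma,\mathcal{P},\mathsf{T})$ be a tiling of $\mathbb{M}$ which is a geometric realization of $\sigma^\infty(T)$. Then the dynamical system $(\Omega(x),\Gamma)$ is minimal, where $\Omega(x)$ is the hull of the tiling $x$.
   Context: **Tilings.** $\mathbb{M}$ is the Euclidean plane $\mathbb{E}^2$ or the hyperbolic plane $\mathbb{H}^2$, with a base point $O$, and $\Gamma$ is a subgroup of the isometry group $\mathrm{Isom}(\mathbb{M})$. A tile is a compact subset of $\mathbb{M}$ which is the closure of its interior; a labelled tile is a pair (tile, element of a finite set of labels). Two labelled tiles are equivalent if they have the same label and one is the image of the other under an element of $\Gamma$; an equivalence class is called a prototile. A tiling $(\mathbb{M},\Gamma,\mathcal{P},\mathsf{T})$ modelled on a finite set $\mathcal{P}$ of prototiles is a set $\mathsf{T}$ of (labelled) tiles, each belonging to an element of $\mathcal{P}$, whose union is $\mathbb{M}$ and such that distinct tiles of $\mathsf{T}$ have disjoint interiors. A patch of a tiling is a connected finite union of its tiles; its support is the union of its tiles as a subset of $\mathbb{M}$. **Space of tilings, hull, minimality.** $\Sigma_{\mathcal{P}}$ is the set of all tilings of $\mathbb{M}$ modelled on $\mathcal{P}$; $\Gamma$ acts on it by $g(\mathbb{M},\Gamma,\mathcal{P},\mathsf{T})=(\mathbb{M},\Gamma,\mathcal{P},g\mathsf{T})$. Let $B_r$ be the closed ball of radius $r$ centered at $O$,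 $\|g\|_r=\sup_{Q\in B_r}d(Q,gQ)$, and let $B_{1/r}[x]$ be the set of patches of $x$ whose support contains $B_{1/r}$. $\Sigma_{\mathcal{P}}$ has the topology of the distance $d(x,y)=\inf(\{1\}\cup A(x,y))$, where $A(x,y)=\{r>0 : \exists p\in B_{1/r}[x],\ \exists q\in B_{1/r}[y],\ \exists g\in\Gamma,\ gp=q,\ \|g\|_{1/r}\le r\}$. The hull is $\Omega(x)=\overline{\Gamma x}$. $(\Omega(x),\Gamma)$ is minimal if every $\Gamma$-orbit is dense in $\Omega(x)$. **Complex of a tiling.** Assume the tiles are connected. The $2$-complex associated to the tiling has as vertices the points of $\mathbb{M}$ belonging to at least three tiles; its edges are the closures of the connected components (open arcs) of $\bigcup_{T\in\mathsf{T}}\partial T$ minus the vertices; its faces are the tiles. Each face is labelled by its prototile. **Topological pre-substitutions.** A topological polygon is a $2$-dimensional CW-complex, homeomorphic to a closed disc, made of one face, $k$ edges and $k$ vertices for some $k\ge 3$, whose $1$-skeleton is the boundary circle of the disc. Let $\mathcal{T}=\{T_1,\dots,T_d\}$ be a finite set of topological polygons (called tiles). A patch modelled on $\mathcal{T}$ is a $2$-CW-complex $P$ homeomorphic to the closed disc such that each closed face $f$ of $P$ comes with a tile $\mathrm{type}(f)\in\mathcal{T}$ and a homeomorphism $\tau_f:f\to \mathrm{type}(f)$ respecting the cellular structure. An edge of $P$ not contained in the boundary circle of $P$ is interior; it is contained in exactly two closed faces. A topological pre-substitution $(\mathcal{T},\sigma(\mathcal{T}),\sigma)$ consists of such a set $\mathcal{T}$,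 a set $\sigma(\mathcal{T})=\{\sigma(T_1),\dots,\sigma(T_d)\}$ of patches modelled on $\mathcal{T}$, and a homeomorphism $\sigma:\bigsqcup_i T_i\to\bigsqcup_i\sigma(T_i)$ restricting to homeomorphisms $T_i\to\sigma(T_i)$ which send each vertex of $T_i$ to a vertex of the boundary of $\sigma(T_i)$. Thus $\sigma$ maps an edge of $T_i$ to an edge path in the boundary of $\sigma(T_i)$. **Iteration and compatibility.** A pair $(e,e')$ of edges of tiles of $\mathcal{T}$ is balanced if the edge paths $\sigma(e)$, $\sigma(e')$ have the same number of edges. An interior edge $e$ of a patch, adjacent to the faces $f,f'$, is balanced if $(\tau_f(e),\tau_{f'}(e))$ is balanced. Every pre-substitution is $1$-compatible. For $p\ge2$, $\sigma$ is $p$-compatible if it is $(p-1)$-compatible and, for every $i$, every interior edge of $\sigma^{p-1}(T_i)$ is balanced; in that case $\sigma^p(T_i)$ is the patch obtained from $\bigsqcup_{f\text{ face of }\sigma^{p-1}(T_i)}\sigma(\mathrm{type}(f))$ by gluing edge to edge, whenever $f,f'$ are adjacent along an edge $e$, the patches $\sigma(\mathrm{type}(f))$ and $\sigma(\mathrm{type}(f'))$ along $\sigma(\tau_f(e))$ and $\sigma(\tau_{f'}(e))$. The map $\sigma$ induces homeomorphisms $\sigma^{p-1}(T_i)\to\sigma^p(T_i)$ sending vertices to vertices; by composition one gets $\sigma^p:T_i\to\sigma^p(T_i)$, and $\sigma^p$ is again a pre-substitution. $\sigma$ is compatible if it is $p$-compatible for all $p$. **Core, substitutions, inflation.** The thick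 boundary $\mathsf{B}(P)$ of a patch $P$ is the subcomplex consisting of the closed faces containing at least one vertex of $\partial P$; the core $\mathrm{Core}(P)$ is the closure of $P\smallsetminus \mathsf{B}(P)$. A topological substitution is a compatible pre-substitution with the core property: for some $i$ and $k$, $\mathrm{Core}(\sigma^k(T_i))\ne\emptyset$. If $T\in\mathcal{T}$ is such that the core of $\sigma(T)$ contains a face of type $T$ (this is implicit whenever $\sigma^\infty(T)$ is considered), one identifies $T$ with such a face, hence inductively $\sigma^k(T)$ with a subcomplex of $\sigma^{k+1}(T)$, and sets $\sigma^\infty(T)=\bigcup_{k\ge0}\sigma^k(T)$, a complex homeomorphic to the plane whose faces are labelled by their types. **Geometric realization.** A tiling $x$ is a geometric realization of $\sigma^\infty(T)$ if its associated labelled complex is $\sigma^\infty(T)$: each $T_i$ is realized by a prototile $\lfloor T_i\rfloor$, and $\mathbb{M}$ is obtained by gluing the realizations of the faces as prescribed by the complex $\sigma^\infty(T)$. **Primitivity.** A patch $P$ is separated if there is a (closed) tile $T$ of $P$ such that $P\smallsetminus T$ is not connected. A topological substitution is pure primitive if (i) for all $T\in\mathcal{T}$, the patches $\sigma(T)$ and $\sigma^2(T)$ are not separated, and (ii) for all $T,T'\in\mathcal{T}$, the core of $\sigma(T)$ contains a face of type $T'$. It is primitive if $\sigma^k$ is pure primitive for some integer $k\geq 1$. *)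

theory Defs
  imports "HOL-Analysis.Analysis" "HOL-Algebra.Bij"
begin

no_notation eq_closure_of (\<open>closure'_of\<index>\<close>)

section \<open>The plane and its isometries\<close>

datatype geometry = Euclidean | Hyperbolic

text \<open>
  Both planes have carriers that are open subsets of the complex numbers; the hyperbolic plane is the
  Poincare disc with its metric of curvature \<open>-1\<close>.  In both cases the metric topology is the subspace
  topology of the carrier, so that topological notions for subsets of the plane (compactness,
  interior, frontier, \<open>\<dots>\<close>) can be taken in the complex numbers.
\<close>

fun plane :: "geometry \<Rightarrow> complex set" where
  "plane Euclidean = UNIV"
| "plane Hyperbolic = ball 0 1"

fun plane_dist :: "geometry \<Rightarrow> complex \<Rightarrow> complex \<Rightarrow> real" where
  "plane_dist Euclidean z w = dist z w"
| "plane_dist Hyperbolic z w =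
     arcosh (1 + 2 * (cmod (z - w))\<^sup>2 / ((1 - (cmod z)\<^sup>2) * (1 - (cmod w)\<^sup>2)))"

definition plane_cball :: "geometry \<Rightarrow> complex \<Rightarrow> real \<Rightarrow> complex set" where
  "plane_cball G b r = {Q \<in> plane G. plane_dist G b Q \<le> r}"

text \<open>As in \<^const>\<open>BijGroup\<close>, an isometry is a function that is \<^const>\<open>undefined\<close> outside the plane.\<close>

definition isom_group :: "geometry \<Rightarrow> (complex \<Rightarrow> complex) monoid" where
  "isom_group G = (BijGroup (plane G))
     \<lparr>carrier := {g \<in> Bij (plane G).
        \<forall>z\<in>plane G. \<forall>w\<in>plane G. plane_dist G (g z) (g w) = plane_dist G z w}\<rparr>"

definition displacement :: "geometry \<Rightarrow> complex \<Rightarrow> real \<Rightarrow> (complex \<Rightarrow> complex) \<Rightarrow> real" where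
  "displacement G b r g = (SUP Q\<in>plane_cball G b r. plane_dist G Q (g Q))"


section \<open>Tilings\<close>

type_synonym 'l labelled_tile = "complex set \<times> 'l"

definition is_tile :: "geometry \<Rightarrow> complex set \<Rightarrow> bool" where
  "is_tile G A \<longleftrightarrow> compact A \<and> A \<subseteq> plane G \<and> closure (interior A) = A"

definition labelled_tiles :: "geometry \<Rightarrow> 'l labelled_tile set" where
  "labelled_tiles G = {u. is_tile G (fst u)}"

definition tile_equiv ::
  "geometry \<Rightarrow> (complex \<Rightarrow> complex) set \<Rightarrow> ('l labelled_tile \<times> 'l labelled_tile) set" where
  "tile_equiv G \<Gamma> = {(u, v). u \<in> labelled_tiles G \<and> v \<in> labelled_tiles G \<and>
      snd u = snd v \<and> (\<exists>g\<in>\<Gamma>. fst v = g ` fst u)}"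

definition prototiles ::
  "geometry \<Rightarrow> (complex \<Rightarrow> complex) set \<Rightarrow> 'l labelled_tile set set" where
  "prototiles G \<Gamma> = labelled_tiles G // tile_equiv G \<Gamma>"

definition prototile_of ::
  "geometry \<Rightarrow> (complex \<Rightarrow> complex) set \<Rightarrow> 'l labelled_tile \<Rightarrow> 'l labelled_tile set" where
  "prototile_of G \<Gamma> u = tile_equiv G \<Gamma> `` {u}"

text \<open>
  A tiling \<open>(\<bbbM>, \<Gamma>, \<P>, \<T>)\<close> is represented by its set of labelled tiles, the first three
  components being parameters.
\<close>

definition is_tiling ::
  "geometry \<Rightarrow> (complex \<Rightarrow> complex) set \<Rightarrow> 'l labelled_tile set set \<Rightarrow> 'l labelled_tile set \<Rightarrow> bool"
  where
  "is_tiling G \<Gamma> \<P> \<T> \<longleftrightarrow>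
     subgroup \<Gamma> (isom_group G) \<and> finite \<P> \<and> \<P> \<subseteq> prototiles G \<Gamma> \<and>
     \<T> \<subseteq> \<Union>\<P> \<and> (\<Union>u\<in>\<T>. fst u) = plane G \<and>
     (\<forall>u\<in>\<T>. \<forall>v\<in>\<T>. u \<noteq> v \<longrightarrow> interior (fst u) \<inter> interior (fst v) = {})"

definition tilings ::
  "geometry \<Rightarrow> (complex \<Rightarrow> complex) set \<Rightarrow> 'l labelled_tile set set \<Rightarrow> 'l labelled_tile set set"
  where "tilings G \<Gamma> \<P> = {\<T>. is_tiling G \<Gamma> \<P> \<T>}"

definition act :: "(complex \<Rightarrow> complex) \<Rightarrow> 'l labelled_tile set \<Rightarrow> 'l labelled_tile set" where
  "act g p = (\<lambda>(A, l). (g ` A, l)) ` p"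

text \<open>The patches of a tiling whose support contains the given set \<open>B\<close>.\<close>

definition patches_over :: "complex set \<Rightarrow> 'l labelled_tile set \<Rightarrow> 'l labelled_tile set set" where
  "patches_over B \<T> = {p. p \<subseteq> \<T> \<and> finite p \<and> connected (\<Union>u\<in>p. fst u) \<and> B \<subseteq> (\<Union>u\<in>p. fst u)}"

definition tiling_dist ::
  "geometry \<Rightarrow> (complex \<Rightarrow> complex) set \<Rightarrow> complex \<Rightarrow>
   'l labelled_tile set \<Rightarrow> 'l labelled_tile set \<Rightarrow> real" where
  "tiling_dist G \<Gamma> b x y = Inf ({1} \<union> {r. r > 0 \<and>
     (\<exists>p \<in> patches_over (plane_cball G b (1/r)) x. \<exists>q \<in> patches_over (plane_cball G b (1/r)) y.
       \<exists>g\<in>\<Gamma>. act g p = q \<and> displacement G b (1/r) g \<le> r)})"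

text \<open>
  The topology of the distance \<^const>\<open>tiling_dist\<close>, written out because the library's
  \<^const>\<open>Metric_space.mtopology\<close> can only be unfolded after \<^const>\<open>Metric_space\<close> has been proved.
\<close>

definition tiling_topology ::
  "geometry \<Rightarrow> (complex \<Rightarrow> complex) set \<Rightarrow> complex \<Rightarrow> 'l labelled_tile set set \<Rightarrow>
   'l labelled_tile set topology" where
  "tiling_topology G \<Gamma> b \<P> = topology (\<lambda>U. U \<subseteq> tilings G \<Gamma> \<P> \<and>
     (\<forall>x\<in>U. \<exists>\<epsilon>>0. \<forall>y\<in>tilings G \<Gamma> \<P>. tiling_dist G \<Gamma> b x y < \<epsilon> \<longrightarrow> y \<in> U))"

lemma openin_tiling_topology:
  "openin (tiling_topology G \<Gamma> b \<P>) U \<longleftrightarrow> U \<subseteq> tilings G \<Gamma> \<P> \<and>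
     (\<forall>x\<in>U. \<exists>\<epsilon>>0. \<forall>y\<in>tilings G \<Gamma> \<P>. tiling_dist G \<Gamma> b x y < \<epsilon> \<longrightarrow> y \<in> U)"
proof -
  let ?L = "\<lambda>U. U \<subseteq> tilings G \<Gamma> \<P> \<and>
     (\<forall>x\<in>U. \<exists>\<epsilon>>0. \<forall>y\<in>tilings G \<Gamma> \<P>. tiling_dist G \<Gamma> b x y < \<epsilon> \<longrightarrow> y \<in> U)"
  have "?L (U \<inter> V)" if U: "?L U" and V: "?L V" for U V
  proof (intro conjI ballI)
    fix x assume x: "x \<in> U \<inter> V"
    from U x obtain d where d: "d > 0"
      "\<forall>y\<in>tilings G \<Gamma> \<P>. tiling_dist G \<Gamma> b x y < d \<longrightarrow> y \<in> U" by blast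
    from V x obtain e where e: "e > 0"
      "\<forall>y\<in>tilings G \<Gamma> \<P>. tiling_dist G \<Gamma> b x y < e \<longrightarrow> y \<in> V" by blast
    show "\<exists>\<epsilon>>0. \<forall>y\<in>tilings G \<Gamma> \<P>. tiling_dist G \<Gamma> b x y < \<epsilon> \<longrightarrow> y \<in> U \<inter> V"
      using d e by (intro exI[of _ "min d e"]) auto
  qed (use U in blast)
  moreover have "?L (\<Union>K)" if "\<forall>U\<in>K. ?L U" for K
  proof (intro conjI ballI)
    show "\<Union>K \<subseteq> tilings G \<Gamma> \<P>" using that by blast
  next
    fix x assume "x \<in> \<Union>K"
    then obtain U where "U \<in> K" "x \<in> U" by blast
    then obtain e where "e > 0"
      "\<forall>y\<in>tilings G \<Gamma> \<P>. tiling_dist G \<Gamma> b x y < e \<longrightarrow> y \<in> U" using \<open>\<forall>U\<in>K. ?L U\<close> by blast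
    then show "\<exists>\<epsilon>>0. \<forall>y\<in>tilings G \<Gamma> \<P>. tiling_dist G \<Gamma> b x y < \<epsilon> \<longrightarrow> y \<in> \<Union>K"
      using \<open>U \<in> K\<close> by blast
  qed
  ultimately have "istopology ?L" unfolding istopology_def by simp
  then show ?thesis unfolding tiling_topology_def by (simp add: topology_inverse')
qed

definition tiling_orbit ::
  "(complex \<Rightarrow> complex) set \<Rightarrow> 'l labelled_tile set \<Rightarrow> 'l labelled_tile set set" where
  "tiling_orbit \<Gamma> x = (\<lambda>g. act g x) ` \<Gamma>"

definition tiling_hull ::
  "geometry \<Rightarrow> (complex \<Rightarrow> complex) set \<Rightarrow> complex \<Rightarrow> 'l labelled_tile set set \<Rightarrow>
   'l labelled_tile set \<Rightarrow> 'l labelled_tile set set" where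
  "tiling_hull G \<Gamma> b \<P> x = tiling_topology G \<Gamma> b \<P> closure_of tiling_orbit \<Gamma> x"

text \<open>\<open>X\<close> is a space on which a group acts, \<open>orb y\<close> being the orbit of \<open>y\<close>.\<close>

definition minimal_system :: "'x topology \<Rightarrow> ('x \<Rightarrow> 'x set) \<Rightarrow> bool" where
  "minimal_system X orb \<longleftrightarrow> (\<forall>y\<in>topspace X. X closure_of orb y = topspace X)"


section \<open>Two-dimensional cell complexes\<close>

text \<open>
  Cells of dimension 1 and 2 are represented by the \<^emph>\<open>open\<close> cells (subsets of the space);
  the corresponding closed cells are their closures.
\<close>

record 'p complex2 =
  ctop :: "'p topology"
  verts :: "'p set"
  edges :: "'p set set"
  faces :: "'p set set"

definition cells :: "('p, 'z) complex2_scheme \<Rightarrow> 'p set set" where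
  "cells K = (\<lambda>v. {v}) ` verts K \<union> edges K \<union> faces K"

abbreviation closed_cell :: "('p, 'z) complex2_scheme \<Rightarrow> 'p set \<Rightarrow> 'p set" where
  "closed_cell K c \<equiv> ctop K closure_of c"

definition cw2 :: "('p, 'z) complex2_scheme \<Rightarrow> bool" where
  "cw2 K \<longleftrightarrow>
     Hausdorff_space (ctop K) \<and>
     \<Union>(cells K) = topspace (ctop K) \<and>
     disjoint (cells K) \<and>
     (\<forall>e\<in>edges K. \<exists>\<phi> :: real \<Rightarrow> 'p.
        continuous_map (top_of_set {0..1}) (ctop K) \<phi> \<and>
        homeomorphic_map (top_of_set {0<..<1}) (subtopology (ctop K) e) \<phi> \<and>
        \<phi> ` {0, 1} \<subseteq> verts K) \<and>
     (\<forall>f\<in>faces K. \<exists>(\<phi> :: complex \<Rightarrow> 'p) V E.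
        continuous_map (top_of_set (cball 0 1)) (ctop K) \<phi> \<and>
        homeomorphic_map (top_of_set (ball 0 1)) (subtopology (ctop K) f) \<phi> \<and>
        V \<subseteq> verts K \<and> finite V \<and> E \<subseteq> edges K \<and> finite E \<and>
        \<phi> ` sphere 0 1 \<subseteq> V \<union> \<Union>E) \<and>
     (\<forall>C. closedin (ctop K) C \<longleftrightarrow>
        C \<subseteq> topspace (ctop K) \<and> (\<forall>c\<in>cells K. closedin (ctop K) (C \<inter> closed_cell K c)))"

definition restrict_complex :: "('p, 'z) complex2_scheme \<Rightarrow> 'p set \<Rightarrow> ('p, 'z) complex2_scheme" where
  "restrict_complex K A = K
     \<lparr>ctop := subtopology (ctop K) A, verts := verts K \<inter> A,
      edges := {e \<in> edges K. e \<subseteq> A}, faces := {f \<in> faces K. f \<subseteq> A}\<rparr>"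

definition cell_iso ::
  "('p \<Rightarrow> 'q) \<Rightarrow> ('p, 'y) complex2_scheme \<Rightarrow> ('q, 'z) complex2_scheme \<Rightarrow> bool" where
  "cell_iso \<phi> K L \<longleftrightarrow>
     homeomorphic_map (ctop K) (ctop L) \<phi> \<and>
     \<phi> ` verts K = verts L \<and> (`) \<phi> ` edges K = edges L \<and> (`) \<phi> ` faces K = faces L"

definition is_disc :: "('p, 'z) complex2_scheme \<Rightarrow> bool" where
  "is_disc K \<longleftrightarrow> ctop K homeomorphic_space top_of_set (cball 0 1 :: complex set)"

text \<open>The boundary circle of a disc does not depend on the homeomorphism with the round disc.\<close>

definition boundary_circle :: "('p, 'z) complex2_scheme \<Rightarrow> 'p set" where
  "boundary_circle K = {x \<in> topspace (ctop K).
     \<exists>h. homeomorphic_map (ctop K) (top_of_set (cball 0 1 :: complex set)) h \<and> h x \<in> sphere 0 1}"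

definition topological_polygon :: "'a complex2 \<Rightarrow> bool" where
  "topological_polygon K \<longleftrightarrow>
     cw2 K \<and> is_disc K \<and> card (faces K) = 1 \<and>
     (\<exists>k\<ge>3. card (edges K) = k \<and> card (verts K) = k) \<and>
     verts K \<union> \<Union>(edges K) = boundary_circle K"


section \<open>Patches and pre-substitutions\<close>

text \<open>
  A complex (points of type \<open>'p\<close>) whose faces \<open>f\<close> carry a type \<open>ftype f\<close>, which is the index of a
  polygon, and a map \<open>fmap f\<close> from the closed face to that polygon (points of type \<open>'a\<close>).
\<close>

record ('p, 'a, 't) typed_complex = "'p complex2" +
  ftype :: "'p set \<Rightarrow> 't"
  fmap :: "'p set \<Rightarrow> 'p \<Rightarrow> 'a"

definition is_patch :: "('t \<Rightarrow> 'a complex2) \<Rightarrow> ('p, 'a, 't) typed_complex \<Rightarrow> bool" where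
  "is_patch \<tau> P \<longleftrightarrow> cw2 P \<and> is_disc P \<and>
     (\<forall>f\<in>faces P. cell_iso (fmap P f) (restrict_complex P (closed_cell P f)) (\<tau> (ftype P f)))"

definition interior_edges :: "('p, 'z) complex2_scheme \<Rightarrow> 'p set set" where
  "interior_edges P = {e \<in> edges P. \<not> e \<subseteq> boundary_circle P}"

text \<open>
  The type \<open>'t\<close> indexes the finite set of tiles; \<open>tile i\<close>, \<open>img i\<close> and \<open>smap i\<close> are
  \<open>T\<^sub>i\<close>, \<open>\<sigma>(T\<^sub>i)\<close> and the restriction of \<open>\<sigma>\<close> to \<open>T\<^sub>i\<close>.
\<close>

record ('a, 't) presub =
  tile :: "'t \<Rightarrow> 'a complex2"
  img :: "'t \<Rightarrow> ('a, 'a, 't) typed_complex"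
  smap :: "'t \<Rightarrow> 'a \<Rightarrow> 'a"

definition pre_substitution :: "('a, 't::finite) presub \<Rightarrow> bool" where
  "pre_substitution S \<longleftrightarrow> (\<forall>i.
     topological_polygon (tile S i) \<and> is_patch (tile S) (img S i) \<and>
     homeomorphic_map (ctop (tile S i)) (ctop (img S i)) (smap S i) \<and>
     smap S i ` verts (tile S i) \<subseteq> verts (img S i) \<inter> boundary_circle (img S i))"


section \<open>Iteration\<close>

text \<open>The number of edges of the edge path \<open>\<sigma>(e)\<close>, where \<open>e\<close> is an edge of \<open>T\<^sub>i\<close>.\<close>

definition path_length :: "('a, 't) presub \<Rightarrow> 't \<Rightarrow> 'a set \<Rightarrow> nat" where
  "path_length S i e = card {e' \<in> edges (img S i). e' \<subseteq> smap S i ` e}"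

definition balanced_edge ::
  "('a, 't) presub \<Rightarrow> ('p, 'a, 't) typed_complex \<Rightarrow> 'p set \<Rightarrow> bool" where
  "balanced_edge S P e \<longleftrightarrow>
     (\<forall>f\<in>faces P. \<forall>f'\<in>faces P. f \<noteq> f' \<and> e \<subseteq> closed_cell P f \<and> e \<subseteq> closed_cell P f' \<longrightarrow>
        path_length S (ftype P f) (fmap P f ` e) = path_length S (ftype P f') (fmap P f' ` e))"

text \<open>The subset \<open>\<sigma>(\<tau>\<^sub>f(c))\<close> of \<open>\<sigma>(type(f))\<close>, where \<open>c\<close> is a subset of the closed face \<open>f\<close> of \<open>P\<close>.\<close>

definition sub_image ::
  "('a, 't) presub \<Rightarrow> ('p, 'a, 't) typed_complex \<Rightarrow> 'p set \<Rightarrow> 'p set \<Rightarrow> 'a set" where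
  "sub_image S P f c = smap S (ftype P f) ` fmap P f ` c"

text \<open>
  Edge-to-edge gluing maps: for \<open>f\<close> and \<open>f'\<close> adjacent along \<open>e\<close>, \<open>h e f f'\<close> is an isomorphism of
  edge paths from \<open>\<sigma>(\<tau>\<^sub>f(e))\<close> to \<open>\<sigma>(\<tau>\<^bsub>f'\<^esub>(e))\<close> matching the images of each endpoint of \<open>e\<close>.
  (The map induced by \<open>\<sigma>\<close> itself matches endpoints but not necessarily the inner vertices.)
\<close>

definition edge_gluing ::
  "('a, 't) presub \<Rightarrow> ('p, 'a, 't) typed_complex \<Rightarrow>
   ('p set \<Rightarrow> 'p set \<Rightarrow> 'p set \<Rightarrow> 'a \<Rightarrow> 'a) \<Rightarrow> bool" where
  "edge_gluing S P h \<longleftrightarrow>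
     (\<forall>e\<in>edges P. \<forall>f\<in>faces P. \<forall>f'\<in>faces P.
        f \<noteq> f' \<and> e \<subseteq> closed_cell P f \<and> e \<subseteq> closed_cell P f' \<longrightarrow>
        cell_iso (h e f f')
          (restrict_complex (img S (ftype P f)) (sub_image S P f (closed_cell P e)))
          (restrict_complex (img S (ftype P f')) (sub_image S P f' (closed_cell P e))) \<and>
        (\<forall>v \<in> verts P \<inter> closed_cell P e.
           h e f f' (smap S (ftype P f) (fmap P f v)) = smap S (ftype P f') (fmap P f' v)) \<and>
        (\<forall>y \<in> sub_image S P f (closed_cell P e). h e f' f (h e f f' y) = y))"

definition gluing_rel ::
  "('a, 't) presub \<Rightarrow> ('p, 'a, 't) typed_complex \<Rightarrow>
   ('p set \<Rightarrow> 'p set \<Rightarrow> 'p set \<Rightarrow> 'a \<Rightarrow> 'a) \<Rightarrow> (('p set \<times> 'a) \<times> ('p set \<times> 'a)) set" where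
  "gluing_rel S P h = {((f, y), (f', h e f f' y)) | e f f' y.
     e \<in> edges P \<and> f \<in> faces P \<and> f' \<in> faces P \<and> f \<noteq> f' \<and>
     e \<subseteq> closed_cell P f \<and> e \<subseteq> closed_cell P f' \<and> y \<in> sub_image S P f (closed_cell P e)}"

text \<open>
  \<open>glued S P Q \<iota>\<close>: the patch \<open>Q\<close> is the quotient of the disjoint union of the patches
  \<open>\<sigma>(type(f))\<close>, \<open>f\<close> a face of \<open>P\<close>, by edge-to-edge gluing, where \<open>\<iota> f\<close> is the canonical map
  \<open>\<sigma>(type(f)) \<rightarrow> Q\<close>.  The relation \<^const>\<open>gluing_rel\<close> is symmetric, so its reflexive transitive closure
  is the equivalence it generates.  The maps of closed faces to polygons only matter up to
  cell-preserving isotopy, so they are compared cell by cell.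
\<close>

definition glued ::
  "('a, 't) presub \<Rightarrow> ('p, 'a, 't) typed_complex \<Rightarrow> ('p, 'a, 't) typed_complex \<Rightarrow>
   ('p set \<Rightarrow> 'a \<Rightarrow> 'p) \<Rightarrow> bool" where
  "glued S P Q \<iota> \<longleftrightarrow>
     is_patch (tile S) Q \<and>
     quotient_map (sum_topology (\<lambda>f. ctop (img S (ftype P f))) (faces P)) (ctop Q) (\<lambda>(f, y). \<iota> f y) \<and>
     (\<exists>h. edge_gluing S P h \<and>
        (\<forall>f\<in>faces P. \<forall>y\<in>topspace (ctop (img S (ftype P f))).
         \<forall>f'\<in>faces P. \<forall>y'\<in>topspace (ctop (img S (ftype P f'))).
           \<iota> f y = \<iota> f' y' \<longleftrightarrow> ((f, y), (f', y')) \<in> (gluing_rel S P h)\<^sup>*)) \<and>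
     verts Q = (\<Union>f\<in>faces P. \<iota> f ` verts (img S (ftype P f))) \<and>
     edges Q = (\<Union>f\<in>faces P. (`) (\<iota> f) ` edges (img S (ftype P f))) \<and>
     faces Q = (\<Union>f\<in>faces P. (`) (\<iota> f) ` faces (img S (ftype P f))) \<and>
     (\<forall>f\<in>faces P. let R = img S (ftype P f) in \<forall>g\<in>faces R.
        ftype Q (\<iota> f ` g) = ftype R g \<and>
        (\<forall>c\<in>cells (restrict_complex R (closed_cell R g)).
           fmap Q (\<iota> f ` g) ` \<iota> f ` c = fmap R g ` c))"

text \<open>The homeomorphism \<open>\<theta>\<close> from \<open>P\<close> to the glued patch \<open>Q\<close> is induced by \<open>\<sigma>\<close>.\<close>

definition induced_map ::
  "('a, 't) presub \<Rightarrow> ('p, 'a, 't) typed_complex \<Rightarrow> ('p, 'a, 't) typed_complex \<Rightarrow>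
   ('p set \<Rightarrow> 'a \<Rightarrow> 'p) \<Rightarrow> ('p \<Rightarrow> 'p) \<Rightarrow> bool" where
  "induced_map S P Q \<iota> \<theta> \<longleftrightarrow>
     homeomorphic_map (ctop P) (ctop Q) \<theta> \<and>
     (\<forall>f\<in>faces P. \<forall>c\<in>cells (restrict_complex P (closed_cell P f)).
        \<theta> ` c = \<iota> f ` sub_image S P f c)"

definition single_tile :: "('a, 't) presub \<Rightarrow> 't \<Rightarrow> ('p, 'a, 't) typed_complex \<Rightarrow> 'p set \<Rightarrow> bool" where
  "single_tile S i P f \<longleftrightarrow>
     is_patch (tile S) P \<and> faces P = {f} \<and> ftype P f = i \<and> topspace (ctop P) = closed_cell P f"

text \<open>
  \<open>iterate S p i P \<phi>\<close>: the patch \<open>P\<close> is (a model of) \<open>\<sigma>\<^sup>p(T\<^sub>i)\<close>, with homeomorphism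
  \<open>\<phi> = \<sigma>\<^sup>p : T\<^sub>i \<rightarrow> P\<close>.  All models are isomorphic as typed complexes, so the properties below
  do not depend on the model.  Gluing edge to edge is possible only along balanced edges.
\<close>

primrec iterate ::
  "('a, 't) presub \<Rightarrow> nat \<Rightarrow> 't \<Rightarrow> ('p, 'a, 't) typed_complex \<Rightarrow> ('a \<Rightarrow> 'p) \<Rightarrow> bool" where
  "iterate S 0 i P \<phi> \<longleftrightarrow>
     (\<exists>f. single_tile S i P f \<and>
        homeomorphic_map (ctop (tile S i)) (ctop P) \<phi> \<and>
        (\<forall>x\<in>topspace (ctop (tile S i)). fmap P f (\<phi> x) = x))"
| "iterate S (Suc p) i Q \<phi> \<longleftrightarrow>
     (\<exists>P \<psi> \<iota> \<theta>. iterate S p i P \<psi> \<and> glued S P Q \<iota> \<and> induced_map S P Q \<iota> \<theta> \<and>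
        (\<forall>x\<in>topspace (ctop (tile S i)). \<phi> x = \<theta> (\<psi> x)))"

text \<open>\<open>p_compatible S n\<close> is \<open>(n+1)\<close>-compatibility, as every pre-substitution is 1-compatible.\<close>

primrec p_compatible :: "('a, 't) presub \<Rightarrow> nat \<Rightarrow> bool" where
  "p_compatible S 0 \<longleftrightarrow> True"
| "p_compatible S (Suc n) \<longleftrightarrow> p_compatible S n \<and>
     (\<forall>i (P :: ('a, 'a, 't) typed_complex) \<phi>.
        iterate S (Suc n) i P \<phi> \<longrightarrow> (\<forall>e\<in>interior_edges P. balanced_edge S P e))"

definition compatible :: "('a, 't) presub \<Rightarrow> bool" where
  "compatible S \<longleftrightarrow> (\<forall>n. p_compatible S n)"


section \<open>Core, topological substitutions, primitivity\<close>

definition thick_boundary :: "('p, 'z) complex2_scheme \<Rightarrow> 'p set" where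
  "thick_boundary P = \<Union>{closed_cell P f | f. f \<in> faces P \<and>
     (\<exists>v \<in> verts P \<inter> boundary_circle P. v \<in> closed_cell P f)}"

definition core :: "('p, 'z) complex2_scheme \<Rightarrow> 'p set" where
  "core P = ctop P closure_of (topspace (ctop P) - thick_boundary P)"

definition topological_substitution :: "('a, 't::finite) presub \<Rightarrow> bool" where
  "topological_substitution S \<longleftrightarrow>
     pre_substitution S \<and> compatible S \<and>
     (\<exists>i k (P :: ('a, 'a, 't) typed_complex) \<phi>. k \<ge> 1 \<and> iterate S k i P \<phi> \<and> core P \<noteq> {})"

definition separated :: "('p, 'z) complex2_scheme \<Rightarrow> bool" where
  "separated P \<longleftrightarrow>
     (\<exists>f\<in>faces P. \<not> connectedin (ctop P) (topspace (ctop P) - closed_cell P f))"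

definition pure_primitive :: "('a, 't) presub \<Rightarrow> bool" where
  "pure_primitive S \<longleftrightarrow>
     (\<forall>i. \<not> separated (img S i)) \<and>
     (\<forall>i. \<exists>(P :: ('a, 'a, 't) typed_complex) \<phi>. iterate S 2 i P \<phi> \<and> \<not> separated P) \<and>
     (\<forall>i j. \<exists>f\<in>faces (img S i). f \<subseteq> core (img S i) \<and> ftype (img S i) f = j)"

text \<open>\<open>S'\<close> is the pre-substitution \<open>\<sigma>\<^sup>k\<close>.\<close>

definition is_power :: "('a, 't) presub \<Rightarrow> nat \<Rightarrow> ('a, 't) presub \<Rightarrow> bool" where
  "is_power S k S' \<longleftrightarrow>
     tile S' = tile S \<and> (\<forall>i. iterate S k i (img S' i) (smap S' i))"

definition primitive_substitution :: "('a, 't) presub \<Rightarrow> bool" where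
  "primitive_substitution S \<longleftrightarrow> (\<exists>k\<ge>1. \<exists>S'. is_power S k S' \<and> pure_primitive S')"


section \<open>The infinite complex and its geometric realizations\<close>

text \<open>
  \<open>sigma_infinity S t Y\<close>: the typed complex \<open>Y\<close> is (a model of) \<open>\<sigma>\<^sup>\<infinity>(T\<^sub>t)\<close>.  It is the increasing union
  of subcomplexes \<open>P k\<close> supported by \<open>A k\<close>, where \<open>P k\<close> is \<open>\<sigma>\<^sup>k(T\<^sub>t)\<close>; the first one is a face of type
  \<open>T\<^sub>t\<close> in the core of \<open>P 1 = \<sigma>(T\<^sub>t)\<close>.  That the gluing maps \<open>\<iota>\<close> do not depend on \<open>k\<close> says that the
  inclusion of \<open>\<sigma>\<^bsup>k+1\<^esup>(T\<^sub>t)\<close> in \<open>\<sigma>\<^bsup>k+2\<^esup>(T\<^sub>t)\<close> is the one obtained by applying \<open>\<sigma>\<close> to the inclusion of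
  \<open>\<sigma>\<^sup>k(T\<^sub>t)\<close> in \<open>\<sigma>\<^bsup>k+1\<^esup>(T\<^sub>t)\<close>.
\<close>

definition sigma_infinity ::
  "('a, 't) presub \<Rightarrow> 't \<Rightarrow> ('p, 'a, 't) typed_complex \<Rightarrow> bool" where
  "sigma_infinity S t Y \<longleftrightarrow> (\<exists>(A :: nat \<Rightarrow> 'p set) \<iota> f\<^sub>0.
     let P = (\<lambda>k. restrict_complex Y (A k)) in
       single_tile S t (P 0) f\<^sub>0 \<and> f\<^sub>0 \<subseteq> core (P 1) \<and>
       (\<forall>k. A k \<subseteq> A (Suc k) \<and> glued S (P k) (P (Suc k)) \<iota>) \<and>
       topspace (ctop Y) = (\<Union>k. A k) \<and>
       verts Y = (\<Union>k. verts (P k)) \<and>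
       edges Y = (\<Union>k. edges (P k)) \<and>
       faces Y = (\<Union>k. faces (P k)) \<and>
       (\<forall>C. closedin (ctop Y) C \<longleftrightarrow>
          C \<subseteq> topspace (ctop Y) \<and> (\<forall>k. closedin (ctop (P k)) (C \<inter> A k))))"

definition tiling_vertices :: "'l labelled_tile set \<Rightarrow> complex set" where
  "tiling_vertices \<T> = {z. \<exists>U\<subseteq>\<T>. card U = 3 \<and> (\<forall>u\<in>U. z \<in> fst u)}"

text \<open>
  The complex associated to a tiling, with given types and maps for its faces.  The open face of a
  tile is its interior.
\<close>

definition tiling_complex ::
  "geometry \<Rightarrow> 'l labelled_tile set \<Rightarrow> (complex set \<Rightarrow> 't) \<Rightarrow> (complex set \<Rightarrow> complex \<Rightarrow> 'a) \<Rightarrow>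
   (complex, 'a, 't) typed_complex" where
  "tiling_complex G \<T> ty \<tau> =
     \<lparr>ctop = top_of_set (plane G),
      verts = tiling_vertices \<T>,
      edges = components ((\<Union>u\<in>\<T>. frontier (fst u)) - tiling_vertices \<T>),
      faces = (\<lambda>u. interior (fst u)) ` \<T>,
      ftype = ty, fmap = \<tau>\<rparr>"

text \<open>
  The complex of the tiling is \<open>\<sigma>\<^sup>\<infinity>(T\<^sub>t)\<close>, the prototile of a face of type \<open>T\<^sub>i\<close> being \<open>proto i\<close>
  (different types being realized by different prototiles, as the complexes are isomorphic as
  labelled complexes).  The polygon \<open>T\<^sub>i\<close> is realized by \<open>\<rho> i\<close> on a representative \<open>R i\<close> of
  \<open>proto i\<close>, and each tile is an image \<open>g ` fst (R i)\<close>, \<open>g \<in> \<Gamma>\<close>, whose cells are the images of the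
  cells of \<open>R i\<close>: this is the gluing prescribed by the complex.
\<close>

definition geometric_realization ::
  "geometry \<Rightarrow> (complex \<Rightarrow> complex) set \<Rightarrow> 'l labelled_tile set set \<Rightarrow> 'l labelled_tile set \<Rightarrow>
   ('a, 't) presub \<Rightarrow> 't \<Rightarrow> bool" where
  "geometric_realization G \<Gamma> \<P> \<T> S t \<longleftrightarrow>
     (\<exists>(ty :: complex set \<Rightarrow> 't) (\<tau> :: complex set \<Rightarrow> complex \<Rightarrow> 'a)
       (proto :: 't \<Rightarrow> 'l labelled_tile set) (R :: 't \<Rightarrow> 'l labelled_tile) (\<rho> :: 't \<Rightarrow> 'a \<Rightarrow> complex).
       sigma_infinity S t (tiling_complex G \<T> ty \<tau>) \<and>
       inj proto \<and> range proto \<subseteq> \<P> \<and>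
       (\<forall>i. R i \<in> proto i \<and> homeomorphic_map (ctop (tile S i)) (top_of_set (fst (R i))) (\<rho> i)) \<and>
       (\<forall>u\<in>\<T>. let f = interior (fst u); i = ty f in
          prototile_of G \<Gamma> u = proto i \<and>
          (\<exists>g\<in>\<Gamma>. fst u = g ` fst (R i) \<and>
             (\<forall>c\<in>cells (tile S i). \<tau> f ` g ` \<rho> i ` c = c))))"

end

theory Submission
  imports Defs
begin

text \<open>
  Minimality follows from repetitivity: if every finite patch of the tiling \<open>x\<close> occurs, up to \<open>\<Gamma>\<close>, within a
  bounded distance of every point, then the same holds, with the same bound, in every tiling of the hull,
  since this is a closed condition.

  Every face \<open>f\<close> of \<open>\<sigma>\<^sup>\<infinity>(T)\<close> is subdivided into a supertile \<open>\<sigma>\<^sup>n(f)\<close>, and the supertiles of a fixed level cover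
  the plane.  By primitivity every supertile of a suitable level contains a face of type \<open>T\<close>, hence a
  supertile \<open>\<sigma>\<^sup>k(T)\<close>.  So it remains to see that two supertiles of the same level and type are congruent under
  \<open>\<Gamma>\<close>: this bounds their diameters, and makes all supertiles \<open>\<sigma>\<^sup>k(T)\<close> copies of the patch \<open>\<sigma>\<^sup>k(T)\<close> of \<open>x\<close>.
  Each pair of corresponding faces is related by an element of \<open>\<Gamma>\<close> respecting their cells.  For two faces
  adjacent along an edge these elements agree on the edge, hence they agree up to the reflection in the line
  of that edge, and the reflection is excluded because the two faces lie on different sides.  Since the faces
  of \<open>\<sigma>(T\<^sub>i)\<close> are connected through edges, an induction on the level, in which a common edge of two faces is
  subdivided in a way that only depends on its end points, gives the congruence.
\<close>

section \<open>The metric of the plane\<close>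

text \<open>The obstacle is that the definitions determine hardly any map pointwise. Gluing maps
  between edge paths are chosen separately for each edge, and face maps are compared only cell by
  cell, so two supertiles of the same type do not come with a map between them, let alone an
  isometry. What is canonical is the end points of an edge and, since an increasing permutation of
  finitely many points of an arc is trivial, the cells along the subdivided edge. The relation
  \<open>parallel\<close> therefore passes exactly this cell data down the levels. Metric
  information enters only at the last level, where single tiles of the same type are congruent by
  hypothesis. The second difficulty is that edges are arbitrary arcs, without straight sides or an
  evident notion of the two sides of an edge. Sides are needed only when a reflection preserves the
  arc and fixes its ends; then the arc is forced into the axis of the reflection, and the sides near
  an interior point are two half-discs in a suitable chart.\<close>

lemma open_plane: "open (plane G)"
  by (cases G) auto

text \<open>This is \<open>cosh d - 1\<close> for the hyperbolic distance d. It is rational in the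
  coordinates, so equality of distances becomes an algebraic condition.\<close>

definition hyp_ratio :: "complex \<Rightarrow> complex \<Rightarrow> real" where
  "hyp_ratio z w = 2 * (cmod (z - w))\<^sup>2 / ((1 - (cmod z)\<^sup>2) * (1 - (cmod w)\<^sup>2))"

lemma plane_dist_hyp: "plane_dist Hyperbolic z w = arcosh (1 + hyp_ratio z w)"
  by (simp add: hyp_ratio_def)

lemma disc_pos: "z \<in> ball 0 1 \<Longrightarrow> 0 < 1 - (cmod z)\<^sup>2"
  by (simp add: power_less_one_iff)

lemma hyp_ratio_nonneg: "z \<in> ball 0 1 \<Longrightarrow> w \<in> ball 0 1 \<Longrightarrow> 0 \<le> hyp_ratio z w"
  unfolding hyp_ratio_def using disc_pos [of z] disc_pos [of w]
  by (intro divide_nonneg_nonneg mult_nonneg_nonneg) auto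

text \<open>\<open>cosh\<close> undoes \<open>arcosh\<close> on the reals that are at least 1, and
  both arguments lie there.\<close>

lemma plane_dist_hyp_eq_iff:
  assumes "z \<in> ball 0 1" "w \<in> ball 0 1" "z' \<in> ball 0 1" "w' \<in> ball 0 1"
  shows "plane_dist Hyperbolic z w = plane_dist Hyperbolic z' w' \<longleftrightarrow> hyp_ratio z w = hyp_ratio z' w'"
proof
  assume "plane_dist Hyperbolic z w = plane_dist Hyperbolic z' w'"
  then have "cosh (arcosh (1 + hyp_ratio z w)) = cosh (arcosh (1 + hyp_ratio z' w'))"
    by (simp only: plane_dist_hyp)
  then show "hyp_ratio z w = hyp_ratio z' w'"
    using hyp_ratio_nonneg [OF assms(1,2)] hyp_ratio_nonneg [OF assms(3,4)] by simp
qed (simp only: plane_dist_hyp)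

lemma continuous_on_plane_dist [continuous_intros]:
  assumes "continuous_on A f" "continuous_on A g" "f ` A \<subseteq> plane G" "g ` A \<subseteq> plane G"
  shows "continuous_on A (\<lambda>x. plane_dist G (f x) (g x))"
proof (cases G)
  case Euclidean
  then show ?thesis using assms by (auto intro!: continuous_intros)
next
  case Hyperbolic
  have pos: "0 < 1 - (cmod (f x))\<^sup>2" "0 < 1 - (cmod (g x))\<^sup>2" if "x \<in> A" for x
    using assms(3,4) that Hyperbolic disc_pos by auto
  have "continuous_on A (\<lambda>x. hyp_ratio (f x) (g x))"
    unfolding hyp_ratio_def using pos by (intro continuous_intros assms) (auto dest: less_imp_neq)
  moreover have "1 \<le> 1 + hyp_ratio (f x) (g x)" if "x \<in> A" for x
    using that assms Hyperbolic by (auto intro!: hyp_ratio_nonneg)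
  ultimately have "continuous_on A (\<lambda>x. arcosh (1 + hyp_ratio (f x) (g x)))"
    by (intro continuous_on_compose2 [OF continuous_on_arcosh [OF order.refl]] continuous_intros) auto
  then show ?thesis unfolding Hyperbolic plane_dist_hyp .
qed

lemma plane_dist_self: "z \<in> plane G \<Longrightarrow> plane_dist G z z = 0"
  by (cases G) auto

lemma plane_dist_nonneg:
  assumes "z \<in> plane G" "w \<in> plane G" shows "0 \<le> plane_dist G z w"
proof (cases G)
  case Hyperbolic
  then have "0 \<le> hyp_ratio z w" using assms hyp_ratio_nonneg by simp
  then show ?thesis unfolding Hyperbolic plane_dist_hyp by simp
qed simp

text \<open>A continuous function of the distance, vanishing at 0, that dominates the squared
  Euclidean distance in both geometries. It makes the continuity of isometries a single
  argument.\<close>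

definition gauge :: "geometry \<Rightarrow> real \<Rightarrow> real" where
  "gauge G d = (case G of Euclidean \<Rightarrow> d\<^sup>2 | Hyperbolic \<Rightarrow> cosh d - 1)"

text \<open>In the disc both denominators of \<open>hyp_ratio\<close> are at most 1, so dropping
  them only decreases the ratio.\<close>

lemma dist_le_gauge:
  assumes "z \<in> plane G" "w \<in> plane G"
  shows "(dist z w)\<^sup>2 \<le> gauge G (plane_dist G z w)"
proof (cases G)
  case Hyperbolic
  then have b: "z \<in> ball 0 1" "w \<in> ball 0 1" using assms by auto
  then have r: "0 \<le> hyp_ratio z w" by (rule hyp_ratio_nonneg)
  have pos: "0 < 1 - (cmod z)\<^sup>2" "0 < 1 - (cmod w)\<^sup>2" using b disc_pos by blast+
  then have p: "0 < (1 - (cmod z)\<^sup>2) * (1 - (cmod w)\<^sup>2)" by simp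
  have "(1 - (cmod z)\<^sup>2) * (1 - (cmod w)\<^sup>2) \<le> 1 * 1"
    using pos by (intro mult_mono) auto
  then have "hyp_ratio z w * ((1 - (cmod z)\<^sup>2) * (1 - (cmod w)\<^sup>2)) \<le> hyp_ratio z w * 1"
    using r by (intro mult_left_mono) auto
  moreover have "hyp_ratio z w * ((1 - (cmod z)\<^sup>2) * (1 - (cmod w)\<^sup>2)) = 2 * (cmod (z - w))\<^sup>2"
    using p unfolding hyp_ratio_def by (metis less_irrefl nonzero_eq_divide_eq)
  ultimately have "2 * (cmod (z - w))\<^sup>2 \<le> hyp_ratio z w" by simp
  then have "(cmod (z - w))\<^sup>2 \<le> hyp_ratio z w"
    by (smt (verit) zero_le_power2)
  moreover have "cosh (plane_dist G z w) = 1 + hyp_ratio z w"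
    unfolding Hyperbolic plane_dist_hyp using r by simp
  ultimately show ?thesis using Hyperbolic by (simp add: dist_norm gauge_def)
qed (simp add: gauge_def)

lemma compact_plane_cball:
  assumes "b \<in> plane G" shows "compact (plane_cball G b r)"
proof (cases G)
  case Euclidean
  have "plane_cball G b r = cball b r" unfolding plane_cball_def Euclidean by auto
  then show ?thesis by simp
next
  case Hyperbolic
  define C where "C = cosh r - 1"
  show ?thesis
  proof (cases "r < 0")
    case True
    then have "plane_cball G b r = {}"
      using plane_dist_nonneg [OF assms] unfolding plane_cball_def by force
    then show ?thesis by simp
  next
    case False
    \<comment> \<open>The inequality \<open>hyp_ratio b Q \<le> C\<close> with denominators cleared,
      which makes sense and is closed on the closed disc. On the unit circle its right side vanishes
      and would force Q = b, so the set stays inside the open disc.\<close>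
    let ?K = "{Q \<in> cball 0 1. 2 * (cmod (b - Q))\<^sup>2 \<le> C * ((1 - (cmod b)\<^sup>2) * (1 - (cmod Q)\<^sup>2))}"
    have b: "b \<in> ball 0 1" using assms Hyperbolic by simp
    then have pb: "0 < 1 - (cmod b)\<^sup>2" using disc_pos by blast
    have iff: "plane_dist G b Q \<le> r \<longleftrightarrow> 2 * (cmod (b - Q))\<^sup>2 \<le> C * ((1 - (cmod b)\<^sup>2) * (1 - (cmod Q)\<^sup>2))"
      if "Q \<in> ball 0 1" for Q
    proof -
      have pQ: "0 < 1 - (cmod Q)\<^sup>2" using that disc_pos by blast
      have h: "0 \<le> hyp_ratio b Q" using b that by (rule hyp_ratio_nonneg)
      then have "plane_dist G b Q \<le> r \<longleftrightarrow> 1 + hyp_ratio b Q \<le> cosh r"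
        unfolding Hyperbolic plane_dist_hyp using False
        by (metis arcosh_cosh_real arcosh_less_iff_real cosh_real_ge_1 le_add_same_cancel1 linorder_not_less)
      also have "\<dots> \<longleftrightarrow> hyp_ratio b Q \<le> C" unfolding C_def by auto
      also have "\<dots> \<longleftrightarrow> 2 * (cmod (b - Q))\<^sup>2 \<le> C * ((1 - (cmod b)\<^sup>2) * (1 - (cmod Q)\<^sup>2))"
        unfolding hyp_ratio_def using pb pQ by (intro pos_divide_le_eq) simp
      finally show ?thesis .
    qed
    have "Q \<in> ball 0 1" if "Q \<in> ?K" for Q
    proof (rule ccontr)
      assume "Q \<notin> ball 0 1"
      with that have "cmod Q = 1" by auto
      with that have "2 * (cmod (b - Q))\<^sup>2 \<le> 0" by auto
      then have "b = Q" by simp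
      with b \<open>cmod Q = 1\<close> show False by auto
    qed
    then have "plane_cball G b r = ?K"
      unfolding plane_cball_def using iff Hyperbolic by auto
    moreover have "compact ?K"
    proof -
      have "closed {Q. 2 * (cmod (b - Q))\<^sup>2 \<le> C * ((1 - (cmod b)\<^sup>2) * (1 - (cmod Q)\<^sup>2))}"
        by (intro closed_Collect_le continuous_intros)
      then have "compact (cball 0 1 \<inter> {Q. 2 * (cmod (b - Q))\<^sup>2 \<le> C * ((1 - (cmod b)\<^sup>2) * (1 - (cmod Q)\<^sup>2))})"
        by (intro compact_Int_closed compact_cball)
      then show ?thesis by (simp add: Int_def)
    qed
    ultimately show ?thesis by simp
  qed
qed

lemma compact_subset_plane_cball:
  assumes "compact K" "K \<subseteq> plane G" "b \<in> plane G"
  obtains \<rho> where "\<rho> > 0" "K \<subseteq> plane_cball G b \<rho>"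
proof -
  have "continuous_on K (\<lambda>Q. plane_dist G b Q)"
    using assms by (intro continuous_intros) auto
  then have "compact ((\<lambda>Q. plane_dist G b Q) ` K)"
    using assms compact_continuous_image by blast
  then obtain B where "\<And>Q. Q \<in> K \<Longrightarrow> \<bar>plane_dist G b Q\<bar> \<le> B"
    using compact_imp_bounded bounded_real by (metis image_eqI)
  then have "K \<subseteq> plane_cball G b (max B 1)"
    using assms(2) unfolding plane_cball_def by fastforce
  then show thesis using that [of "max B 1"] by simp
qed

section \<open>Isometries\<close>

text \<open>No value outside the plane is prescribed, unlike for the elements of
  \<open>isom_group\<close>; composites and \<open>inv_into\<close> can then be used without
  restricting them.\<close>

definition isometry :: "geometry \<Rightarrow> (complex \<Rightarrow> complex) \<Rightarrow> bool" where
  "isometry G g \<longleftrightarrow> bij_betw g (plane G) (plane G) \<and>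
     (\<forall>z\<in>plane G. \<forall>w\<in>plane G. plane_dist G (g z) (g w) = plane_dist G z w)"

lemma isometry_in: "isometry G g \<Longrightarrow> z \<in> plane G \<Longrightarrow> g z \<in> plane G"
  by (auto simp: isometry_def bij_betw_def)

lemma isometry_image: "isometry G g \<Longrightarrow> g ` plane G = plane G"
  by (auto simp: isometry_def bij_betw_def)

lemma isometry_inj: "isometry G g \<Longrightarrow> inj_on g (plane G)"
  by (auto simp: isometry_def bij_betw_def)

lemma isometry_dist:
  "isometry G g \<Longrightarrow> z \<in> plane G \<Longrightarrow> w \<in> plane G \<Longrightarrow> plane_dist G (g z) (g w) = plane_dist G z w"
  by (auto simp: isometry_def)

text \<open>Squeeze: the squared Euclidean distance of the images is at most the gauge of their
  plane distance, which is that of the arguments and tends to 0.\<close>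

lemma continuous_on_isometry:
  assumes "isometry G g" shows "continuous_on (plane G) g"
proof -
  have "(g \<longlongrightarrow> g z) (at z within plane G)" if z: "z \<in> plane G" for z
  proof -
    let ?m = "gauge G"
    have "continuous_on (plane G) (\<lambda>w. plane_dist G z w)"
      using z by (intro continuous_on_plane_dist continuous_intros) auto
    then have "((\<lambda>w. plane_dist G z w) \<longlongrightarrow> plane_dist G z z) (at z within plane G)"
      using z by (simp add: continuous_on_def)
    then have "((\<lambda>w. plane_dist G z w) \<longlongrightarrow> 0) (at z within plane G)"
      using z by (simp add: plane_dist_self)
    then have "((\<lambda>w. ?m (plane_dist G z w)) \<longlongrightarrow> ?m 0) (at z within plane G)"
      unfolding gauge_def by (cases G) (auto simp only: geometry.case intro!: tendsto_intros)
    then have lim: "((\<lambda>w. ?m (plane_dist G z w)) \<longlongrightarrow> 0) (at z within plane G)"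
      by (cases G) (auto simp: gauge_def)
    have upper: "\<forall>\<^sub>F w in at z within plane G. (dist (g z) (g w))\<^sup>2 \<le> ?m (plane_dist G z w)"
      unfolding eventually_at_filter
    proof (intro always_eventually allI impI)
      fix w assume "w \<in> plane G"
      then show "(dist (g z) (g w))\<^sup>2 \<le> ?m (plane_dist G z w)"
        using dist_le_gauge [of "g z" G "g w"] isometry_in [OF assms] isometry_dist [OF assms] z by simp
    qed
    have lower: "\<forall>\<^sub>F w in at z within plane G. 0 \<le> (dist (g z) (g w))\<^sup>2" by simp
    have "((\<lambda>w. (dist (g z) (g w))\<^sup>2) \<longlongrightarrow> 0) (at z within plane G)"
      by (rule tendsto_sandwich [OF lower upper tendsto_const lim])
    then have "((\<lambda>w. sqrt ((dist (g z) (g w))\<^sup>2)) \<longlongrightarrow> sqrt 0) (at z within plane G)"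
      by (rule tendsto_real_sqrt)
    then have "((\<lambda>w. dist (g w) (g z)) \<longlongrightarrow> 0) (at z within plane G)"
      by (simp add: dist_commute)
    then show ?thesis by (rule tendsto_dist_iff [THEN iffD2])
  qed
  then show ?thesis by (simp add: continuous_on_def)
qed

lemma isometry_open_image:
  assumes "isometry G g" "open U" "U \<subseteq> plane G" shows "open (g ` U)"
  using assms continuous_on_subset [OF continuous_on_isometry] inj_on_subset [OF isometry_inj]
    invariance_of_domain by blast

lemma isometry_compose:
  assumes "isometry G g" "isometry G h" and eq: "\<And>z. z \<in> plane G \<Longrightarrow> k z = g (h z)"
  shows "isometry G k"
proof -
  have "bij_betw (g \<circ> h) (plane G) (plane G)"
    using assms bij_betw_trans by (metis isometry_def)
  then have "bij_betw k (plane G) (plane G)"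
    by (rule bij_betw_cong [THEN iffD1, rotated]) (simp add: eq)
  then show ?thesis
    using assms by (auto simp: isometry_def eq isometry_in)
qed

lemma isometry_inv_into:
  assumes "isometry G g" shows "isometry G (inv_into (plane G) g)"
proof -
  let ?h = "inv_into (plane G) g"
  have bij: "bij_betw ?h (plane G) (plane G)"
    using assms by (auto simp: isometry_def bij_betw_inv_into)
  have "plane_dist G (?h z) (?h w) = plane_dist G z w" if "z \<in> plane G" "w \<in> plane G" for z w
  proof -
    have "?h z \<in> plane G" "?h w \<in> plane G" using bij that by (auto simp: bij_betw_def)
    then have "plane_dist G (?h z) (?h w) = plane_dist G (g (?h z)) (g (?h w))"
      using isometry_dist [OF assms] by simp
    also have "\<dots> = plane_dist G z w"
      using that isometry_image [OF assms] by (simp add: f_inv_into_f)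
    finally show ?thesis .
  qed
  with bij show ?thesis by (auto simp: isometry_def)
qed

text \<open>The interior is taken in the complex numbers. Open subsets of the plane stay open under
  g and under its inverse by invariance of domain.\<close>

lemma isometry_interior_image:
  assumes "isometry G g" "A \<subseteq> plane G" shows "interior (g ` A) = g ` interior A"
proof (rule interior_unique)
  show "g ` interior A \<subseteq> g ` A" using interior_subset by blast
  show "open (g ` interior A)"
    using assms interior_subset by (intro isometry_open_image) auto
  fix U assume U: "U \<subseteq> g ` A" "open U"
  let ?h = "inv_into (plane G) g"
  have A: "g ` A \<subseteq> plane G" using assms isometry_in by blast
  have "open (?h ` U)"
    using U A isometry_inv_into [OF assms(1)] by (intro isometry_open_image) auto
  moreover have "?h ` U \<subseteq> A"
    using U assms isometry_inj [OF assms(1)] by (force simp: inv_into_f_f subset_iff)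
  ultimately have "?h ` U \<subseteq> interior A" by (rule interior_maximal [rotated])
  then have "g ` ?h ` U \<subseteq> g ` interior A" by blast
  moreover have "g ` ?h ` U = U"
    using U A isometry_image [OF assms(1)] image_inv_into_cancel by (metis order_trans)
  ultimately show "U \<subseteq> g ` interior A" by simp
qed

lemma is_tile_image:
  assumes "isometry G g" "is_tile G A" shows "is_tile G (g ` A)"
proof -
  have A: "compact A" "A \<subseteq> plane G" "closure (interior A) = A"
    using assms by (auto simp: is_tile_def)
  have cont: "continuous_on A g"
    using continuous_on_isometry [OF assms(1)] A continuous_on_subset by blast
  then have c: "compact (g ` A)" using A compact_continuous_image by blast
  have "g ` closure (interior A) \<subseteq> closure (g ` interior A)"
    by (rule image_closure_subset [OF _ closed_closure closure_subset]) (use A cont in simp)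
  moreover have "closure (g ` interior A) \<subseteq> g ` A"
    using c interior_subset by (intro closure_minimal) (auto intro: compact_imp_closed)
  ultimately have "closure (interior (g ` A)) = g ` A"
    using A isometry_interior_image [OF assms(1) A(2)] by simp
  moreover have "g ` A \<subseteq> plane G" using A isometry_in [OF assms(1)] by blast
  ultimately show ?thesis using c by (simp add: is_tile_def)
qed

section \<open>The isometry group and its subgroups\<close>

lemma isom_group_isometry: "g \<in> carrier (isom_group G) \<Longrightarrow> isometry G g"
  by (auto simp: isom_group_def isometry_def Bij_def)

lemma group_isom_group: "group (isom_group G)"
proof -
  let ?B = "BijGroup (plane G)"
  let ?H = "carrier (isom_group G)"
  interpret group ?B by (rule group_BijGroup)
  have H: "?H = {g \<in> Bij (plane G). isometry G g}"
    by (auto simp: isom_group_def isometry_def Bij_def)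
  have "subgroup ?H ?B"
  proof (rule subgroupI)
    show "?H \<subseteq> carrier ?B" by (auto simp: H BijGroup_def)
    have "isometry G (\<lambda>x\<in>plane G. x)"
      by (auto simp: isometry_def bij_betw_def inj_on_def)
    then show "?H \<noteq> {}" using id_Bij by (auto simp: H)
  next
    fix g assume g: "g \<in> ?H"
    then have "inv\<^bsub>?B\<^esub> g = (\<lambda>x\<in>plane G. inv_into (plane G) g x)"
      by (simp add: H inv_BijGroup)
    moreover have "isometry G (\<lambda>x\<in>plane G. inv_into (plane G) g x)"
      using isometry_inv_into [of G g] g
      by (auto simp: H isometry_def cong: bij_betw_cong)
    ultimately show "inv\<^bsub>?B\<^esub> g \<in> ?H"
      using g restrict_inv_into_Bij [of g "plane G"] by (simp add: H)
  next
    fix g h assume gh: "g \<in> ?H" "h \<in> ?H"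
    then have "g \<otimes>\<^bsub>?B\<^esub> h = compose (plane G) g h"
      by (simp add: H BijGroup_def)
    moreover have "isometry G (compose (plane G) g h)"
      by (rule isometry_compose [of G g h]) (use gh H in \<open>auto simp: compose_eq\<close>)
    ultimately show "g \<otimes>\<^bsub>?B\<^esub> h \<in> ?H"
      using gh compose_Bij [of g "plane G" h] by (simp add: H)
  qed
  moreover have "isom_group G = ?B\<lparr>carrier := ?H\<rparr>" by (simp add: isom_group_def)
  ultimately show ?thesis
    using subgroup.subgroup_is_group is_group by metis
qed

context
  fixes G \<Gamma> assumes \<Gamma>: "subgroup \<Gamma> (isom_group G)"
begin

lemma subgroup_isometry: "g \<in> \<Gamma> \<Longrightarrow> isometry G g"
  using \<Gamma> isom_group_isometry subgroup.mem_carrier by metis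

text \<open>The operations of \<open>isom_group\<close> are functions restricted to the plane. This
  fact and the next two state them by their values on the plane, which is the only form used
  later.\<close>

lemma subgroup_mult:
  assumes "g \<in> \<Gamma>" "h \<in> \<Gamma>"
  obtains k where "k \<in> \<Gamma>" "\<And>z. z \<in> plane G \<Longrightarrow> k z = g (h z)"
proof (rule that)
  show "g \<otimes>\<^bsub>isom_group G\<^esub> h \<in> \<Gamma>" using \<Gamma> assms by (simp add: subgroup.m_closed)
  have "g \<in> Bij (plane G)" "h \<in> Bij (plane G)"
    using \<Gamma> assms subgroup.mem_carrier by (fastforce simp: isom_group_def)+
  then show "(g \<otimes>\<^bsub>isom_group G\<^esub> h) z = g (h z)" if "z \<in> plane G" for z
    using that by (simp add: isom_group_def BijGroup_def compose_def)
qed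

lemma subgroup_one:
  obtains k where "k \<in> \<Gamma>" "\<And>z. z \<in> plane G \<Longrightarrow> k z = z"
proof (rule that)
  show "\<one>\<^bsub>isom_group G\<^esub> \<in> \<Gamma>" using \<Gamma> by (simp add: subgroup.one_closed)
  show "\<one>\<^bsub>isom_group G\<^esub> z = z" if "z \<in> plane G" for z
    using that by (simp add: isom_group_def BijGroup_def)
qed

lemma subgroup_inv:
  assumes "g \<in> \<Gamma>"
  obtains k where "k \<in> \<Gamma>" "\<And>z. z \<in> plane G \<Longrightarrow> k (g z) = z" "\<And>z. z \<in> plane G \<Longrightarrow> g (k z) = z"
proof -
  interpret group "isom_group G" by (rule group_isom_group)
  let ?k = "inv\<^bsub>isom_group G\<^esub> g"
  have k: "?k \<in> \<Gamma>" using \<Gamma> assms by (simp add: subgroup.m_inv_closed)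
  have g: "g \<in> carrier (isom_group G)" using \<Gamma> assms subgroup.mem_carrier by metis
  have b: "g \<in> Bij (plane G)" "?k \<in> Bij (plane G)"
    using \<Gamma> assms k subgroup.mem_carrier by (fastforce simp: isom_group_def)+
  have "?k \<otimes>\<^bsub>isom_group G\<^esub> g = \<one>\<^bsub>isom_group G\<^esub>" using g by simp
  then have "compose (plane G) ?k g = (\<lambda>z\<in>plane G. z)"
    using b by (simp add: isom_group_def BijGroup_def)
  then have 1: "?k (g z) = z" if "z \<in> plane G" for z
    using that by (metis compose_eq restrict_apply')
  have "g \<otimes>\<^bsub>isom_group G\<^esub> ?k = \<one>\<^bsub>isom_group G\<^esub>" using g by simp
  then have "compose (plane G) g ?k = (\<lambda>z\<in>plane G. z)"
    using b by (simp add: isom_group_def BijGroup_def)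
  then have 2: "g (?k z) = z" if "z \<in> plane G" for z
    using that by (metis compose_eq restrict_apply')
  show thesis by (rule that [OF k 1 2])
qed

end

section \<open>Repetitivity implies minimality\<close>

definition support :: "'l labelled_tile set \<Rightarrow> complex set" where
  "support p = (\<Union>u\<in>p. fst u)"

lemma act_eq: "act g p = (\<lambda>u. (g ` fst u, snd u)) ` p"
  by (simp add: act_def case_prod_unfold)

lemma support_act: "support (act g p) = g ` support p"
  by (simp add: support_def act_eq image_UN)

lemma act_mono: "p \<subseteq> q \<Longrightarrow> act g p \<subseteq> act g q"
  by (auto simp: act_eq)

text \<open>The support condition is there because k agrees with the composite on the plane
  only.\<close>

lemma act_compose:
  assumes "support p \<subseteq> plane G" "\<And>z. z \<in> plane G \<Longrightarrow> k z = g (h z)"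
  shows "act g (act h p) = act k p"
proof -
  have "(g ` h ` fst u, snd u) = (k ` fst u, snd u)" if "u \<in> p" for u
  proof -
    have "fst u \<subseteq> plane G" using assms(1) that by (auto simp: support_def)
    then have "g ` h ` fst u = k ` fst u"
      unfolding image_image using assms(2) by (intro image_cong) auto
    then show ?thesis by simp
  qed
  then show ?thesis by (simp add: act_eq image_image)
qed

lemma act_id:
  assumes "support p \<subseteq> plane G" "\<And>z. z \<in> plane G \<Longrightarrow> k z = z"
  shows "act k p = p"
proof -
  have "(k ` fst u, snd u) = u" if "u \<in> p" for u
  proof -
    have "fst u \<subseteq> plane G" using assms(1) that by (auto simp: support_def)
    then have "k ` fst u = (\<lambda>z. z) ` fst u"
      using assms(2) by (intro image_cong) auto
    then show ?thesis by simp
  qed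
  then show ?thesis by (simp add: act_eq)
qed

lemma tiling_prototile:
  assumes "is_tiling G \<Gamma> \<P> \<T>" "u \<in> \<T>"
  obtains w where "w \<in> labelled_tiles G" "tile_equiv G \<Gamma> `` {w} \<in> \<P>" "(w, u) \<in> tile_equiv G \<Gamma>"
proof -
  have "\<P> \<subseteq> labelled_tiles G // tile_equiv G \<Gamma>" "\<T> \<subseteq> \<Union>\<P>"
    using assms(1) by (simp_all add: is_tiling_def prototiles_def)
  then obtain C where C: "C \<in> \<P>" "u \<in> C" "C \<in> labelled_tiles G // tile_equiv G \<Gamma>"
    using assms(2) by blast
  from C(3) obtain w where w: "C = tile_equiv G \<Gamma> `` {w}" "w \<in> labelled_tiles G"
    by (rule quotientE)
  show thesis by (rule that [of w]) (use C w in simp_all)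
qed

lemma tiling_is_tile:
  assumes "is_tiling G \<Gamma> \<P> \<T>" "u \<in> \<T>" shows "is_tile G (fst u)"
  using tiling_prototile [OF assms] by (auto simp: tile_equiv_def labelled_tiles_def)

lemma tiling_support: "is_tiling G \<Gamma> \<P> \<T> \<Longrightarrow> support \<T> = plane G"
  by (simp add: is_tiling_def support_def)

lemma tiling_support_subset: "is_tiling G \<Gamma> \<P> \<T> \<Longrightarrow> p \<subseteq> \<T> \<Longrightarrow> support p \<subseteq> plane G"
  using tiling_support unfolding support_def by blast

lemma is_tiling_act:
  assumes T: "is_tiling G \<Gamma> \<P> \<T>" and g: "g \<in> \<Gamma>"
  shows "is_tiling G \<Gamma> \<P> (act g \<T>)"
proof -
  have \<Gamma>: "subgroup \<Gamma> (isom_group G)" using T by (simp add: is_tiling_def)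
  note iso = subgroup_isometry [OF \<Gamma> g]
  have tile: "is_tile G (g ` fst u)" if "u \<in> \<T>" for u
    using is_tile_image [OF iso tiling_is_tile [OF T that]] .
  have "(g ` fst u, snd u) \<in> \<Union>\<P>" if u: "u \<in> \<T>" for u
  proof -
    obtain w where C: "w \<in> labelled_tiles G" "tile_equiv G \<Gamma> `` {w} \<in> \<P>" "(w, u) \<in> tile_equiv G \<Gamma>"
      using tiling_prototile [OF T u] .
    then obtain h where h: "h \<in> \<Gamma>" "fst u = h ` fst w" "snd w = snd u"
      by (auto simp: tile_equiv_def)
    obtain k where k: "k \<in> \<Gamma>" "\<And>z. z \<in> plane G \<Longrightarrow> k z = g (h z)"
      by (rule subgroup_mult [OF \<Gamma> g h(1)]) (rule that)
    have "fst w \<subseteq> plane G" using C(1) by (auto simp: labelled_tiles_def is_tile_def)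
    then have "g ` fst u = k ` fst w"
      unfolding h(2) image_image using k(2) by (intro image_cong) auto
    then have "(g ` fst u, snd u) \<in> tile_equiv G \<Gamma> `` {w}"
      using C(1) h(3) k(1) tile [OF u] by (auto simp: tile_equiv_def labelled_tiles_def)
    then show ?thesis using C(2) by blast
  qed
  then have 1: "act g \<T> \<subseteq> \<Union>\<P>" by (auto simp: act_eq)
  have 2: "(\<Union>u\<in>act g \<T>. fst u) = plane G"
    using support_act [of g \<T>] tiling_support [OF T] isometry_image [OF iso] by (simp add: support_def)
  have 3: "interior (fst u) \<inter> interior (fst v) = {}"
    if uv: "u \<in> act g \<T>" "v \<in> act g \<T>" "u \<noteq> v" for u v
  proof -
    obtain u' v' where u': "u' \<in> \<T>" "u = (g ` fst u', snd u')" and v': "v' \<in> \<T>" "v = (g ` fst v', snd v')"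
      using uv(1,2) by (auto simp: act_eq)
    have "u' \<noteq> v'" using uv(3) u' v' by auto
    then have "interior (fst u') \<inter> interior (fst v') = {}"
      using T u' v' by (auto simp: is_tiling_def)
    moreover have sub: "fst u' \<subseteq> plane G" "fst v' \<subseteq> plane G"
      using tiling_is_tile [OF T] u' v' by (auto simp: is_tile_def)
    moreover have "inj_on g (plane G)" by (rule isometry_inj [OF iso])
    ultimately have "g ` interior (fst u') \<inter> g ` interior (fst v') = {}"
      using inj_on_image_Int [of g "plane G" "interior (fst u')" "interior (fst v')"] interior_subset
      by (metis image_empty order_trans)
    then show ?thesis using u' v' sub isometry_interior_image [OF iso] by simp
  qed
  show ?thesis using T 1 2 3 by (simp add: is_tiling_def)
qed

section \<open>Balls, displacement, the tiling distance, continuity of the action\<close>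

lemma plane_cball_image:
  assumes "isometry G h" "c \<in> plane G" shows "plane_cball G (h c) R = h ` plane_cball G c R"
proof
  show "h ` plane_cball G c R \<subseteq> plane_cball G (h c) R"
    using assms isometry_in isometry_dist by (fastforce simp: plane_cball_def)
  show "plane_cball G (h c) R \<subseteq> h ` plane_cball G c R"
  proof
    fix w assume w: "w \<in> plane_cball G (h c) R"
    then obtain z where "z \<in> plane G" "w = h z"
      using isometry_image [OF assms(1)] by (auto simp: plane_cball_def)
    with w show "w \<in> h ` plane_cball G c R"
      using assms isometry_dist by (fastforce simp: plane_cball_def)
  qed
qed

text \<open>Compactness of balls makes the supremum in \<open>displacement\<close> a genuine upper
  bound; for an unbounded set \<open>SUP\<close> would say nothing.\<close>

lemma bdd_above_displacement:
  assumes "b \<in> plane G" "isometry G g"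
  shows "bdd_above ((\<lambda>Q. plane_dist G Q (g Q)) ` plane_cball G b r)"
proof -
  have sub: "plane_cball G b r \<subseteq> plane G" by (auto simp: plane_cball_def)
  have "continuous_on (plane_cball G b r) (\<lambda>Q. plane_dist G Q (g Q))"
    using continuous_on_subset [OF continuous_on_isometry [OF assms(2)] sub] sub isometry_in [OF assms(2)]
    by (intro continuous_intros) auto
  then have "compact ((\<lambda>Q. plane_dist G Q (g Q)) ` plane_cball G b r)"
    using compact_plane_cball [OF assms(1)] compact_continuous_image by blast
  then show ?thesis by (simp add: bounded_imp_bdd_above compact_imp_bounded)
qed

text \<open>The bound \<epsilon> \<le> 1 discards the default element 1 of the infimum.\<close>

lemma tiling_dist_less_iff:
  assumes "\<epsilon> \<le> 1"
  shows "tiling_dist G \<Gamma> b x y < \<epsilon> \<longleftrightarrow> (\<exists>r. 0 < r \<and> r < \<epsilon> \<and>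
     (\<exists>p \<in> patches_over (plane_cball G b (1/r)) x. \<exists>q \<in> patches_over (plane_cball G b (1/r)) y.
       \<exists>g\<in>\<Gamma>. act g p = q \<and> displacement G b (1/r) g \<le> r))"
proof -
  have "bdd_below ({1} \<union> {r. r > 0 \<and>
     (\<exists>p \<in> patches_over (plane_cball G b (1/r)) x. \<exists>q \<in> patches_over (plane_cball G b (1/r)) y.
       \<exists>g\<in>\<Gamma>. act g p = q \<and> displacement G b (1/r) g \<le> r)})"
    by (rule bdd_belowI [of _ 0]) auto
  then show ?thesis
    unfolding tiling_dist_def using assms by (subst cInf_less_iff) auto
qed

lemma tiling_dist_lessE:
  assumes "tiling_dist G \<Gamma> b x y < \<epsilon>" "\<epsilon> \<le> 1"
  obtains r p q g where "0 < r" "r < \<epsilon>" "p \<in> patches_over (plane_cball G b (1/r)) x"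
    "q \<in> patches_over (plane_cball G b (1/r)) y" "g \<in> \<Gamma>" "act g p = q" "displacement G b (1/r) g \<le> r"
  using assms(1) unfolding tiling_dist_less_iff [OF assms(2)] by blast

lemma tiling_dist_lessI:
  assumes "0 < r" "r < \<epsilon>" "\<epsilon> \<le> 1" "p \<in> patches_over (plane_cball G b (1/r)) x"
    "act g p \<in> patches_over (plane_cball G b (1/r)) y" "g \<in> \<Gamma>" "displacement G b (1/r) g \<le> r"
  shows "tiling_dist G \<Gamma> b x y < \<epsilon>"
  using assms unfolding tiling_dist_less_iff [OF assms(3)] by blast

lemma plane_cball_subset: "plane_cball G b r \<subseteq> plane G"
  by (auto simp: plane_cball_def)

lemma center_in_plane_cball: "b \<in> plane G \<Longrightarrow> 0 \<le> r \<Longrightarrow> b \<in> plane_cball G b r"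
  by (simp add: plane_cball_def plane_dist_self del: plane_dist.simps)

lemma patches_over_act:
  assumes g: "isometry G g" and p: "p \<in> patches_over B w"
    and w: "support w \<subseteq> plane G" and B: "B' \<subseteq> g ` B"
  shows "act g p \<in> patches_over B' (act g w)"
proof -
  have p': "p \<subseteq> w" "finite p" "connected (support p)" "B \<subseteq> support p"
    using p unfolding patches_over_def support_def by blast+
  have "support p \<subseteq> plane G" using p'(1) w unfolding support_def by blast
  then have "connected (g ` support p)"
    using p'(3) continuous_on_subset [OF continuous_on_isometry [OF g]] connected_continuous_image by blast
  moreover have "B' \<subseteq> g ` support p" using B p'(4) by blast
  ultimately have "connected (support (act g p))" "B' \<subseteq> support (act g p)"
    by (simp_all add: support_act)
  moreover have "finite (act g p)" using p'(2) by (simp add: act_eq)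
  ultimately show ?thesis
    using act_mono [OF p'(1)] unfolding patches_over_def support_def by blast
qed

lemma topspace_tiling_topology: "topspace (tiling_topology G \<Gamma> b \<P>) = tilings G \<Gamma> \<P>"
proof
  show "topspace (tiling_topology G \<Gamma> b \<P>) \<subseteq> tilings G \<Gamma> \<P>"
    using openin_topspace [of "tiling_topology G \<Gamma> b \<P>"] unfolding openin_tiling_topology by simp
  have "openin (tiling_topology G \<Gamma> b \<P>) (tilings G \<Gamma> \<P>)"
    unfolding openin_tiling_topology using zero_less_one by blast
  then show "tilings G \<Gamma> \<P> \<subseteq> topspace (tiling_topology G \<Gamma> b \<P>)" by (rule openin_subset)
qed

text \<open>This is continuity of the action of g. If h matches w and y over a ball containing the
  preimage under g of a given ball, then the conjugate of h by g matches the moved tilings over that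
  ball; its displacement at Q is that of h at the preimage of Q.\<close>

lemma openin_act_vimage:
  fixes \<P> :: "'a labelled_tile set set"
  assumes \<Gamma>: "subgroup \<Gamma> (isom_group G)" and g: "g \<in> \<Gamma>" and b: "b \<in> plane G"
    and U: "openin (tiling_topology G \<Gamma> b \<P>) U"
  shows "openin (tiling_topology G \<Gamma> b \<P>) {w \<in> tilings G \<Gamma> \<P>. act g w \<in> U}"
  unfolding openin_tiling_topology
proof (intro conjI ballI)
  fix w assume "w \<in> {w \<in> tilings G \<Gamma> \<P>. act g w \<in> U}"
  then have w: "w \<in> tilings G \<Gamma> \<P>" "act g w \<in> U" by auto
  obtain \<epsilon>' where "\<epsilon>' > 0"
    and "\<And>y. y \<in> tilings G \<Gamma> \<P> \<Longrightarrow> tiling_dist G \<Gamma> b (act g w) y < \<epsilon>' \<Longrightarrow> y \<in> U"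
    using U w(2) unfolding openin_tiling_topology by blast
  then obtain \<epsilon> where \<epsilon>: "\<epsilon> > 0" "\<epsilon> \<le> 1"
    and in_U: "\<And>y. y \<in> tilings G \<Gamma> \<P> \<Longrightarrow> tiling_dist G \<Gamma> b (act g w) y < \<epsilon> \<Longrightarrow> y \<in> U"
    using that [of "min \<epsilon>' 1"] by auto
  \<comment> \<open>Half of \<epsilon>, because \<open>tiling_dist_lessI\<close> needs a radius
    strictly below \<epsilon>.\<close>
  define s where "s = \<epsilon> / 2"
  have s: "0 < s" "s < \<epsilon>" using \<epsilon> by (auto simp: s_def)
  obtain g' where g': "g' \<in> \<Gamma>" "\<And>z. z \<in> plane G \<Longrightarrow> g' (g z) = z" "\<And>z. z \<in> plane G \<Longrightarrow> g (g' z) = z"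
    by (rule subgroup_inv [OF \<Gamma> g]) (rule that)
  note iso = subgroup_isometry [OF \<Gamma>]
  let ?K = "plane_cball G b (1/s)"
  have K: "compact ?K" "?K \<subseteq> plane G" using compact_plane_cball [OF b] plane_cball_subset by auto
  have "compact (g' ` ?K)" "g' ` ?K \<subseteq> plane G"
    using K continuous_on_subset [OF continuous_on_isometry [OF iso [OF g'(1)]]] compact_continuous_image
      isometry_in [OF iso [OF g'(1)]] by blast+
  then obtain \<rho> where \<rho>: "\<rho> > 0" "g' ` ?K \<subseteq> plane_cball G b \<rho>"
    using compact_subset_plane_cball [of _ G b] b by blast
  show "\<exists>\<delta>>0. \<forall>y\<in>tilings G \<Gamma> \<P>. tiling_dist G \<Gamma> b w y < \<delta> \<longrightarrow> y \<in> {w \<in> tilings G \<Gamma> \<P>. act g w \<in> U}"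
  \<comment> \<open>A radius r below 1/\<rho> makes the ball of radius 1/r contain the preimage of
    \<open>?K\<close>; r below s bounds the displacement of the conjugate by s.\<close>
  proof (intro exI [of _ "min (1/\<rho>) s"] conjI ballI impI CollectI)
    show "0 < min (1/\<rho>) s" using \<rho> s by simp
    fix y assume y: "y \<in> tilings G \<Gamma> \<P>" and d: "tiling_dist G \<Gamma> b w y < min (1/\<rho>) s"
    show "y \<in> tilings G \<Gamma> \<P>" by (rule y)
    have le: "min (1/\<rho>) s \<le> 1" using s \<epsilon> by auto
    obtain r p q h where r: "0 < r" "r < min (1/\<rho>) s"
      and p: "p \<in> patches_over (plane_cball G b (1/r)) w" and q: "q \<in> patches_over (plane_cball G b (1/r)) y"
      and h: "h \<in> \<Gamma>" "act h p = q" "displacement G b (1/r) h \<le> r"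
      using tiling_dist_lessE [OF d le] .
    have "\<rho> < 1 / r" using r \<rho> by (simp add: field_simps)
    then have Kr: "g' ` ?K \<subseteq> plane_cball G b (1/r)" using \<rho> by (force simp: plane_cball_def)
    have patch: "act g p' \<in> patches_over ?K (act g w')"
      if "p' \<in> patches_over (plane_cball G b (1/r)) w'" "w' \<in> tilings G \<Gamma> \<P>" for p' w'
    proof (rule patches_over_act [OF iso [OF g] that(1)])
      show "support w' \<subseteq> plane G" using that(2) tiling_support [of G \<Gamma> \<P> w'] by (simp add: tilings_def)
      show "?K \<subseteq> g ` plane_cball G b (1/r)"
      proof
        fix z assume z: "z \<in> ?K"
        then have "g' z \<in> plane_cball G b (1/r)" using Kr by blast
        moreover have "z = g (g' z)" using g'(3) [of z] z K(2) by auto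
        ultimately show "z \<in> g ` plane_cball G b (1/r)" by blast
      qed
    qed
    obtain k where k: "k \<in> \<Gamma>" "\<And>z. z \<in> plane G \<Longrightarrow> k z = h (g' z)"
      by (rule subgroup_mult [OF \<Gamma> h(1) g'(1)]) (rule that)
    obtain l where l: "l \<in> \<Gamma>" "\<And>z. z \<in> plane G \<Longrightarrow> l z = g (k z)"
      by (rule subgroup_mult [OF \<Gamma> g k(1)]) (rule that)
    have ps: "support p \<subseteq> plane G"
    proof -
      have "p \<subseteq> w" using p unfolding patches_over_def by blast
      moreover have "is_tiling G \<Gamma> \<P> w" using w(1) by (simp add: tilings_def)
      ultimately show ?thesis using tiling_support_subset by metis
    qed
    have gps: "support (act g p) \<subseteq> plane G"
      using ps isometry_in [OF iso [OF g]] unfolding support_act by blast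
    have "act l (act g p) = act g (act k (act g p))"
      by (rule act_compose [symmetric, OF gps]) (rule l(2))
    also have "act k (act g p) = act h p"
      by (rule act_compose [OF ps]) (simp add: k(2) g'(2) isometry_in [OF iso [OF g]])
    finally have "act l (act g p) = act g q" using h(2) by simp
    moreover have "displacement G b (1/s) l \<le> s"
      unfolding displacement_def
    proof (rule cSUP_least)
      show "?K \<noteq> {}" using center_in_plane_cball [OF b, of "1/s"] s by auto
      fix Q assume Q: "Q \<in> ?K"
      then have "Q \<in> plane G" using K by blast
      then have Q': "g' Q \<in> plane G" "h (g' Q) \<in> plane G" "g (g' Q) = Q" "l Q = g (h (g' Q))"
        using isometry_in [OF iso] g'(1,3) h(1) l k by auto
      then have "plane_dist G Q (l Q) = plane_dist G (g' Q) (h (g' Q))"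
        using isometry_dist [OF iso [OF g], of "g' Q" "h (g' Q)"] by simp
      also have "\<dots> \<le> displacement G b (1/r) h"
        unfolding displacement_def
        by (rule cSUP_upper [OF _ bdd_above_displacement [OF b iso [OF h(1)]]]) (use Q Kr in blast)
      finally show "plane_dist G Q (l Q) \<le> s" using h(3) r by simp
    qed
    ultimately have "tiling_dist G \<Gamma> b (act g w) (act g y) < \<epsilon>"
      using patch [OF p w(1)] patch [OF q y] l(1) s \<epsilon>(2)
      by (intro tiling_dist_lessI [where r = s and p = "act g p" and g = l]) auto
    moreover have "act g y \<in> tilings G \<Gamma> \<P>"
      using is_tiling_act [OF _ g] y unfolding tilings_def by blast
    ultimately show "act g y \<in> U" using in_U by blast
  qed
qed auto

text \<open>The interior of u is open and misses the interiors of the other tiles, hence also their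
  closures, which are these tiles. So tiles different from u cannot cover it.\<close>

lemma tile_mem_of_covered:
  assumes T: "is_tiling G \<Gamma> \<P> \<T>" and q: "q \<subseteq> \<T>" "finite q"
    and u: "u \<in> \<T>" "fst u \<noteq> {}" "fst u \<subseteq> support q"
  shows "u \<in> q"
proof (rule ccontr)
  assume "u \<notin> q"
  have tile: "closure (interior (fst v)) = fst v" if "v \<in> \<T>" for v
    using tiling_is_tile [OF T that] by (simp add: is_tile_def)
  have ne: "interior (fst u) \<noteq> {}" using tile [OF u(1)] u(2) by force
  have "interior (fst u) \<inter> fst v = {}" if "v \<in> q" for v
  proof -
    have "interior (fst u) \<inter> interior (fst v) = {}"
      using T u(1) that q(1) \<open>u \<notin> q\<close> unfolding is_tiling_def by (metis subsetD)
    then have "interior (fst u) \<inter> closure (interior (fst v)) = {}"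
      by (simp add: open_Int_closure_eq_empty)
    then show ?thesis using tile [of v] that q by auto
  qed
  then show False using ne u(3) interior_subset unfolding support_def by fast
qed

text \<open>The radius R is a parameter and not quantified: closedness is obtained for a fixed
  bound.\<close>

definition recurrent ::
  "geometry \<Rightarrow> (complex \<Rightarrow> complex) set \<Rightarrow> 'l labelled_tile set \<Rightarrow> real \<Rightarrow> 'l labelled_tile set \<Rightarrow> bool" where
  "recurrent G \<Gamma> p R w \<longleftrightarrow>
     (\<forall>c\<in>plane G. \<exists>g\<in>\<Gamma>. act g p \<subseteq> w \<and> support (act g p) \<subseteq> plane_cball G c R)"

text \<open>A failure at c is visible in the ball of radius R around c. A tiling y close to w agrees
  with w over this ball up to some h, so a copy of p in y near h c would pull back to a forbidden
  copy in w near c.\<close>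

lemma openin_not_recurrent:
  assumes b: "b \<in> plane G" and \<Gamma>: "subgroup \<Gamma> (isom_group G)"
    and ps: "support p \<subseteq> plane G" and ne: "\<And>u. u \<in> p \<Longrightarrow> fst u \<noteq> {}"
  shows "openin (tiling_topology G \<Gamma> b \<P>) {w \<in> tilings G \<Gamma> \<P>. \<not> recurrent G \<Gamma> p R w}"
  unfolding openin_tiling_topology
proof (intro conjI ballI)
  note iso = subgroup_isometry [OF \<Gamma>]
  show "{w \<in> tilings G \<Gamma> \<P>. \<not> recurrent G \<Gamma> p R w} \<subseteq> tilings G \<Gamma> \<P>" by blast
  fix w assume "w \<in> {w \<in> tilings G \<Gamma> \<P>. \<not> recurrent G \<Gamma> p R w}"
  then have w: "w \<in> tilings G \<Gamma> \<P>" "\<not> recurrent G \<Gamma> p R w" by auto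
  then obtain c where c: "c \<in> plane G"
    and bad: "\<not> (\<exists>g\<in>\<Gamma>. act g p \<subseteq> w \<and> support (act g p) \<subseteq> plane_cball G c R)"
    unfolding recurrent_def by blast
  obtain \<rho> where \<rho>: "\<rho> > 0" "plane_cball G c R \<subseteq> plane_cball G b \<rho>"
    by (rule compact_subset_plane_cball [OF compact_plane_cball [OF c] plane_cball_subset b])
  show "\<exists>\<epsilon>>0. \<forall>y\<in>tilings G \<Gamma> \<P>. tiling_dist G \<Gamma> b w y < \<epsilon> \<longrightarrow> y \<in> {w \<in> tilings G \<Gamma> \<P>. \<not> recurrent G \<Gamma> p R w}"
  \<comment> \<open>1/\<rho> makes the matched patches cover the ball around c; 1 is the limit under
    which \<open>tiling_dist_lessE\<close> applies.\<close>
  proof (intro exI [of _ "min (1/\<rho>) 1"] conjI ballI impI CollectI notI)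
    show "0 < min (1/\<rho>) 1" using \<rho> by simp
    fix y assume y: "y \<in> tilings G \<Gamma> \<P>" and d: "tiling_dist G \<Gamma> b w y < min (1/\<rho>) 1"
    show "y \<in> tilings G \<Gamma> \<P>" by (rule y)
    assume Cy: "recurrent G \<Gamma> p R y"
    obtain r p1 q1 h where r: "0 < r" "r < min (1/\<rho>) 1"
      and p1: "p1 \<in> patches_over (plane_cball G b (1/r)) w"
      and q1: "q1 \<in> patches_over (plane_cball G b (1/r)) y"
      and h: "h \<in> \<Gamma>" "act h p1 = q1"
      using tiling_dist_lessE [OF d min.cobounded2] .
    have "\<rho> < 1 / r" using r \<rho> by (simp add: field_simps)
    then have "plane_cball G c R \<subseteq> plane_cball G b (1/r)" using \<rho> by (force simp: plane_cball_def)
    then have "plane_cball G c R \<subseteq> support p1" using p1 unfolding patches_over_def support_def by blast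
    then have hB: "plane_cball G (h c) R \<subseteq> support q1"
      unfolding h(2) [symmetric] support_act plane_cball_image [OF iso [OF h(1)] c] by (rule image_mono)
    have "h c \<in> plane G" by (rule isometry_in [OF iso [OF h(1)] c])
    then obtain g where g: "g \<in> \<Gamma>" "act g p \<subseteq> y" "support (act g p) \<subseteq> plane_cball G (h c) R"
      using Cy unfolding recurrent_def by blast
    \<comment> \<open>Lying in y is not enough for pulling back by h: the tiles of the copy must
      belong to the matched patch \<open>q1\<close>. They do, because \<open>q1\<close> covers the
      ball containing them.\<close>
    have "u \<in> q1" if u: "u \<in> act g p" for u
    proof (rule tile_mem_of_covered)
      show "is_tiling G \<Gamma> \<P> y" using y by (simp add: tilings_def)
      show "q1 \<subseteq> y" "finite q1" using q1 unfolding patches_over_def by blast+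
      show "u \<in> y" using u g by blast
      show "fst u \<noteq> {}" using u ne unfolding act_eq by auto
      show "fst u \<subseteq> support q1" using u g(3) hB unfolding support_def by blast
    qed
    then have gq: "act g p \<subseteq> q1" by blast
    obtain h' where h': "h' \<in> \<Gamma>" "\<And>z. z \<in> plane G \<Longrightarrow> h' (h z) = z" "\<And>z. z \<in> plane G \<Longrightarrow> h (h' z) = z"
      by (rule subgroup_inv [OF \<Gamma> h(1)]) (rule that)
    obtain k where k: "k \<in> \<Gamma>" "\<And>z. z \<in> plane G \<Longrightarrow> k z = h' (g z)"
      by (rule subgroup_mult [OF \<Gamma> h'(1) g(1)]) (rule that)
    obtain e where e: "e \<in> \<Gamma>" "\<And>z. z \<in> plane G \<Longrightarrow> e z = z"
      by (rule subgroup_one [OF \<Gamma>]) (rule that)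
    have kp: "act k p = act h' (act g p)" by (rule act_compose [OF ps, symmetric], rule k(2))
    have p1s: "support p1 \<subseteq> plane G"
    proof -
      have "p1 \<subseteq> w" using p1 unfolding patches_over_def by blast
      moreover have "is_tiling G \<Gamma> \<P> w" using w(1) by (simp add: tilings_def)
      ultimately show ?thesis using tiling_support_subset by metis
    qed
    have "act h' q1 = act e p1"
      unfolding h(2) [symmetric] by (rule act_compose [OF p1s]) (simp add: e(2) h'(2))
    also have "\<dots> = p1" by (rule act_id [OF p1s e(2)])
    finally have "act k p \<subseteq> p1" using kp act_mono [OF gq, of h'] by simp
    then have "act k p \<subseteq> w" using p1 unfolding patches_over_def by blast
    moreover have "support (act k p) \<subseteq> plane_cball G c R"
    proof -
      have "support (act k p) \<subseteq> h' ` h ` plane_cball G c R"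
        unfolding kp support_act plane_cball_image [OF iso [OF h(1)] c, symmetric] using g(3)
        by (auto simp only: support_act)
      also have "\<dots> = plane_cball G c R"
      proof -
        have "h' (h z) = z" if "z \<in> plane_cball G c R" for z
          using that plane_cball_subset h'(2) by blast
        then show ?thesis by (simp add: image_image)
      qed
      finally show ?thesis .
    qed
    ultimately show False using bad k(1) by blast
  qed
qed

text \<open>F is any family of patches exhausting the compact sets, since these are the only patches
  needed to approximate a tiling.\<close>

theorem repetitive_imp_minimal:
  fixes \<T> :: "'l labelled_tile set"
  assumes b: "b \<in> plane G" and T: "is_tiling G \<Gamma> \<P> \<T>"
    and ne: "\<And>u. u \<in> \<T> \<Longrightarrow> fst u \<noteq> {}"
    and patch: "\<And>p. p \<in> F \<Longrightarrow> finite p \<and> p \<subseteq> \<T> \<and> connected (support p)"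
    and cover: "\<And>K. compact K \<Longrightarrow> K \<subseteq> plane G \<Longrightarrow> \<exists>p\<in>F. K \<subseteq> support p"
    and rep: "\<And>p. p \<in> F \<Longrightarrow> \<exists>R. \<forall>c\<in>plane G. \<exists>g\<in>\<Gamma>. act g p \<subseteq> \<T> \<and> support (act g p) \<subseteq> plane_cball G c R"
  shows "minimal_system (subtopology (tiling_topology G \<Gamma> b \<P>) (tiling_hull G \<Gamma> b \<P> \<T>)) (tiling_orbit \<Gamma>)"
proof -
  let ?X = "tiling_topology G \<Gamma> b \<P>"
  let ?H = "tiling_hull G \<Gamma> b \<P> \<T>"
  have \<Gamma>: "subgroup \<Gamma> (isom_group G)" using T by (simp add: is_tiling_def)
  note iso = subgroup_isometry [OF \<Gamma>]
  have in_hull: "z \<in> ?H \<longleftrightarrow> z \<in> tilings G \<Gamma> \<P> \<and> (\<forall>U. z \<in> U \<and> openin ?X U \<longrightarrow> (\<exists>g\<in>\<Gamma>. act g \<T> \<in> U))" for z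
    unfolding tiling_hull_def in_closure_of topspace_tiling_topology tiling_orbit_def by blast
  have hull_tiling: "z \<in> tilings G \<Gamma> \<P>" if "z \<in> ?H" for z
    using that in_hull [of z] by blast
  have hull_meets: "\<exists>g\<in>\<Gamma>. act g \<T> \<in> U" if "z \<in> ?H" "openin ?X U" "z \<in> U" for z U
    using that in_hull [of z] by blast
  have act_tilings: "act g w \<in> tilings G \<Gamma> \<P>" if "g \<in> \<Gamma>" "w \<in> tilings G \<Gamma> \<P>" for g w
    using that is_tiling_act unfolding tilings_def by blast
  have supp: "support w = plane G" if "w \<in> tilings G \<Gamma> \<P>" for w
    using that tiling_support [of G \<Gamma> \<P> w] by (simp add: tilings_def)
  have Tt: "\<T> \<in> tilings G \<Gamma> \<P>" using T by (simp add: tilings_def)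
  \<comment> \<open>Invariance of the hull: by continuity of the action, a neighbourhood of g z
    pulls back to one of z, which meets the orbit.\<close>
  have hull_act: "act g z \<in> ?H" if g: "g \<in> \<Gamma>" and z: "z \<in> ?H" for g z
    unfolding in_hull [of "act g z"]
  proof (intro conjI allI impI)
    show "act g z \<in> tilings G \<Gamma> \<P>" by (rule act_tilings [OF g hull_tiling [OF z]])
    fix U assume U: "act g z \<in> U \<and> openin ?X U"
    then have "openin ?X {w \<in> tilings G \<Gamma> \<P>. act g w \<in> U}"
      using openin_act_vimage [OF \<Gamma> g b] by blast
    then obtain h where h: "h \<in> \<Gamma>" "act g (act h \<T>) \<in> U"
      using hull_meets [OF z] U hull_tiling [OF z] by blast
    obtain k where "k \<in> \<Gamma>" "\<And>z. z \<in> plane G \<Longrightarrow> k z = g (h z)"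
      by (rule subgroup_mult [OF \<Gamma> g h(1)]) (rule that)
    then have "act k \<T> \<in> U"
      using h(2) act_compose [of \<T> G k g h] supp [OF Tt] by simp
    with \<open>k \<in> \<Gamma>\<close> show "\<exists>g\<in>\<Gamma>. act g \<T> \<in> U" by blast
  qed
  \<comment> \<open>Recurrence of p with radius R holds on the orbit of \<T> and is closed, hence
    holds at y; a copy near the base point b is then enough.\<close>
  have copy: "\<exists>g\<in>\<Gamma>. act g p \<subseteq> y" if p: "p \<in> F" and y: "y \<in> ?H" for p y
  proof -
    obtain R where R: "\<forall>c\<in>plane G. \<exists>g\<in>\<Gamma>. act g p \<subseteq> \<T> \<and> support (act g p) \<subseteq> plane_cball G c R"
      using rep [OF p] by (rule exE)
    define C where "C = recurrent G \<Gamma> p R"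
    have pT: "p \<subseteq> \<T>" "finite p" using patch [OF p] by auto
    have ps: "support p \<subseteq> plane G" using pT tiling_support_subset [OF T] by blast
    \<comment> \<open>An isometry maps balls to balls of the same radius, so R does not change along
      an orbit.\<close>
    have C_act: "C (act h w)" if Cw: "C w" and h: "h \<in> \<Gamma>" and wt: "w \<in> tilings G \<Gamma> \<P>" for h w
      unfolding C_def recurrent_def
    proof
      fix c assume c: "c \<in> plane G"
      obtain h' where h': "h' \<in> \<Gamma>" "\<And>z. z \<in> plane G \<Longrightarrow> h' (h z) = z" "\<And>z. z \<in> plane G \<Longrightarrow> h (h' z) = z"
        by (rule subgroup_inv [OF \<Gamma> h]) (rule that)
      have c': "h' c \<in> plane G" by (rule isometry_in [OF iso [OF h'(1)] c])
      then obtain g where g: "g \<in> \<Gamma>" "act g p \<subseteq> w" "support (act g p) \<subseteq> plane_cball G (h' c) R"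
        using Cw c' unfolding C_def recurrent_def by blast
      obtain k where k: "k \<in> \<Gamma>" "\<And>z. z \<in> plane G \<Longrightarrow> k z = h (g z)"
        by (rule subgroup_mult [OF \<Gamma> h g(1)]) (rule that)
      have eq: "act k p = act h (act g p)" by (rule act_compose [OF ps, symmetric], rule k(2))
      then have "support (act k p) \<subseteq> h ` plane_cball G (h' c) R"
        using image_mono [OF g(3)] by (simp only: support_act)
      then have "support (act k p) \<subseteq> plane_cball G c R"
        using plane_cball_image [OF iso [OF h] c'] h'(3) c by simp
      then show "\<exists>g\<in>\<Gamma>. act g p \<subseteq> act h w \<and> support (act g p) \<subseteq> plane_cball G c R"
        using k(1) eq act_mono [OF g(2), of h] by (intro bexI [of _ k] conjI) simp_all
    qed
    have "openin ?X {w \<in> tilings G \<Gamma> \<P>. \<not> C w}"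
      unfolding C_def by (rule openin_not_recurrent [OF b \<Gamma> ps]) (use ne pT in blast)
    moreover have "C (act g \<T>)" if "g \<in> \<Gamma>" for g
      by (rule C_act [OF _ that Tt]) (unfold C_def recurrent_def, rule R)
    ultimately have "C y"
      using hull_meets [OF y, of "{w \<in> tilings G \<Gamma> \<P>. \<not> C w}"] hull_tiling [OF y] by blast
    then show ?thesis using b unfolding C_def recurrent_def by blast
  qed
  have "z \<in> subtopology ?X ?H closure_of tiling_orbit \<Gamma> y"
    if y: "y \<in> topspace (subtopology ?X ?H)" and z: "z \<in> topspace (subtopology ?X ?H)" for y z
    unfolding in_closure_of
  proof (intro conjI allI impI)
    show "z \<in> topspace (subtopology ?X ?H)" by (rule z)
    fix V assume V: "z \<in> V \<and> openin (subtopology ?X ?H) V"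
    then obtain U where U: "openin ?X U" "V = U \<inter> ?H" by (auto simp: openin_subtopology)
    have "z \<in> ?H" "z \<in> U" and yH: "y \<in> ?H" using V U y z by auto
    \<comment> \<open>z is replaced by a point of the orbit of \<T> in the same open set; only \<T>
      and y remain to be compared.\<close>
    then obtain g1 where g1: "g1 \<in> \<Gamma>" "act g1 \<T> \<in> U" using hull_meets [OF _ U(1)] by blast
    then obtain \<epsilon>' where "\<epsilon>' > 0"
      and "\<And>y. y \<in> tilings G \<Gamma> \<P> \<Longrightarrow> tiling_dist G \<Gamma> b (act g1 \<T>) y < \<epsilon>' \<Longrightarrow> y \<in> U"
      using U(1) unfolding openin_tiling_topology by blast
    then obtain \<epsilon> where \<epsilon>: "\<epsilon> > 0" "\<epsilon> \<le> 1"
      and in_U: "\<And>y. y \<in> tilings G \<Gamma> \<P> \<Longrightarrow> tiling_dist G \<Gamma> b (act g1 \<T>) y < \<epsilon> \<Longrightarrow> y \<in> U"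
      using that [of "min \<epsilon>' 1"] by auto
    define s where "s = \<epsilon> / 2"
    have s: "0 < s" "s < \<epsilon>" using \<epsilon> by (auto simp: s_def)
    let ?K = "plane_cball G b (1/s)"
    obtain g1' where g1': "g1' \<in> \<Gamma>" "\<And>z. z \<in> plane G \<Longrightarrow> g1' (g1 z) = z" "\<And>z. z \<in> plane G \<Longrightarrow> g1 (g1' z) = z"
      by (rule subgroup_inv [OF \<Gamma> g1(1)]) (rule that)
    have K: "compact ?K" "?K \<subseteq> plane G" using compact_plane_cball [OF b] plane_cball_subset by auto
    have "compact (g1' ` ?K)" "g1' ` ?K \<subseteq> plane G"
      using K continuous_on_subset [OF continuous_on_isometry [OF iso [OF g1'(1)]]] compact_continuous_image
        isometry_in [OF iso [OF g1'(1)]] by blast+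
    \<comment> \<open>p is chosen so that its image under \<open>g1\<close> covers
      \<open>?K\<close>.\<close>
    then obtain p where p: "p \<in> F" "g1' ` ?K \<subseteq> support p" using cover by blast
    have pT: "p \<subseteq> \<T>" "finite p" "connected (support p)" using patch [OF p(1)] by auto
    have ps: "support p \<subseteq> plane G" using pT tiling_support_subset [OF T] by blast
    obtain g where g: "g \<in> \<Gamma>" "act g p \<subseteq> y" using copy [OF p(1) yH] by blast
    obtain g' where g': "g' \<in> \<Gamma>" "\<And>z. z \<in> plane G \<Longrightarrow> g' (g z) = z" "\<And>z. z \<in> plane G \<Longrightarrow> g (g' z) = z"
      by (rule subgroup_inv [OF \<Gamma> g(1)]) (rule that)
    \<comment> \<open>k carries the copy of p found in y onto the image of p under
      \<open>g1\<close>.\<close>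
    obtain k where k: "k \<in> \<Gamma>" "\<And>z. z \<in> plane G \<Longrightarrow> k z = g1 (g' z)"
      by (rule subgroup_mult [OF \<Gamma> g1(1) g'(1)]) (rule that)
    \<comment> \<open>The two tilings now share the patch \<open>?q\<close> itself, so the identity,
      of displacement 0, witnesses their closeness.\<close>
    obtain e where e: "e \<in> \<Gamma>" "\<And>z. z \<in> plane G \<Longrightarrow> e z = z"
      by (rule subgroup_one [OF \<Gamma>]) (rule that)
    have yt: "y \<in> tilings G \<Gamma> \<P>" by (rule hull_tiling [OF yH])
    let ?q = "act g1 p"
    have "act k (act g p) = ?q"
      by (rule act_compose [OF ps]) (simp add: k g' isometry_in [OF iso [OF g(1)]])
    then have qy: "?q \<subseteq> act k y" using act_mono [OF g(2)] by metis
    have qT: "?q \<subseteq> act g1 \<T>" using act_mono [OF pT(1)] .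
    have "?K \<subseteq> support ?q"
      proof
      fix z assume z: "z \<in> ?K"
      then have "g1' z \<in> support p" "g1 (g1' z) = z" using p(2) g1'(3) K(2) by blast+
      then show "z \<in> support ?q" unfolding support_act by force
    qed
    moreover have "connected (support ?q)"
      using pT(3) continuous_on_subset [OF continuous_on_isometry [OF iso [OF g1(1)]] ps]
        connected_continuous_image unfolding support_act by blast
    moreover have "finite ?q" using pT by (simp add: act_eq)
    ultimately have "?q \<in> patches_over ?K (act g1 \<T>)" "?q \<in> patches_over ?K (act k y)"
      using qy qT unfolding patches_over_def support_def by blast+
    moreover have "act e ?q = ?q"
      by (rule act_id [OF _ e(2)]) (use isometry_in [OF iso [OF g1(1)]] ps in \<open>unfold support_act, blast\<close>)
    moreover have "displacement G b (1/s) e \<le> s"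
      unfolding displacement_def
    proof (rule cSUP_least)
      show "?K \<noteq> {}" using center_in_plane_cball [OF b, of "1/s"] s by auto
      show "plane_dist G Q (e Q) \<le> s" if Q: "Q \<in> ?K" for Q
      proof -
        have "Q \<in> plane G" using Q K(2) by blast
        then show ?thesis using e(2) [of Q] plane_dist_self [of Q G] s(1) by simp
      qed
    qed
    ultimately have "tiling_dist G \<Gamma> b (act g1 \<T>) (act k y) < \<epsilon>"
      using e(1) s \<epsilon>(2) by (intro tiling_dist_lessI [where r = s and p = ?q and g = e]) auto
    then have "act k y \<in> U" using in_U act_tilings [OF k(1) yt] by blast
    then show "\<exists>w. w \<in> tiling_orbit \<Gamma> y \<and> w \<in> V"
      using U(2) hull_act [OF k(1) yH] k(1) unfolding tiling_orbit_def by blast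
  qed
  then show ?thesis
    unfolding minimal_system_def
    by (intro ballI subset_antisym closure_of_subset_topspace subsetI) blast
qed

section \<open>Cell complexes\<close>

lemma homeomorphic_mapD:
  assumes "homeomorphic_map X Y f"
  shows "continuous_map X Y f" "f ` topspace X = topspace Y" "inj_on f (topspace X)"
  using assms by (simp_all add: homeomorphic_eq_everything_map)

lemma homeomorphic_map_inverse:
  assumes "homeomorphic_map X Y f"
  obtains g where "homeomorphic_map Y X g" "\<And>x. x \<in> topspace X \<Longrightarrow> g (f x) = x"
    "\<And>y. y \<in> topspace Y \<Longrightarrow> f (g y) = y"
proof -
  obtain g where g: "homeomorphic_maps X Y f g" using assms homeomorphic_map_maps by blast
  then have "homeomorphic_maps Y X g f" by (rule homeomorphic_maps_sym [THEN iffD1])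
  then have "homeomorphic_map Y X g" by (rule homeomorphic_maps_imp_map)
  moreover have "\<forall>x \<in> topspace X. g (f x) = x" "\<forall>y \<in> topspace Y. f (g y) = y"
    using g unfolding homeomorphic_maps_def by blast+
  ultimately show thesis by (intro that [of g]) simp_all
qed

text \<open>D is discrete because all its subsets are closed, and compact as a closed subset of K; a
  compact discrete space is finite.\<close>

lemma finite_if_subsets_closed:
  assumes K: "compactin X K" "D \<subseteq> K" and closed: "\<And>D'. D' \<subseteq> D \<Longrightarrow> closedin X D'"
  shows "finite D"
proof -
  have D: "D \<subseteq> topspace X" using closed [of D] closedin_subset by blast
  have "openin (subtopology X D) {x}" if "x \<in> D" for x
  proof -
    have "openin X (topspace X - (D - {x}))" using closed [of "D - {x}"] by (simp add: openin_diff)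
    moreover have "{x} = (topspace X - (D - {x})) \<inter> D" using that D by blast
    ultimately show ?thesis unfolding openin_subtopology by blast
  qed
  then have "discrete_topology D = subtopology X D"
    using D by (subst discrete_topology_unique) auto
  moreover have "compactin X D" using closed_compactin [OF K] closed by blast
  then have "compact_space (subtopology X D)" by (simp add: compactin_subspace)
  ultimately show ?thesis by (metis compact_space_discrete_topology)
qed

lemma no_embedding_plane_real:
  fixes f :: "complex \<Rightarrow> real"
  assumes "open U" "U \<noteq> {}" "continuous_on U f" "inj_on f U"
  shows False
  using invariance_of_dimension [OF assms(3,1,4,2)] by simp

section \<open>Consequences of the CW axioms\<close>

context
  fixes K :: "('p, 'z) complex2_scheme"
  assumes K: "cw2 K"
begin

lemma cw2_Hausdorff: "Hausdorff_space (ctop K)"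
  using K unfolding cw2_def by (elim conjE)

lemma cw2_Union_cells: "\<Union>(cells K) = topspace (ctop K)"
  using K unfolding cw2_def by (elim conjE)

lemma cw2_cell_unique: "c \<in> cells K \<Longrightarrow> c' \<in> cells K \<Longrightarrow> x \<in> c \<Longrightarrow> x \<in> c' \<Longrightarrow> c = c'"
proof -
  have "disjoint (cells K)" using K unfolding cw2_def by (elim conjE)
  then show "c \<in> cells K \<Longrightarrow> c' \<in> cells K \<Longrightarrow> x \<in> c \<Longrightarrow> x \<in> c' \<Longrightarrow> c = c'"
    unfolding pairwise_def disjnt_def by blast
qed

lemma cw2_cell_subset: "c \<in> cells K \<Longrightarrow> c \<subseteq> topspace (ctop K)"
  using cw2_Union_cells by blast

lemma cw2_closed_iff: "closedin (ctop K) C \<longleftrightarrow>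
    C \<subseteq> topspace (ctop K) \<and> (\<forall>c\<in>cells K. closedin (ctop K) (C \<inter> closed_cell K c))"
proof -
  have "\<forall>C. closedin (ctop K) C \<longleftrightarrow>
    C \<subseteq> topspace (ctop K) \<and> (\<forall>c\<in>cells K. closedin (ctop K) (C \<inter> closed_cell K c))"
    using K unfolding cw2_def by (elim conjE)
  then show ?thesis by (rule spec)
qed

lemma vert_cell: "v \<in> verts K \<Longrightarrow> {v} \<in> cells K"
  by (simp add: cells_def)

lemma edge_cell: "e \<in> edges K \<Longrightarrow> e \<in> cells K"
  by (simp add: cells_def)

lemma face_cell: "f \<in> faces K \<Longrightarrow> f \<in> cells K"
  by (simp add: cells_def)

lemma verts_subset: "verts K \<subseteq> topspace (ctop K)"
  using cw2_cell_subset vert_cell by blast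

lemma cw2_edge:
  assumes "e \<in> edges K"
  obtains \<phi> :: "real \<Rightarrow> 'p" where "continuous_map (top_of_set {0..1}) (ctop K) \<phi>"
    "homeomorphic_map (top_of_set {0<..<1}) (subtopology (ctop K) e) \<phi>"
    "\<phi> ` {0<..<1} = e" "inj_on \<phi> {0<..<1}" "\<phi> 0 \<in> verts K" "\<phi> 1 \<in> verts K"
proof -
  have "\<forall>e\<in>edges K. \<exists>\<phi> :: real \<Rightarrow> 'p.
        continuous_map (top_of_set {0..1}) (ctop K) \<phi> \<and>
        homeomorphic_map (top_of_set {0<..<1}) (subtopology (ctop K) e) \<phi> \<and>
        \<phi> ` {0, 1} \<subseteq> verts K"
    using K unfolding cw2_def by (elim conjE)
  then obtain \<phi> :: "real \<Rightarrow> 'p" where \<phi>: "continuous_map (top_of_set {0..1}) (ctop K) \<phi>"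
        "homeomorphic_map (top_of_set {0<..<1}) (subtopology (ctop K) e) \<phi>" "\<phi> ` {0, 1} \<subseteq> verts K"
    using assms by blast
  have "e \<subseteq> topspace (ctop K)" using assms cw2_cell_subset edge_cell by blast
  then have "\<phi> ` {0<..<1} = e" "inj_on \<phi> {0<..<1}"
    using homeomorphic_mapD(2,3) [OF \<phi>(2)] by (simp_all add: Int_absorb1)
  with \<phi> show thesis using that by blast
qed

lemma cw2_face:
  assumes "f \<in> faces K"
  obtains \<phi> :: "complex \<Rightarrow> 'p" and V E where "continuous_map (top_of_set (cball 0 1)) (ctop K) \<phi>"
    "homeomorphic_map (top_of_set (ball 0 1)) (subtopology (ctop K) f) \<phi>"
    "\<phi> ` ball 0 1 = f" "inj_on \<phi> (ball 0 1)"
    "V \<subseteq> verts K" "finite V" "E \<subseteq> edges K" "finite E" "\<phi> ` sphere 0 1 \<subseteq> V \<union> \<Union>E"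
proof -
  have "\<forall>f\<in>faces K. \<exists>(\<phi> :: complex \<Rightarrow> 'p) V E.
        continuous_map (top_of_set (cball 0 1)) (ctop K) \<phi> \<and>
        homeomorphic_map (top_of_set (ball 0 1)) (subtopology (ctop K) f) \<phi> \<and>
        V \<subseteq> verts K \<and> finite V \<and> E \<subseteq> edges K \<and> finite E \<and>
        \<phi> ` sphere 0 1 \<subseteq> V \<union> \<Union>E"
    using K unfolding cw2_def by (elim conjE)
  then obtain \<phi> :: "complex \<Rightarrow> 'p" and V E where \<phi>: "continuous_map (top_of_set (cball 0 1)) (ctop K) \<phi>"
        "homeomorphic_map (top_of_set (ball 0 1)) (subtopology (ctop K) f) \<phi>"
        "V \<subseteq> verts K" "finite V" "E \<subseteq> edges K" "finite E"
        "\<phi> ` sphere 0 1 \<subseteq> V \<union> \<Union>E"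
    using assms by (metis (no_types, lifting))
  have "f \<subseteq> topspace (ctop K)" using assms cw2_cell_subset face_cell by blast
  then have "\<phi> ` ball 0 1 = f" "inj_on \<phi> (ball 0 1)"
    using homeomorphic_mapD(2,3) [OF \<phi>(2)] by (simp_all add: Int_absorb1)
  with \<phi> show thesis using that by blast
qed

lemma edge_infinite: "e \<in> edges K \<Longrightarrow> infinite e"
  by (elim cw2_edge) (metis finite_imageD infinite_Ioo zero_less_one)

lemma face_infinite: "f \<in> faces K \<Longrightarrow> infinite f"
proof (elim cw2_face)
  fix \<phi> :: "complex \<Rightarrow> 'p" assume "\<phi> ` ball 0 1 = f" "inj_on \<phi> (ball 0 1)"
  moreover have "infinite (ball (0::complex) 1)" using finite_imp_not_open [of "ball (0::complex) 1"] by auto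
  ultimately show "infinite f" using finite_imageD by blast
qed

lemma cell_nonempty: "c \<in> cells K \<Longrightarrow> c \<noteq> {}"
  using edge_infinite face_infinite unfolding cells_def by force

text \<open>Disjointness is a condition on the set of cells, so one set could still count as a
  vertex and as an edge. Infinite edges exclude this.\<close>

lemma vert_notin_edge: "v \<in> verts K \<Longrightarrow> e \<in> edges K \<Longrightarrow> v \<notin> e"
  using cw2_cell_unique [OF vert_cell edge_cell, of v e v] edge_infinite [of e] by auto

lemma vert_notin_face: "v \<in> verts K \<Longrightarrow> f \<in> faces K \<Longrightarrow> v \<notin> f"
  using cw2_cell_unique [OF vert_cell face_cell, of v f v] face_infinite [of f] by auto

lemma edges_disjoint: "e \<in> edges K \<Longrightarrow> e' \<in> edges K \<Longrightarrow> x \<in> e \<Longrightarrow> x \<in> e' \<Longrightarrow> e = e'"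
  using cw2_cell_unique edge_cell by metis

lemma faces_disjoint: "f \<in> faces K \<Longrightarrow> f' \<in> faces K \<Longrightarrow> x \<in> f \<Longrightarrow> x \<in> f' \<Longrightarrow> f = f'"
  using cw2_cell_unique face_cell by metis

text \<open>The remaining possibility is that the same set is an edge and a face; an open disc does
  not embed in an interval.\<close>

lemma edge_face_disjoint:
  assumes e: "e \<in> edges K" and f: "f \<in> faces K" shows "e \<inter> f = {}"
proof (rule ccontr)
  assume "e \<inter> f \<noteq> {}"
  then have eq: "e = f" using cw2_cell_unique edge_cell [OF e] face_cell [OF f] by blast
  obtain \<phi> where \<phi>: "homeomorphic_map (top_of_set {0<..<1::real}) (subtopology (ctop K) e) \<phi>"
    using cw2_edge [OF e] by metis
  obtain \<psi> where \<psi>: "homeomorphic_map (top_of_set (ball (0::complex) 1)) (subtopology (ctop K) f) \<psi>"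
    using cw2_face [OF f] by metis
  obtain g where "homeomorphic_map (subtopology (ctop K) f) (top_of_set {0<..<1::real}) g"
    using homeomorphic_map_inverse [OF \<phi>] eq by metis
  then have h: "homeomorphic_map (top_of_set (ball (0::complex) 1)) (top_of_set {0<..<1::real}) (g \<circ> \<psi>)"
    using \<psi> homeomorphic_map_compose by blast
  then have "continuous_on (ball 0 1) (g \<circ> \<psi>)" "inj_on (g \<circ> \<psi>) (ball 0 1)"
    using homeomorphic_mapD [OF h] by (auto dest: continuous_map_into_fulltopology)
  then show False using no_embedding_plane_real [of "ball 0 1" "g \<circ> \<psi>"] by simp
qed

text \<open>The image of the closed interval is compact, hence closed in a Hausdorff space, and the
  open interval is dense in it.\<close>

lemma closed_cell_edge:
  assumes \<phi>: "continuous_map (top_of_set {0..1}) (ctop K) \<phi>" and e: "\<phi> ` {0<..<1::real} = e"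
  shows "closed_cell K e = \<phi> ` {0..1}"
proof
  have "compactin (ctop K) (\<phi> ` {0..1})"
    by (rule image_compactin [OF _ \<phi>]) (simp add: compactin_subtopology)
  then have "closedin (ctop K) (\<phi> ` {0..1})" using cw2_Hausdorff compactin_imp_closedin by blast
  moreover have "e \<subseteq> \<phi> ` {0..1}" unfolding e [symmetric] by (intro image_mono) auto
  ultimately show "closed_cell K e \<subseteq> \<phi> ` {0..1}" by (rule closure_of_minimal [rotated])
  have "\<phi> ` (top_of_set {0..1} closure_of {0<..<1}) \<subseteq> ctop K closure_of \<phi> ` {0<..<1}"
    by (rule continuous_map_image_closure_subset [OF \<phi>])
  moreover have "top_of_set {0..1} closure_of {0<..<1::real} = {0..1}"
    by (simp add: closure_of_subtopology Int_absorb1 greaterThanLessThan_subseteq_atLeastAtMost_iff)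
  ultimately show "\<phi> ` {0..1} \<subseteq> closed_cell K e" using e by simp
qed

lemma closed_cell_face:
  assumes \<phi>: "continuous_map (top_of_set (cball 0 1)) (ctop K) \<phi>" and f: "\<phi> ` ball (0::complex) 1 = f"
  shows "closed_cell K f = \<phi> ` cball 0 1"
proof
  have "compactin (ctop K) (\<phi> ` cball 0 1)"
    by (rule image_compactin [OF _ \<phi>]) (simp add: compactin_subtopology)
  then have "closedin (ctop K) (\<phi> ` cball 0 1)" using cw2_Hausdorff compactin_imp_closedin by blast
  moreover have "f \<subseteq> \<phi> ` cball 0 1" unfolding f [symmetric] by (intro image_mono) auto
  ultimately show "closed_cell K f \<subseteq> \<phi> ` cball 0 1" by (rule closure_of_minimal [rotated])
  have "\<phi> ` (top_of_set (cball 0 1) closure_of ball 0 1) \<subseteq> ctop K closure_of \<phi> ` ball 0 1"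
    by (rule continuous_map_image_closure_subset [OF \<phi>])
  moreover have "top_of_set (cball 0 1) closure_of ball (0::complex) 1 = cball 0 1"
    by (simp add: closure_of_subtopology Int_absorb1 ball_subset_cball)
  ultimately show "\<phi> ` cball 0 1 \<subseteq> closed_cell K f" using f by simp
qed

lemma closed_cell_edge_subset: "e \<in> edges K \<Longrightarrow> closed_cell K e \<subseteq> e \<union> verts K"
proof (elim cw2_edge)
  fix \<phi> :: "real \<Rightarrow> 'p"
  assume \<phi>: "continuous_map (top_of_set {0..1}) (ctop K) \<phi>" "\<phi> ` {0<..<1} = e" "\<phi> 0 \<in> verts K" "\<phi> 1 \<in> verts K"
  have "{0..1::real} = {0<..<1} \<union> {0, 1}" by auto
  then show "closed_cell K e \<subseteq> e \<union> verts K"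
    using \<phi>(2-4) closed_cell_edge [OF \<phi>(1,2)] by auto
qed

lemma closed_cell_finite_cells:
  assumes "c \<in> cells K"
  obtains C where "finite C" "C \<subseteq> cells K" "closed_cell K c \<subseteq> \<Union>C"
proof -
  consider v where "v \<in> verts K" "c = {v}" | "c \<in> edges K" | "c \<in> faces K"
    using assms unfolding cells_def by blast
  then show thesis
  proof cases
    case 1
    then have "closedin (ctop K) c"
      using verts_subset closedin_Hausdorff_finite [OF cw2_Hausdorff, of c] by auto
    then have "closed_cell K c = c" by (simp add: closure_of_closedin)
    then show thesis using that [of "{c}"] assms by simp
  next
    case 2
    then obtain \<phi> :: "real \<Rightarrow> 'p" where \<phi>: "continuous_map (top_of_set {0..1}) (ctop K) \<phi>" "\<phi> ` {0<..<1} = c"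
      "\<phi> 0 \<in> verts K" "\<phi> 1 \<in> verts K" using cw2_edge by metis
    have eq: "{0..1::real} = {0<..<1} \<union> {0, 1}" by auto
    have "closed_cell K c \<subseteq> \<Union>{c, {\<phi> 0}, {\<phi> 1}}"
      unfolding closed_cell_edge [OF \<phi>(1,2)] eq image_Un \<phi>(2) by auto
    then show thesis using that [of "{c, {\<phi> 0}, {\<phi> 1}}"] \<phi>(3,4) assms vert_cell by auto
  next
    case 3
    then obtain \<phi> :: "complex \<Rightarrow> 'p" and V E where \<phi>: "continuous_map (top_of_set (cball 0 1)) (ctop K) \<phi>"
      "\<phi> ` ball 0 1 = c" "V \<subseteq> verts K" "finite V" "E \<subseteq> edges K" "finite E" "\<phi> ` sphere 0 1 \<subseteq> V \<union> \<Union>E"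
      by (rule cw2_face)
    have eq: "cball (0::complex) 1 = ball 0 1 \<union> sphere 0 1" by auto
    have "closed_cell K c \<subseteq> \<Union>({c} \<union> (\<lambda>v. {v}) ` V \<union> E)"
      unfolding closed_cell_face [OF \<phi>(1,2)] eq image_Un \<phi>(2) using \<phi>(7) by auto
    moreover have "{c} \<union> (\<lambda>v. {v}) ` V \<union> E \<subseteq> cells K"
      using assms \<phi>(3,5) unfolding cells_def by auto
    moreover have "finite ({c} \<union> (\<lambda>v. {v}) ` V \<union> E)" using \<phi>(4,6) by simp
    ultimately show thesis by (intro that [of "{c} \<union> (\<lambda>v. {v}) ` V \<union> E"])
  qed
qed

text \<open>One point from each cell: all subsets of the resulting set are closed in the weak topology.\<close>

lemma compact_finite_cells:
  assumes compact: "compact_space (ctop K)" shows "finite (cells K)"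
proof -
  define p where "p c = (SOME x. x \<in> c)" for c :: "'p set"
  have p: "p c \<in> c" if "c \<in> cells K" for c
    using cell_nonempty [OF that] unfolding p_def by (simp add: some_in_eq)
  have inj: "inj_on p (cells K)"
    using cw2_cell_unique p by (metis inj_onI)
  have closed: "closedin (ctop K) D" if D: "D \<subseteq> p ` cells K" for D
  proof (rule cw2_closed_iff [THEN iffD2], intro conjI ballI)
    show top: "D \<subseteq> topspace (ctop K)" using D p cw2_cell_subset by fastforce
    fix c assume "c \<in> cells K"
    then obtain C where C: "finite C" "C \<subseteq> cells K" "closed_cell K c \<subseteq> \<Union>C"
      using closed_cell_finite_cells by metis
    have "D \<inter> closed_cell K c \<subseteq> p ` C"
    proof
      fix x assume "x \<in> D \<inter> closed_cell K c"
      then obtain c1 c2 where "c1 \<in> cells K" "x = p c1" "c2 \<in> C" "x \<in> c2"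
        using D C(3) by blast
      then have "c1 = c2" using p [of c1] C(2) cw2_cell_unique [of c1 c2 x] by auto
      then show "x \<in> p ` C" using \<open>x = p c1\<close> \<open>c2 \<in> C\<close> by blast
    qed
    then have "finite (D \<inter> closed_cell K c)" using C(1) finite_subset by blast
    then show "closedin (ctop K) (D \<inter> closed_cell K c)"
      using top by (intro closedin_Hausdorff_finite [OF cw2_Hausdorff]) auto
  qed
  have "finite (p ` cells K)"
  proof (rule finite_if_subsets_closed)
    show "compactin (ctop K) (topspace (ctop K))" using compact by (simp add: compact_space_def)
    show "p ` cells K \<subseteq> topspace (ctop K)" using p cw2_cell_subset by fastforce
  qed (rule closed)
  then show ?thesis using inj finite_imageD by blast
qed

end

section \<open>Discs\<close>

lemma disc_homeo:
  assumes "is_disc K"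
  obtains h where "homeomorphic_map (ctop K) (top_of_set (cball 0 1 :: complex set)) h"
  using assms unfolding is_disc_def homeomorphic_space by blast

lemma disc_compact: "is_disc K \<Longrightarrow> compact_space (ctop K)"
  unfolding is_disc_def
  using homeomorphic_compact_space [of "ctop K" "top_of_set (cball 0 1 :: complex set)"]
  by (simp add: compact_space_subtopology)

text \<open>By invariance of domain the image of U is open in the complex numbers, so it lies in the
  interior of the closed disc.\<close>

lemma disc_interior_image:
  fixes \<psi> :: "complex \<Rightarrow> 'p"
  assumes h: "homeomorphic_map X (top_of_set (cball (0::complex) 1)) h"
    and \<psi>: "continuous_map (top_of_set U) X \<psi>" "inj_on \<psi> U" and U: "open U" and x: "x \<in> U"
  shows "h (\<psi> x) \<in> ball 0 1"
proof -
  have c: "continuous_map (top_of_set U) (top_of_set (cball 0 1)) (h \<circ> \<psi>)"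
    using continuous_map_compose [OF \<psi>(1)] homeomorphic_mapD(1) [OF h] .
  have sub: "\<psi> ` U \<subseteq> topspace X"
    using continuous_map_image_subset_topspace [OF \<psi>(1)] by simp
  have "inj_on (h \<circ> \<psi>) U"
    by (rule comp_inj_on [OF \<psi>(2)]) (rule inj_on_subset [OF homeomorphic_mapD(3) [OF h] sub])
  moreover have "continuous_on U (h \<circ> \<psi>)" using c by (auto dest: continuous_map_into_fulltopology)
  ultimately have "open ((h \<circ> \<psi>) ` U)" using invariance_of_domain U by blast
  moreover have "(h \<circ> \<psi>) ` U \<subseteq> cball 0 1"
    using continuous_map_image_subset_topspace [OF c] by simp
  ultimately have "(h \<circ> \<psi>) ` U \<subseteq> interior (cball 0 1)" by (rule interior_maximal [rotated])
  then show ?thesis using x by auto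
qed

text \<open>Any fixed h can replace the existential homeomorphism of the definition: a point sent by
  h into the open disc has a neighbourhood parametrized by an open disc, so no homeomorphism sends
  it to the circle.\<close>

lemma boundary_circle_eq:
  assumes h: "homeomorphic_map (ctop K) (top_of_set (cball (0::complex) 1)) h"
  shows "boundary_circle K = {x \<in> topspace (ctop K). h x \<in> sphere 0 1}"
proof -
  have "h x \<in> sphere 0 1" if x: "x \<in> topspace (ctop K)"
    and g: "homeomorphic_map (ctop K) (top_of_set (cball (0::complex) 1)) g" "g x \<in> sphere 0 1" for g x
  proof (rule ccontr)
    assume "h x \<notin> sphere 0 1"
    moreover have "h x \<in> cball 0 1" using x homeomorphic_mapD(2) [OF h] by auto
    ultimately have hx: "h x \<in> ball 0 1" by auto
    obtain k where k: "homeomorphic_map (top_of_set (cball 0 1)) (ctop K) k"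
      "\<And>x. x \<in> topspace (ctop K) \<Longrightarrow> k (h x) = x"
      using homeomorphic_map_inverse [OF h] by metis
    have "continuous_map (top_of_set (ball 0 1)) (ctop K) k"
      using continuous_map_from_subtopology_mono [OF homeomorphic_mapD(1) [OF k(1)] ball_subset_cball] .
    moreover have "inj_on k (ball 0 1)"
      using inj_on_subset [OF homeomorphic_mapD(3) [OF k(1)]] by (simp add: ball_subset_cball)
    ultimately have "g (k (h x)) \<in> ball 0 1"
      using disc_interior_image [OF g(1)] hx by blast
    then show False using k(2) [OF x] g(2) by simp
  qed
  then show ?thesis unfolding boundary_circle_def using h by blast
qed

lemma boundary_circle_homeo:
  assumes s: "homeomorphic_map (ctop K) (ctop L) s" and x: "x \<in> boundary_circle K"
  shows "s x \<in> boundary_circle L"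
proof -
  obtain h where h: "homeomorphic_map (ctop K) (top_of_set (cball 0 1 :: complex set)) h" "h x \<in> sphere 0 1"
    and xK: "x \<in> topspace (ctop K)"
    using x unfolding boundary_circle_def by blast
  obtain g where g: "homeomorphic_map (ctop L) (ctop K) g" "\<And>x. x \<in> topspace (ctop K) \<Longrightarrow> g (s x) = x"
    using homeomorphic_map_inverse [OF s] by metis
  have "homeomorphic_map (ctop L) (top_of_set (cball 0 1)) (h \<circ> g)"
    using homeomorphic_map_compose [OF g(1) h(1)] .
  moreover have "(h \<circ> g) (s x) \<in> sphere 0 1" using g(2) [OF xK] h(2) by simp
  moreover have "s x \<in> topspace (ctop L)" using homeomorphic_mapD(2) [OF s] xK by blast
  ultimately show ?thesis unfolding boundary_circle_def by blast
qed

context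
  fixes K :: "('p, 'z) complex2_scheme"
  assumes K: "cw2 K" and disc: "is_disc K"
begin

lemma disc_finite_cells: "finite (cells K)"
  using compact_finite_cells [OF K disc_compact [OF disc]] .

lemma disc_finite: "finite (verts K)" "finite (edges K)" "finite (faces K)"
proof -
  have "finite ((\<lambda>v. {v}) ` verts K)" and "finite (edges K)" and "finite (faces K)"
    using disc_finite_cells unfolding cells_def by simp_all
  then show "finite (verts K)" "finite (edges K)" "finite (faces K)"
    by (auto dest: finite_imageD simp: inj_on_def)
qed

lemma face_not_boundary:
  assumes f: "f \<in> faces K" shows "f \<inter> boundary_circle K = {}"
proof -
  obtain h where h: "homeomorphic_map (ctop K) (top_of_set (cball 0 1 :: complex set)) h"
    using disc_homeo [OF disc] .
  obtain \<phi> where \<phi>: "continuous_map (top_of_set (cball 0 1)) (ctop K) \<phi>" "\<phi> ` ball (0::complex) 1 = f"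
    "inj_on \<phi> (ball 0 1)"
    using cw2_face [OF K f] by metis
  have "continuous_map (top_of_set (ball 0 1)) (ctop K) \<phi>"
    using continuous_map_from_subtopology_mono [OF \<phi>(1) ball_subset_cball] .
  then have "h (\<phi> x) \<in> ball 0 1" if "x \<in> ball 0 1" for x
    using disc_interior_image [OF h _ \<phi>(3)] that by blast
  then have "h y \<in> ball 0 1" if "y \<in> f" for y using \<phi>(2) that by blast
  then show ?thesis unfolding boundary_circle_eq [OF h] by force
qed

text \<open>Finitely many closed edges cannot cover a nonempty open subset of the disc, by invariance of dimension.\<close>

lemma disc_closed_faces_cover: "topspace (ctop K) = (\<Union>f\<in>faces K. closed_cell K f)"
proof
  show "(\<Union>f\<in>faces K. closed_cell K f) \<subseteq> topspace (ctop K)"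
    using closure_of_subset_topspace by (rule UN_least)
  show "topspace (ctop K) \<subseteq> (\<Union>f\<in>faces K. closed_cell K f)"
  proof (rule ccontr)
    define W where "W = topspace (ctop K) - (\<Union>f\<in>faces K. closed_cell K f)"
    assume "\<not> topspace (ctop K) \<subseteq> (\<Union>f\<in>faces K. closed_cell K f)"
    then have Wne: "W \<noteq> {}" by (auto simp: W_def)
    have "closedin (ctop K) (\<Union>f\<in>faces K. closed_cell K f)"
      using disc_finite(3) by (intro closedin_Union) auto
    then have Wo: "openin (ctop K) W" by (simp add: W_def openin_diff)
    obtain h where h: "homeomorphic_map (ctop K) (top_of_set (cball 0 1 :: complex set)) h"
      using disc_homeo [OF disc] .
    have "openin (top_of_set (cball 0 1)) (h ` W)"
      using homeomorphic_imp_open_map [OF h] Wo unfolding open_map_def by blast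
    then obtain T where T: "open T" "h ` W = cball 0 1 \<inter> T" by (auto simp: openin_open)
    define U where "U = ball 0 1 \<inter> T"
    have U: "open U" using T by (simp add: U_def open_Int)
    have "U \<noteq> {}"
    proof -
      have "T \<inter> closure (ball (0::complex) 1) \<noteq> {}" using T(2) Wne by auto
      then have "T \<inter> ball (0::complex) 1 \<noteq> {}" using T(1) open_Int_closure_eq_empty by blast
      then show ?thesis by (auto simp: U_def)
    qed
    have UW: "U \<subseteq> h ` W" using T(2) by (auto simp: U_def)
    have W: "W \<subseteq> verts K \<union> (\<Union>e\<in>edges K. closed_cell K e)"
    proof
      fix x assume x: "x \<in> W"
      then have "x \<in> \<Union>(cells K)" using cw2_Union_cells [OF K] by (auto simp: W_def)
      then obtain c where c: "c \<in> cells K" "x \<in> c" by blast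
      have "c \<notin> faces K"
        using x c closure_of_subset [OF cw2_cell_subset [OF K c(1)]] by (auto simp: W_def)
      then show "x \<in> verts K \<union> (\<Union>e\<in>edges K. closed_cell K e)"
        using c closure_of_subset [OF cw2_cell_subset [OF K c(1)]] unfolding cells_def by blast
    qed
    have closed: "closed (h ` closed_cell K e)" for e
    proof -
      have "closedin (top_of_set (cball 0 1)) (h ` closed_cell K e)"
        using homeomorphic_imp_closed_map [OF h] unfolding closed_map_def by simp
      then show ?thesis using closed_cball closedin_closed_trans by blast
    qed
    have empty: "interior (h ` closed_cell K e) = {}" if e: "e \<in> edges K" for e
    proof (rule ccontr)
      obtain \<phi> where \<phi>: "continuous_map (top_of_set {0..1}) (ctop K) \<phi>"
        "homeomorphic_map (top_of_set {0<..<1::real}) (subtopology (ctop K) e) \<phi>"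
        "\<phi> ` {0<..<1} = e" "inj_on \<phi> {0<..<1}" "\<phi> 0 \<in> verts K" "\<phi> 1 \<in> verts K"
        using cw2_edge [OF K e] .
      \<comment> \<open>Removing the images of the end points leaves a set inside the open arc,
        which is homeomorphic to an interval.\<close>
      define A where "A = interior (h ` closed_cell K e) - {h (\<phi> 0), h (\<phi> 1)}"
      assume ne: "interior (h ` closed_cell K e) \<noteq> {}"
      have Ao: "open A" unfolding A_def by (intro open_Diff finite_imp_closed) auto
      have Ane: "A \<noteq> {}"
      proof
        assume "A = {}"
        then have "interior (h ` closed_cell K e) \<subseteq> {h (\<phi> 0), h (\<phi> 1)}" by (auto simp: A_def)
        then have "finite (interior (h ` closed_cell K e))" by (rule finite_subset) simp
        then show False using ne finite_imp_not_open open_interior by blast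
      qed
      have Ae: "A \<subseteq> h ` e"
      proof
        fix z assume z: "z \<in> A"
        then have "z \<in> h ` closed_cell K e" using interior_subset by (auto simp: A_def)
        then obtain s where "s \<in> {0..1}" "z = h (\<phi> s)"
          unfolding closed_cell_edge [OF K \<phi>(1,3)] by blast
        moreover from this z have "s \<noteq> 0" "s \<noteq> 1" by (auto simp: A_def)
        ultimately show "z \<in> h ` e" unfolding \<phi>(3) [symmetric] by auto
      qed
      obtain k where k: "homeomorphic_map (top_of_set (cball 0 1)) (ctop K) k"
        "\<And>x. x \<in> topspace (ctop K) \<Longrightarrow> k (h x) = x"
        using homeomorphic_map_inverse [OF h] by metis
      obtain g where g: "homeomorphic_map (subtopology (ctop K) e) (top_of_set {0<..<1::real}) g"
        using homeomorphic_map_inverse [OF \<phi>(2)] by metis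
      have eK: "e \<subseteq> topspace (ctop K)" using cw2_cell_subset [OF K edge_cell [OF K e]] .
      have kA: "k ` A \<subseteq> e" using Ae k(2) eK by fastforce
      have Ac: "A \<subseteq> cball 0 1" using Ae eK homeomorphic_mapD(2) [OF h] by fastforce
      have "continuous_map (top_of_set A) (ctop K) k"
        using continuous_map_from_subtopology_mono [OF homeomorphic_mapD(1) [OF k(1)] Ac] .
      then have kc: "continuous_map (top_of_set A) (subtopology (ctop K) e) k"
        using kA by (auto simp: continuous_map_in_subtopology)
      have "continuous_map (top_of_set A) (top_of_set {0<..<1}) (g \<circ> k)"
        by (rule continuous_map_compose [OF kc homeomorphic_mapD(1) [OF g]])
      then have "continuous_on A (g \<circ> k)" by (auto dest: continuous_map_into_fulltopology)
      moreover have "inj_on (g \<circ> k) A"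
      proof (rule comp_inj_on)
        show "inj_on k A" using inj_on_subset [OF homeomorphic_mapD(3) [OF k(1)]] Ac by simp
        show "inj_on g (k ` A)" using inj_on_subset [OF homeomorphic_mapD(3) [OF g]] kA eK by auto
      qed
      ultimately show False using no_embedding_plane_real Ao Ane by blast
    qed
    have "finite E \<Longrightarrow> E \<subseteq> edges K \<Longrightarrow> interior (h ` verts K \<union> (\<Union>e\<in>E. h ` closed_cell K e)) = {}" for E
    proof (induction E rule: finite_induct)
      case empty
      then show ?case using disc_finite(1) by (simp add: empty_interior_finite)
    next
      case (insert e E)
      have eq: "h ` verts K \<union> (\<Union>e\<in>insert e E. h ` closed_cell K e) =
        (h ` verts K \<union> (\<Union>e\<in>E. h ` closed_cell K e)) \<union> h ` closed_cell K e" by auto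
      have "closed (h ` verts K \<union> (\<Union>e\<in>E. h ` closed_cell K e))"
        using insert(1) disc_finite(1) closed by (intro closed_Un closed_UN finite_imp_closed) auto
      then show ?case
        unfolding eq using insert(3,4) empty [of e] by (subst interior_closed_Un_empty_interior) auto
    qed
    then have "interior (h ` verts K \<union> (\<Union>e\<in>edges K. h ` closed_cell K e)) = {}"
      using disc_finite(2) by blast
    moreover have "U \<subseteq> h ` verts K \<union> (\<Union>e\<in>edges K. h ` closed_cell K e)"
    proof
      fix z assume "z \<in> U"
      then obtain x where "x \<in> W" "z = h x" using UW by blast
      then show "z \<in> h ` verts K \<union> (\<Union>e\<in>edges K. h ` closed_cell K e)" using W by blast
    qed
    ultimately show False using interior_maximal [OF _ U] \<open>U \<noteq> {}\<close> by blast
  qed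
qed

end

section \<open>Patches\<close>

lemma ctop_restrict [simp]: "ctop (restrict_complex K A) = subtopology (ctop K) A"
  by (simp add: restrict_complex_def)

lemma verts_restrict [simp]: "verts (restrict_complex K A) = verts K \<inter> A"
  by (simp add: restrict_complex_def)

lemma edges_restrict [simp]: "edges (restrict_complex K A) = {e \<in> edges K. e \<subseteq> A}"
  by (simp add: restrict_complex_def)

lemma faces_restrict [simp]: "faces (restrict_complex K A) = {f \<in> faces K. f \<subseteq> A}"
  by (simp add: restrict_complex_def)

lemma cells_restrict: "c \<in> cells (restrict_complex K A) \<longleftrightarrow> c \<in> cells K \<and> c \<subseteq> A"
  unfolding cells_def by auto

lemma cell_iso_cells: "cell_iso \<phi> K L \<Longrightarrow> cells L = (`) \<phi> ` cells K"
proof -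
  assume i: "cell_iso \<phi> K L"
  have "(\<lambda>v. {v}) ` verts L = (`) \<phi> ` (\<lambda>v. {v}) ` verts K"
  proof -
    have "\<phi> ` verts K = verts L" using i unfolding cell_iso_def by (elim conjE)
    then show ?thesis by (auto simp: image_image)
  qed
  then show "cells L = (`) \<phi> ` cells K"
    using i unfolding cell_iso_def cells_def by (simp add: image_Un)
qed

context
  fixes \<tau> :: "'t \<Rightarrow> 'a complex2" and P :: "('p, 'a, 't) typed_complex"
  assumes patch: "is_patch \<tau> P" and tiles: "\<And>i. cw2 (\<tau> i)"
begin

lemma patch_cw2: "cw2 P" and patch_disc: "is_disc P"
  using patch unfolding is_patch_def by blast+

lemma patch_face_iso:
  "f \<in> faces P \<Longrightarrow> cell_iso (fmap P f) (restrict_complex P (closed_cell P f)) (\<tau> (ftype P f))"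
  using patch unfolding is_patch_def by blast

text \<open>That a closed face is a union of cells does not come from the CW axioms but from the
  face map: the cells of the polygon cover it, and their preimages are cells of P.\<close>

lemma patch_cell_subset:
  assumes f: "f \<in> faces P" and c: "c \<in> cells P" "x \<in> c" "x \<in> closed_cell P f"
  shows "c \<subseteq> closed_cell P f"
proof -
  let ?R = "restrict_complex P (closed_cell P f)"
  let ?m = "fmap P f"
  have iso: "cell_iso ?m ?R (\<tau> (ftype P f))" by (rule patch_face_iso [OF f])
  have hm: "homeomorphic_map (ctop ?R) (ctop (\<tau> (ftype P f))) ?m"
    using iso unfolding cell_iso_def by blast
  have top: "topspace (ctop ?R) = closed_cell P f"
    by (simp add: Int_absorb1 closure_of_subset_topspace)
  have "?m x \<in> topspace (ctop (\<tau> (ftype P f)))"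
    using homeomorphic_mapD(2) [OF hm] c(3) top by blast
  then obtain d where d: "d \<in> cells (\<tau> (ftype P f))" "?m x \<in> d"
    using cw2_Union_cells [OF tiles] by blast
  then obtain c' where c': "c' \<in> cells ?R" "d = ?m ` c'"
    using cell_iso_cells [OF iso] by blast
  then have c'': "c' \<in> cells P" "c' \<subseteq> closed_cell P f" by (simp_all add: cells_restrict)
  obtain w where w: "w \<in> c'" "?m x = ?m w" using d(2) c'(2) by blast
  have "x = w"
    using inj_onD [OF homeomorphic_mapD(3) [OF hm] w(2)] top c(3) w(1) c''(2) by blast
  then have "c = c'" using cw2_cell_unique [OF patch_cw2 c(1) c''(1) c(2)] w(1) by simp
  then show ?thesis using c''(2) by simp
qed

lemma patch_edge_face:
  assumes e: "e \<in> edges P"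
  obtains f where "f \<in> faces P" "e \<subseteq> closed_cell P f"
proof -
  obtain x where x: "x \<in> e" using edge_infinite [OF patch_cw2 e] by fastforce
  have ec: "e \<in> cells P" by (rule edge_cell [OF patch_cw2 e])
  then have "x \<in> topspace (ctop P)" using cw2_cell_subset [OF patch_cw2] x by blast
  then obtain f where f: "f \<in> faces P" "x \<in> closed_cell P f"
    using disc_closed_faces_cover [OF patch_cw2 patch_disc] by blast
  then show thesis using patch_cell_subset [OF f(1) ec x f(2)] that by blast
qed

definition face_adj :: "('p set \<times> 'p set) set" where
  "face_adj = {(a, b). a \<in> faces P \<and> b \<in> faces P \<and> a \<noteq> b \<and>
     (\<exists>e\<in>edges P. e \<subseteq> closed_cell P a \<and> e \<subseteq> closed_cell P b)}"

text \<open>A convex set that is not contained in a line stays connected without countably many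
  points.\<close>

lemma patch_minus_verts_connected: "connectedin (ctop P) (topspace (ctop P) - verts P)"
proof -
  obtain h where h: "homeomorphic_map (ctop P) (top_of_set (cball 0 1 :: complex set)) h"
    using disc_homeo [OF patch_disc] .
  have "connected (cball (0::complex) 1 - h ` verts P)"
  proof (rule connected_convex_diff_countable)
    show "\<not> collinear (cball (0::complex) 1)" by (simp add: collinear_aff_dim aff_dim_cball)
    show "countable (h ` verts P)"
      using disc_finite(1) [OF patch_cw2 patch_disc] by (simp add: uncountable_infinite countable_finite)
  qed simp
  moreover have "h ` (topspace (ctop P) - verts P) = cball 0 1 - h ` verts P"
    using inj_on_image_set_diff [OF homeomorphic_mapD(3) [OF h] Diff_subset verts_subset [OF patch_cw2]]
      homeomorphic_mapD(2) [OF h] by simp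
  ultimately have "connectedin (top_of_set (cball 0 1)) (h ` (topspace (ctop P) - verts P))"
    by (simp add: connectedin_subtopology)
  then show ?thesis using homeomorphic_map_connectedness_eq [OF h, of "topspace (ctop P) - verts P"] by simp
qed

text \<open>A disc stays connected when the finitely many vertices are removed.\<close>

lemma patch_faces_connected:
  assumes a: "a \<in> faces P" and b: "b \<in> faces P"
  shows "(a, b) \<in> face_adj\<^sup>*"
proof (rule ccontr)
  assume nb: "(a, b) \<notin> face_adj\<^sup>*"
  define A where "A = {f \<in> faces P. (a, f) \<in> face_adj\<^sup>*}"
  define B where "B = {f \<in> faces P. (a, f) \<notin> face_adj\<^sup>*}"
  define M where "M = (\<Union>f\<in>A. closed_cell P f)"
  define N where "N = (\<Union>f\<in>B. closed_cell P f)"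
  have fin: "finite A" "finite B"
    using disc_finite(3) [OF patch_cw2 patch_disc] by (simp_all add: A_def B_def)
  have cl: "closedin (ctop P) M" "closedin (ctop P) N"
    using fin unfolding M_def N_def by (auto intro!: closedin_Union)
  have cover: "topspace (ctop P) - verts P \<subseteq> M \<union> N"
    using disc_closed_faces_cover [OF patch_cw2 patch_disc] unfolding M_def N_def A_def B_def by blast
  have faceM: "f \<inter> (topspace (ctop P) - verts P) \<noteq> {}" "f \<subseteq> closed_cell P f" if f: "f \<in> faces P" for f
  proof -
    have ft: "f \<subseteq> topspace (ctop P)" using cw2_cell_subset [OF patch_cw2 face_cell [OF patch_cw2 f]] .
    moreover have "f \<noteq> {}" using cell_nonempty [OF patch_cw2 face_cell [OF patch_cw2 f]] .
    ultimately show "f \<inter> (topspace (ctop P) - verts P) \<noteq> {}" using vert_notin_face [OF patch_cw2 _ f] by blast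
    show "f \<subseteq> closed_cell P f" using closure_of_subset [OF ft] .
  qed
  have "a \<in> A" "b \<in> B" using a b nb by (auto simp: A_def B_def)
  then have ne: "M \<inter> (topspace (ctop P) - verts P) \<noteq> {}" "N \<inter> (topspace (ctop P) - verts P) \<noteq> {}"
    using faceM [OF a] faceM [OF b] unfolding M_def N_def by blast+
  \<comment> \<open>A common point that is not a vertex lies in an edge or in a face. A common edge
    would make f and g adjacent; a face meeting a closed face is that face, since the boundary of
    the latter consists of vertices and edges.\<close>
  have "M \<inter> N \<inter> (topspace (ctop P) - verts P) = {}"
  proof (rule ccontr)
    assume "M \<inter> N \<inter> (topspace (ctop P) - verts P) \<noteq> {}"
    then obtain x f g where x: "x \<in> topspace (ctop P)" "x \<notin> verts P"
      and f: "f \<in> A" "x \<in> closed_cell P f" and g: "g \<in> B" "x \<in> closed_cell P g"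
      unfolding M_def N_def by blast
    have fg: "f \<in> faces P" "g \<in> faces P" "f \<noteq> g" using f g by (auto simp: A_def B_def)
    obtain c where c: "c \<in> cells P" "x \<in> c" using x(1) cw2_Union_cells [OF patch_cw2] by blast
    have sub: "c \<subseteq> closed_cell P f" "c \<subseteq> closed_cell P g"
      using patch_cell_subset [OF fg(1) c f(2)] patch_cell_subset [OF fg(2) c g(2)] .
    have "c \<notin> (\<lambda>v. {v}) ` verts P" using c x by auto
    then consider "c \<in> edges P" | "c \<in> faces P" using c(1) unfolding cells_def by blast
    then show False
    proof cases
      case 1
      then have "(f, g) \<in> face_adj" using fg sub unfolding face_adj_def by blast
      then have "(a, g) \<in> face_adj\<^sup>*" using f(1) rtrancl.rtrancl_into_rtrancl [of a f face_adj g] unfolding A_def by blast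
      then show False using g(1) by (simp add: B_def)
    next
      case 2
      have only: "c = f'" if f': "f' \<in> faces P" and "c \<subseteq> closed_cell P f'" for f'
      proof -
        obtain \<phi> V E where \<phi>: "continuous_map (top_of_set (cball 0 1)) (ctop P) \<phi>"
          "\<phi> ` ball (0::complex) 1 = f'" "V \<subseteq> verts P" "E \<subseteq> edges P" "\<phi> ` sphere 0 1 \<subseteq> V \<union> \<Union>E"
          using cw2_face [OF patch_cw2 f'] by metis
        have "x \<in> \<phi> ` cball 0 1" using that(2) c(2) closed_cell_face [OF patch_cw2 \<phi>(1,2)] by blast
        moreover have "cball (0::complex) 1 = ball 0 1 \<union> sphere 0 1" by auto
        ultimately have "x \<in> f' \<or> x \<in> V \<or> x \<in> \<Union>E" using \<phi>(2,5) by blast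
        moreover have "x \<notin> \<Union>E" using edge_face_disjoint [OF patch_cw2 _ 2] c(2) \<phi>(4) by blast
        ultimately have "x \<in> f'" using x(2) \<phi>(3) by blast
        then show ?thesis using faces_disjoint [OF patch_cw2 2 f' c(2)] by simp
      qed
      then show False using sub fg by blast
    qed
  qed
  then show False
    using patch_minus_verts_connected cl cover ne unfolding connectedin_closedin by blast
qed

end

section \<open>Edges of polygons\<close>

text \<open>The circle without a is traced by the angle measured from a, over an open
  interval.\<close>

lemma connected_punctured_circle:
  assumes a: "cmod a = 1" shows "connected (sphere 0 1 - {a})"
proof -
  have "(\<lambda>t. a * cis t) ` {0<..<2*pi} = sphere 0 1 - {a}"
  proof
    show "(\<lambda>t. a * cis t) ` {0<..<2*pi} \<subseteq> sphere 0 1 - {a}"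
    proof
      fix z assume "z \<in> (\<lambda>t. a * cis t) ` {0<..<2*pi}"
      then obtain t where t: "0 < t" "t < 2*pi" "z = a * cis t" by auto
      have "cis t \<noteq> 1"
      proof
        assume "cis t = 1"
        then have "cos t = 1" by (metis cis.simps(1) one_complex.simps(1))
        then obtain n :: int where n: "t = of_int n * 2 * pi" using cos_one_2pi_int by auto
        have "0 < of_int n * (2 * pi)" "of_int n * (2 * pi) < 1 * (2 * pi)" using t n by simp_all
        then have "0 < real_of_int n" "real_of_int n < 1"
          by (simp add: zero_less_mult_iff) (use \<open>of_int n * (2 * pi) < 1 * (2 * pi)\<close> in simp)
        then show False by simp
      qed
      moreover have "a \<noteq> 0" using a by auto
      ultimately show "z \<in> sphere 0 1 - {a}" using t(3) a by (simp add: norm_mult)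
    qed
    show "sphere 0 1 - {a} \<subseteq> (\<lambda>t. a * cis t) ` {0<..<2*pi}"
    proof
      fix z assume z: "z \<in> sphere 0 1 - {a}"
      have a0: "a \<noteq> 0" using a by auto
      have "cmod (z / a) = 1" using z a by (simp add: norm_divide)
      then have eq: "z / a = cis (Arg2pi (z / a))"
        using Arg2pi_eq [of "z / a"] by (simp add: cis_conv_exp)
      have "Arg2pi (z / a) \<noteq> 0"
      proof
        assume "Arg2pi (z / a) = 0"
        then have "z / a = 1" using eq by simp
        then show False using z a0 by simp
      qed
      then have "Arg2pi (z / a) \<in> {0<..<2*pi}"
        using Arg2pi_ge_0 [of "z / a"] Arg2pi_lt_2pi [of "z / a"] by simp
      moreover have "z = a * cis (Arg2pi (z / a))" using eq a0 by (metis nonzero_mult_div_cancel_left times_divide_eq_right)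
      ultimately show "z \<in> (\<lambda>t. a * cis t) ` {0<..<2*pi}" by blast
    qed
  qed
  moreover have "connected ((\<lambda>t. a * cis t) ` {0<..<2*pi})"
    by (intro connected_continuous_image continuous_intros) simp
  ultimately show ?thesis by simp
qed

lemma polygon_cw2: "topological_polygon K \<Longrightarrow> cw2 K"
  and polygon_disc: "topological_polygon K \<Longrightarrow> is_disc K"
  and polygon_boundary: "topological_polygon K \<Longrightarrow> verts K \<union> \<Union>(edges K) = boundary_circle K"
  unfolding topological_polygon_def by (elim conjE, assumption)+

lemma polygon_closed_edge_boundary:
  assumes K: "topological_polygon K" and e: "e \<in> edges K"
  shows "closed_cell K e \<subseteq> boundary_circle K"
  using closed_cell_edge_subset [OF polygon_cw2 [OF K] e] polygon_boundary [OF K] e by blast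

text \<open>The CW axioms allow loops. If e were one, the closed edge e and the rest of the boundary
  would meet only in its vertex, and would split the connected circle punctured there into two
  closed pieces.\<close>

lemma polygon_edge_ends:
  fixes \<phi> :: "real \<Rightarrow> 'p"
  assumes K: "topological_polygon K" and e: "e \<in> edges K"
    and \<phi>: "continuous_map (top_of_set {0..1}) (ctop K) \<phi>" "\<phi> ` {0<..<1} = e" "\<phi> 0 \<in> verts K"
  shows "\<phi> 0 \<noteq> \<phi> 1"
proof
  assume loop: "\<phi> 0 = \<phi> 1"
  let ?v = "\<phi> 0"
  note cw = polygon_cw2 [OF K] and disc = polygon_disc [OF K]
  obtain h where h: "homeomorphic_map (ctop K) (top_of_set (cball 0 1 :: complex set)) h"
    using disc_homeo [OF disc] .
  note bd = boundary_circle_eq [OF h]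
  have inj: "inj_on h (topspace (ctop K))" by (rule homeomorphic_mapD(3) [OF h])
  have closed: "closed (h ` C)" if "closedin (ctop K) C" for C
  proof -
    have "closedin (top_of_set (cball 0 1)) (h ` C)"
      using homeomorphic_imp_closed_map [OF h] that unfolding closed_map_def by blast
    then show ?thesis using closed_cball closedin_closed_trans by blast
  qed
  have top: "boundary_circle K \<subseteq> topspace (ctop K)" using bd by blast
  have eb: "e' \<subseteq> boundary_circle K" if "e' \<in> edges K" for e' using polygon_boundary [OF K] that by blast
  have vb: "verts K \<subseteq> boundary_circle K" using polygon_boundary [OF K] by blast
  have himg: "h ` boundary_circle K = sphere 0 1"
    using homeomorphic_mapD(2) [OF h] unfolding bd by force
  have "{0..1::real} = {0<..<1} \<union> {0, 1}" by auto
  then have ce: "closed_cell K e = e \<union> {?v}"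
    using closed_cell_edge [OF cw \<phi>(1,2)] \<phi>(2) loop by auto
  define S where "S = sphere 0 1 - {h ?v}"
  define C where "C = verts K \<union> (\<Union>e'\<in>edges K - {e}. closed_cell K e')"
  have hv: "cmod (h ?v) = 1" using \<phi>(3) vb unfolding bd by auto
  then have S: "connected S" unfolding S_def by (rule connected_punctured_circle)
  have c1: "closed (h ` closed_cell K e)" by (rule closed) simp
  have fin: "finite (verts K)" "finite (edges K)" using disc_finite [OF cw disc] by auto
  have "closedin (ctop K) C"
    unfolding C_def using fin verts_subset [OF cw] closedin_Hausdorff_finite [OF cw2_Hausdorff [OF cw]]
    by (intro closedin_Un closedin_Union) auto
  then have c2: "closed (h ` C)" by (rule closed)
  have et: "e \<subseteq> topspace (ctop K)" using eb [OF e] top by blast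
  have Ct: "C \<subseteq> topspace (ctop K)" using \<open>closedin (ctop K) C\<close> closedin_subset by blast
  have eC: "e \<inter> C = {}"
    unfolding C_def using closed_cell_edge_subset [OF cw] vert_notin_edge [OF cw _ e] edges_disjoint [OF cw e] by blast
  have cover: "S \<subseteq> h ` closed_cell K e \<union> h ` C"
  proof
    fix z assume "z \<in> S"
    then obtain x where x: "x \<in> boundary_circle K" "z = h x" using himg unfolding S_def by blast
    then consider "x \<in> verts K" | e' where "e' \<in> edges K" "x \<in> e'" using polygon_boundary [OF K] by blast
    then have "x \<in> e \<or> x \<in> C"
    proof cases
      case 2
      then have "x \<in> closed_cell K e'" using closure_of_subset [of e' "ctop K"] eb top by blast
      then show ?thesis using 2 unfolding C_def by blast
    qed (simp add: C_def)
    then show "z \<in> h ` closed_cell K e \<union> h ` C" using x ce by blast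
  qed
  have disj: "h ` closed_cell K e \<inter> h ` C \<inter> S = {}"
  proof (rule ccontr)
    assume "h ` closed_cell K e \<inter> h ` C \<inter> S \<noteq> {}"
    then obtain x y where xy: "x \<in> e \<union> {?v}" "y \<in> C" "h x = h y" "h x \<noteq> h ?v"
      unfolding S_def ce by blast
    then have "x \<in> e" by blast
    then have "x = y" using inj_onD [OF inj xy(3)] et Ct xy(2) by blast
    then show False using eC \<open>x \<in> e\<close> xy(2) by blast
  qed
  have "e \<noteq> {}" using cell_nonempty [OF cw edge_cell [OF cw e]] .
  moreover have "h ` e \<subseteq> S"
  proof
    fix z assume "z \<in> h ` e"
    then obtain x where x: "x \<in> e" "z = h x" by blast
    have "x \<noteq> ?v" using x vert_notin_edge [OF cw \<phi>(3) e] by blast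
    then have "h x \<noteq> h ?v" using inj_onD [OF inj] x et vb top \<phi>(3) by blast
    moreover have "h x \<in> sphere 0 1" using x eb [OF e] himg by blast
    ultimately show "z \<in> S" using x(2) unfolding S_def by simp
  qed
  ultimately have ne1: "h ` closed_cell K e \<inter> S \<noteq> {}" unfolding ce by blast
  \<comment> \<open>With at least three edges there is an edge besides e, so the second piece is
    nonempty.\<close>
  obtain k where "card (edges K) = k" "k \<ge> 3" using K unfolding topological_polygon_def by blast
  then have "edges K \<noteq> {e}" by auto
  then obtain e' where e': "e' \<in> edges K" "e' \<noteq> e" using e by blast
  obtain x where x: "x \<in> e'" using cell_nonempty [OF cw edge_cell [OF cw e'(1)]] by blast
  have "x \<in> C" unfolding C_def using e' x closure_of_subset [of e' "ctop K"] eb [OF e'(1)] top by blast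
  moreover have "h x \<in> S"
  proof -
    have "x \<noteq> ?v" using x vert_notin_edge [OF cw \<phi>(3) e'(1)] by blast
    then have "h x \<noteq> h ?v" using inj_onD [OF inj] x eb [OF e'(1)] vb top \<phi>(3) by blast
    moreover have "h x \<in> sphere 0 1" using x eb [OF e'(1)] himg by blast
    ultimately show ?thesis unfolding S_def by blast
  qed
  ultimately have ne2: "h ` C \<inter> S \<noteq> {}" by blast
  show False
    using S c1 c2 cover disj ne1 ne2 unfolding connected_closed by blast
qed

text \<open>Since the ends differ, the characteristic map is injective on the closed interval; a
  continuous bijection from a compact to a Hausdorff space is a homeomorphism.\<close>

lemma polygon_edge:
  assumes K: "topological_polygon K" and e: "e \<in> edges K"
  obtains \<gamma> :: "real \<Rightarrow> 'p" where
    "homeomorphic_map (top_of_set {0..1}) (subtopology (ctop K) (closed_cell K e)) \<gamma>"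
    "\<gamma> ` {0<..<1} = e" "\<gamma> 0 \<in> verts K" "\<gamma> 1 \<in> verts K" "\<gamma> 0 \<noteq> \<gamma> 1"
proof -
  note cw = polygon_cw2 [OF K]
  obtain \<phi> where \<phi>: "continuous_map (top_of_set {0..1}) (ctop K) \<phi>"
    "homeomorphic_map (top_of_set {0<..<1::real}) (subtopology (ctop K) e) \<phi>"
    "\<phi> ` {0<..<1} = e" "inj_on \<phi> {0<..<1}" "\<phi> 0 \<in> verts K" "\<phi> 1 \<in> verts K"
    using cw2_edge [OF cw e] .
  have ne: "\<phi> 0 \<noteq> \<phi> 1" by (rule polygon_edge_ends [OF K e \<phi>(1,3,5)])
  have ends: "\<phi> 0 \<notin> \<phi> ` {0<..<1}" "\<phi> 1 \<notin> \<phi> ` {0<..<1}"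
    using vert_notin_edge [OF cw \<phi>(5) e] vert_notin_edge [OF cw \<phi>(6) e] \<phi>(3) by blast+
  have I: "{0..1::real} = insert 0 (insert 1 {0<..<1})" by auto
  have inj: "inj_on \<phi> {0..1}"
    unfolding I using \<phi>(4) ends ne by (auto simp: inj_on_insert)
  have ce: "closed_cell K e = \<phi> ` {0..1}" by (rule closed_cell_edge [OF cw \<phi>(1,3)])
  have "homeomorphic_map (top_of_set {0..1}) (subtopology (ctop K) (closed_cell K e)) \<phi>"
  proof (rule continuous_imp_homeomorphic_map)
    show "continuous_map (top_of_set {0..1}) (subtopology (ctop K) (closed_cell K e)) \<phi>"
      using \<phi>(1) ce by (auto simp: continuous_map_in_subtopology)
    show "compact_space (top_of_set {0..1::real})" by (simp add: compact_space_subtopology)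
    show "Hausdorff_space (subtopology (ctop K) (closed_cell K e))"
      using cw2_Hausdorff [OF cw] by (rule Hausdorff_space_subtopology)
    show "\<phi> ` topspace (top_of_set {0..1}) = topspace (subtopology (ctop K) (closed_cell K e))"
      using ce closure_of_subset_topspace [of "ctop K" e] by (simp add: Int_absorb1)
    show "inj_on \<phi> (topspace (top_of_set {0..1}))" using inj by simp
  qed
  then show thesis using that \<phi>(3,5,6) ne by blast
qed

section \<open>Edge paths in the boundary of a disc\<close>

text \<open>A continuous injection of an interval is monotone; the values at the ends fix the
  direction.\<close>

lemma strict_mono_of_inj:
  fixes \<kappa> :: "real \<Rightarrow> real"
  assumes c: "continuous_on {0..1} \<kappa>" and i: "inj_on \<kappa> {0..1}" and ends: "\<kappa> 0 = 0" "\<kappa> 1 = 1"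
    and xy: "0 \<le> x" "x < y" "y \<le> 1"
  shows "\<kappa> x < \<kappa> y"
proof -
  have pos: "0 < \<kappa> s" if s: "0 < s" "s \<le> 1" for s
  proof (cases "s = 1")
    case False
    then show ?thesis using continuous_inj_imp_mono [of 0 s 1 \<kappa>] c i s ends by auto
  qed (simp add: ends)
  show ?thesis
  proof (cases "x = 0")
    case False
    have "continuous_on {0..y} \<kappa>" "inj_on \<kappa> {0..y}"
      using c i xy by (auto elim: continuous_on_subset inj_on_subset)
    then have "(\<kappa> 0 < \<kappa> x \<and> \<kappa> x < \<kappa> y) \<or> (\<kappa> y < \<kappa> x \<and> \<kappa> x < \<kappa> 0)"
      using continuous_inj_imp_mono [of 0 x y \<kappa>] False xy by auto
    then show ?thesis using pos [of x] ends False xy by auto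
  qed (use pos [of y] xy ends in auto)
qed

text \<open>Consider the least point m that is moved: if m goes down, its image is fixed, against
  strictness; if it goes up, the preimage of m must lie below m and is fixed.\<close>

lemma mono_bij_finite_fixed:
  fixes \<kappa> :: "real \<Rightarrow> real"
  assumes W: "finite W" "\<kappa> ` W = W" and mono: "\<And>x y. x \<in> W \<Longrightarrow> y \<in> W \<Longrightarrow> x < y \<Longrightarrow> \<kappa> x < \<kappa> y"
    and w: "w \<in> W"
  shows "\<kappa> w = w"
proof (rule ccontr)
  assume "\<kappa> w \<noteq> w"
  define B where "B = {w \<in> W. \<kappa> w \<noteq> w}"
  have B: "finite B" "B \<noteq> {}" using W w \<open>\<kappa> w \<noteq> w\<close> by (auto simp: B_def)
  define m where "m = Min B"
  have m: "m \<in> W" "\<kappa> m \<noteq> m" using Min_in [OF B] by (auto simp: m_def B_def)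
  have fixed: "\<kappa> u = u" if "u \<in> W" "u < m" for u
  proof (rule ccontr)
    assume "\<kappa> u \<noteq> u"
    then have "m \<le> u" using Min_le [OF B(1), of u] that(1) by (simp add: m_def B_def)
    then show False using that(2) by simp
  qed
  have km: "\<kappa> m \<in> W" using W(2) m(1) by blast
  show False
  proof (cases "\<kappa> m < m")
    case True
    then have "\<kappa> (\<kappa> m) = \<kappa> m" using fixed km by blast
    moreover have "\<kappa> (\<kappa> m) < \<kappa> m" using mono [OF km m(1) True] .
    ultimately show False by simp
  next
    case False
    then have gt: "m < \<kappa> m" using m(2) by simp
    obtain u where u: "u \<in> W" "m = \<kappa> u" using W(2) m(1) by blast
    have "u < m"
    proof (rule ccontr)
      assume "\<not> u < m"
      then consider "u = m" | "m < u" by fastforce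
      then show False
      proof cases
        case 2
        then have "\<kappa> m < \<kappa> u" using mono [OF m(1) u(1)] by simp
        then show False using gt u by simp
      qed (use u gt in simp)
    qed
    then show False using fixed u m(2) by metis
  qed
qed

section \<open>An arc B in the boundary circle that begins and ends at vertices\<close>

context
  fixes K :: "('p, 'z) complex2_scheme" and B :: "'p set" and \<gamma> :: "real \<Rightarrow> 'p"
  assumes K: "cw2 K" and disc: "is_disc K"
    and \<gamma>: "homeomorphic_map (top_of_set {0..1}) (subtopology (ctop K) B) \<gamma>"
    and B: "B \<subseteq> boundary_circle K" and ends: "\<gamma> 0 \<in> verts K" "\<gamma> 1 \<in> verts K"
begin

lemma arc_subset: "B \<subseteq> topspace (ctop K)"
  using B unfolding boundary_circle_def by blast

lemma arc_image: "\<gamma> ` {0..1} = B"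
  using homeomorphic_mapD(2) [OF \<gamma>] arc_subset by (simp add: Int_absorb1)

lemma arc_inj: "inj_on \<gamma> {0..1}"
  using homeomorphic_mapD(3) [OF \<gamma>] by simp

lemma arc_cases:
  assumes "x \<in> B" obtains "x \<in> verts K" | c where "c \<in> edges K" "x \<in> c"
proof -
  obtain c where c: "c \<in> cells K" "x \<in> c" using cw2_Union_cells [OF K] arc_subset assms by blast
  have "c \<notin> faces K" using face_not_boundary [OF K disc] c(2) assms B by blast
  then show thesis using c that unfolding cells_def by blast
qed

text \<open>The boundary circle avoids the faces, so on the arc the complement of c is the closed
  set of vertices and other closed edges. As the ends are vertices, the set is open in the reals,
  not just in the interval.\<close>

lemma arc_edge_open:
  assumes c: "c \<in> edges K" shows "open {r \<in> {0..1}. \<gamma> r \<in> c}"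
proof -
  define C where "C = verts K \<union> (\<Union>e'\<in>edges K - {c}. closed_cell K e')"
  have "closedin (ctop K) C"
    unfolding C_def using disc_finite [OF K disc] verts_subset [OF K] closedin_Hausdorff_finite [OF cw2_Hausdorff [OF K]]
    by (intro closedin_Un closedin_Union) auto
  then have "openin (ctop K) (topspace (ctop K) - C)" by (simp add: openin_diff)
  moreover have "continuous_map (top_of_set {0..1}) (ctop K) \<gamma>"
    using homeomorphic_mapD(1) [OF \<gamma>] by (rule continuous_map_into_fulltopology)
  ultimately have o: "openin (top_of_set {0..1}) {r \<in> topspace (top_of_set {0..1}). \<gamma> r \<in> topspace (ctop K) - C}"
    by (rule openin_continuous_map_preimage [rotated])
  have "\<gamma> r \<in> topspace (ctop K) - C \<longleftrightarrow> \<gamma> r \<in> c" if "r \<in> {0..1}" for r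
  proof
    have rB: "\<gamma> r \<in> B" using that arc_image by blast
    show "\<gamma> r \<in> c" if nC: "\<gamma> r \<in> topspace (ctop K) - C"
    proof (rule arc_cases [OF rB])
      assume "\<gamma> r \<in> verts K" then show ?thesis using nC by (simp add: C_def)
    next
      fix c' assume c': "c' \<in> edges K" "\<gamma> r \<in> c'"
      then have "\<gamma> r \<in> closed_cell K c'"
        using closure_of_subset [OF cw2_cell_subset [OF K edge_cell [OF K c'(1)]]] by blast
      then show ?thesis using c' nC unfolding C_def by blast
    qed
    show "\<gamma> r \<in> topspace (ctop K) - C" if "\<gamma> r \<in> c"
      using that rB arc_subset closed_cell_edge_subset [OF K] vert_notin_edge [OF K _ c] edges_disjoint [OF K c]
      unfolding C_def by blast
  qed
  then have eq: "{r \<in> topspace (top_of_set {0..1}). \<gamma> r \<in> topspace (ctop K) - C} = {r \<in> {0..1}. \<gamma> r \<in> c}" by auto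
  obtain T where T: "open T" "{r \<in> {0..1}. \<gamma> r \<in> c} = {0..1} \<inter> T"
    using o unfolding eq by (auto simp: openin_open)
  have "\<gamma> 0 \<notin> c" "\<gamma> 1 \<notin> c" using vert_notin_edge [OF K ends(1) c] vert_notin_edge [OF K ends(2) c] .
  then have "0 \<notin> {0..1} \<inter> T" "1 \<notin> {0..1} \<inter> T" using T(2) by (metis (no_types, lifting) mem_Collect_eq)+
  then have "{0..1} \<inter> T = {0<..<1} \<inter> T" by (auto simp: less_le)
  then show ?thesis using T by (simp add: open_Int)
qed

text \<open>Among the parameters of c, those of points in B form a closed set, as B is compact, and
  an open one, by invariance of domain in dimension 1. Connectedness of the interval gives all or
  nothing.\<close>

lemma arc_edge_subset:
  assumes c: "c \<in> edges K" and x: "x \<in> c" "x \<in> B"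
  shows "c \<subseteq> B"
proof -
  obtain \<phi> where \<phi>: "continuous_map (top_of_set {0..1}) (ctop K) \<phi>"
    "homeomorphic_map (top_of_set {0<..<1::real}) (subtopology (ctop K) c) \<phi>" "\<phi> ` {0<..<1} = c"
    using cw2_edge [OF K c] by metis
  have ct: "c \<subseteq> topspace (ctop K)" using cw2_cell_subset [OF K edge_cell [OF K c]] .
  obtain g where g: "homeomorphic_map (subtopology (ctop K) c) (top_of_set {0<..<1::real}) g"
    "\<And>s. s \<in> topspace (top_of_set {0<..<1}) \<Longrightarrow> g (\<phi> s) = s"
    "\<And>y. y \<in> topspace (subtopology (ctop K) c) \<Longrightarrow> \<phi> (g y) = y"
    using homeomorphic_map_inverse [OF \<phi>(2)] by metis
  define S where "S = {r \<in> {0..1}. \<gamma> r \<in> c}"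
  define Z where "Z = {s \<in> {0<..<1}. \<phi> s \<in> B}"
  have So: "open S" unfolding S_def by (rule arc_edge_open [OF c])
  have S01: "S \<subseteq> {0..1}" by (auto simp: S_def)
  have "continuous_map (top_of_set {0..1}) (ctop K) \<gamma>"
    using homeomorphic_mapD(1) [OF \<gamma>] by (rule continuous_map_into_fulltopology)
  then have "continuous_map (top_of_set S) (ctop K) \<gamma>"
    using S01 by (rule continuous_map_from_subtopology_mono)
  moreover have "\<gamma> ` S \<subseteq> c" by (auto simp: S_def)
  ultimately have "continuous_map (top_of_set S) (subtopology (ctop K) c) \<gamma>"
    by (auto simp: continuous_map_in_subtopology)
  then have "continuous_map (top_of_set S) (top_of_set {0<..<1}) (g \<circ> \<gamma>)"
    using homeomorphic_mapD(1) [OF g(1)] by (rule continuous_map_compose)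
  then have "continuous_on S (g \<circ> \<gamma>)" by (auto dest: continuous_map_into_fulltopology)
  moreover have "inj_on (g \<circ> \<gamma>) S"
  proof (rule comp_inj_on)
    show "inj_on \<gamma> S" using arc_inj S01 by (rule inj_on_subset)
    show "inj_on g (\<gamma> ` S)"
      using homeomorphic_mapD(3) [OF g(1)] by (rule inj_on_subset) (use ct in \<open>auto simp: S_def\<close>)
  qed
  ultimately have "open ((g \<circ> \<gamma>) ` S)" using So invariance_of_domain by blast
  moreover have "(g \<circ> \<gamma>) ` S = Z"
  proof
    show "(g \<circ> \<gamma>) ` S \<subseteq> Z"
    proof
      fix s assume "s \<in> (g \<circ> \<gamma>) ` S"
      then obtain r where r: "r \<in> {0..1}" "\<gamma> r \<in> c" "s = g (\<gamma> r)" by (auto simp: S_def)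
      have t: "\<gamma> r \<in> topspace (subtopology (ctop K) c)" using r(2) ct by auto
      then have "s \<in> {0<..<1}" using homeomorphic_mapD(2) [OF g(1)] r(3) by auto
      moreover have "\<phi> s = \<gamma> r" using g(3) [OF t] r(3) by simp
      ultimately show "s \<in> Z" using r(1) arc_image unfolding Z_def by blast
    qed
    show "Z \<subseteq> (g \<circ> \<gamma>) ` S"
    proof
      fix s assume s: "s \<in> Z"
      then obtain r where r: "r \<in> {0..1}" "\<gamma> r = \<phi> s" using arc_image unfolding Z_def by (metis (no_types, lifting) imageE mem_Collect_eq)
      then have "r \<in> S" using s \<phi>(3) unfolding S_def Z_def by auto
      moreover have "s = g (\<gamma> r)" using g(2) [of s] r(2) s by (simp add: Z_def)
      ultimately show "s \<in> (g \<circ> \<gamma>) ` S" by auto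
    qed
  qed
  ultimately have Zo: "open Z" by simp
  have "compactin (ctop K) B"
    using image_compactin [OF _ continuous_map_into_fulltopology [OF homeomorphic_mapD(1) [OF \<gamma>]], of "{0..1}"] arc_image
    by (simp add: compactin_subtopology)
  then have Bc: "closedin (ctop K) B" using cw2_Hausdorff [OF K] compactin_imp_closedin by blast
  have "continuous_map (top_of_set {0<..<1}) (ctop K) \<phi>"
    using homeomorphic_mapD(1) [OF \<phi>(2)] by (rule continuous_map_into_fulltopology)
  then have "closedin (top_of_set {0<..<1}) {s \<in> topspace (top_of_set {0<..<1}). \<phi> s \<in> B}"
    using Bc by (rule closedin_continuous_map_preimage)
  then have Zc: "closedin (top_of_set {0<..<1}) Z" by (simp add: Z_def)
  have "Z \<subseteq> {0<..<1}" by (auto simp: Z_def)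
  then have "openin (top_of_set {0<..<1}) Z" using Zo by (simp add: openin_open_eq)
  moreover have "connected {0<..<1::real}" by simp
  ultimately have "Z = {} \<or> Z = {0<..<1}" using Zc unfolding connected_clopen by blast
  moreover have "Z \<noteq> {}" using x \<phi>(3) unfolding Z_def by auto
  ultimately have "Z = {0<..<1}" by blast
  then show ?thesis using \<phi>(3) unfolding Z_def by blast
qed

text \<open>Read through \<gamma>, the map k is an increasing bijection of the unit interval
  permuting the finitely many vertex parameters, so it fixes each of them and cannot move a point
  past one.\<close>

lemma arc_self_map:
  assumes k: "homeomorphic_map (subtopology (ctop K) B) (subtopology (ctop K) B) k"
    and kv: "k ` (verts K \<inter> B) = verts K \<inter> B" and k0: "k (\<gamma> 0) = \<gamma> 0" and k1: "k (\<gamma> 1) = \<gamma> 1"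
  shows "v \<in> verts K \<inter> B \<Longrightarrow> k v = v"
    and "c \<in> edges K \<Longrightarrow> c \<subseteq> B \<Longrightarrow> y \<in> c \<Longrightarrow> k y \<in> c"
proof -
  obtain g where g: "homeomorphic_map (subtopology (ctop K) B) (top_of_set {0..1}) g"
    "\<And>s. s \<in> topspace (top_of_set {0..1}) \<Longrightarrow> g (\<gamma> s) = s"
    "\<And>y. y \<in> topspace (subtopology (ctop K) B) \<Longrightarrow> \<gamma> (g y) = y"
    using homeomorphic_map_inverse [OF \<gamma>] by metis
  have top: "topspace (subtopology (ctop K) B) = B" using arc_subset by (simp add: Int_absorb1)
  define \<kappa> where "\<kappa> = g \<circ> (k \<circ> \<gamma>)"
  have "homeomorphic_map (top_of_set {0..1}) (subtopology (ctop K) B) (k \<circ> \<gamma>)"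
    using \<gamma> k by (rule homeomorphic_map_compose)
  then have \<kappa>: "homeomorphic_map (top_of_set {0..1}) (top_of_set {0..1}) \<kappa>"
    unfolding \<kappa>_def using g(1) by (rule homeomorphic_map_compose)
  then have cont: "continuous_on {0..1} \<kappa>" and inj: "inj_on \<kappa> {0..1}" and im: "\<kappa> ` {0..1} = {0..1}"
    using homeomorphic_mapD [OF \<kappa>] by (auto dest: continuous_map_into_fulltopology)
  have \<kappa>0: "\<kappa> 0 = 0" and \<kappa>1: "\<kappa> 1 = 1" using g(2) k0 k1 by (simp_all add: \<kappa>_def)
  note mono = strict_mono_of_inj [OF cont inj \<kappa>0 \<kappa>1]
  have \<gamma>B: "\<gamma> r \<in> B" if "r \<in> {0..1}" for r using that arc_image by blast
  have kB: "k y \<in> B" if "y \<in> B" for y using homeomorphic_mapD(2) [OF k] top that by blast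
  have \<gamma>\<kappa>: "\<gamma> (\<kappa> r) = k (\<gamma> r)" if "r \<in> {0..1}" for r
    unfolding \<kappa>_def comp_def using g(3) [of "k (\<gamma> r)"] top kB [OF \<gamma>B [OF that]]
    by (simp del: topspace_subtopology)
  have pre: "\<exists>r\<in>{0..1}. \<gamma> r = y" if "y \<in> B" for y using that arc_image by blast
  define W where "W = {r \<in> {0..1}. \<gamma> r \<in> verts K}"
  have finW: "finite W"
  proof (rule finite_imageD)
    show "finite (\<gamma> ` W)"
      by (rule finite_subset [OF _ disc_finite(1) [OF K disc]]) (auto simp: W_def)
    show "inj_on \<gamma> W" using arc_inj by (rule inj_on_subset) (auto simp: W_def)
  qed
  have \<kappa>W: "\<kappa> ` W = W"
  proof
    show "\<kappa> ` W \<subseteq> W"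
    proof
      fix s assume "s \<in> \<kappa> ` W"
      then obtain r where r: "r \<in> {0..1}" "\<gamma> r \<in> verts K" "s = \<kappa> r" by (auto simp: W_def)
      have "k (\<gamma> r) \<in> verts K" using kv r \<gamma>B by blast
      then show "s \<in> W" using r im \<gamma>\<kappa> unfolding W_def by auto
    qed
    show "W \<subseteq> \<kappa> ` W"
    proof
      fix s assume s: "s \<in> W"
      then have "\<gamma> s \<in> verts K \<inter> B" using \<gamma>B by (auto simp: W_def)
      then obtain v where v: "v \<in> verts K" "v \<in> B" "\<gamma> s = k v" using kv by blast
      obtain r where r: "r \<in> {0..1}" "\<gamma> r = v" using pre [OF v(2)] by blast
      have "\<gamma> (\<kappa> r) = \<gamma> s" using \<gamma>\<kappa> r v by simp
      moreover have "\<kappa> r \<in> {0..1}" "s \<in> {0..1}" using im r(1) s unfolding W_def by blast+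
      ultimately have "\<kappa> r = s" using inj_onD [OF arc_inj] by blast
      then show "s \<in> \<kappa> ` W" using r v unfolding W_def by auto
    qed
  qed
  have fix_W: "\<kappa> w = w" if "w \<in> W" for w
    by (rule mono_bij_finite_fixed [OF finW \<kappa>W mono that]) (auto simp: W_def)
  show "k v = v" if v: "v \<in> verts K \<inter> B" for v
  proof -
    obtain r where r: "r \<in> {0..1}" "\<gamma> r = v" using pre v by blast
    then have "\<kappa> r = r" using fix_W v by (simp add: W_def)
    then show ?thesis using \<gamma>\<kappa> r by metis
  qed
  show "k y \<in> c" if c: "c \<in> edges K" "c \<subseteq> B" "y \<in> c" for c y
  proof -
    obtain r where r: "r \<in> {0..1}" "\<gamma> r = y" using pre c by blast
    \<comment> \<open>The segment between a parameter and its image contains no vertex parameter. It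
      is covered by the disjoint open parameter sets of the edges, so it stays in one of
      them.\<close>
    define I where "I = closed_segment r (\<kappa> r)"
    have \<kappa>r: "\<kappa> r \<in> {0..1}" using im r by blast
    have I01: "I \<subseteq> {0..1}" unfolding I_def using r \<kappa>r by (auto simp: closed_segment_eq_real_ivl)
    have rW: "r \<notin> W" using vert_notin_edge [OF K _ c(1)] c(3) r unfolding W_def by blast
    have IW: "s \<notin> W" if s: "s \<in> I" for s
    proof
      assume sW: "s \<in> W"
      then have "s \<noteq> r" using rW by blast
      have s01: "s \<in> {0..1}" using sW by (simp add: W_def)
      show False
      proof (cases "r < s")
        case True
        then have "\<kappa> r < \<kappa> s" using mono r s01 by simp
        then have "\<kappa> r < s" using fix_W [OF sW] by simp
        then show False using s True unfolding I_def closed_segment_eq_real_ivl by (auto split: if_splits)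
      next
        case False
        then have "s < r" using \<open>s \<noteq> r\<close> by simp
        then have "\<kappa> s < \<kappa> r" using mono r s01 by simp
        then have "s < \<kappa> r" using fix_W [OF sW] by simp
        then show False using s \<open>s < r\<close> unfolding I_def closed_segment_eq_real_ivl by (auto split: if_splits)
      qed
    qed
    define A1 where "A1 = {s \<in> {0..1}. \<gamma> s \<in> c}"
    define A2 where "A2 = (\<Union>c'\<in>edges K - {c}. {s \<in> {0..1}. \<gamma> s \<in> c'})"
    have o: "open A1" "open A2" unfolding A1_def A2_def using arc_edge_open c(1) by auto
    have "I \<subseteq> A1 \<union> A2"
    proof
      fix s assume s: "s \<in> I"
      then have s01: "s \<in> {0..1}" using I01 by blast
      show "s \<in> A1 \<union> A2"
      proof (rule arc_cases [OF \<gamma>B [OF s01]])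
        assume "\<gamma> s \<in> verts K" then show ?thesis using IW [OF s] s01 by (simp add: W_def)
      next
        fix c' assume "c' \<in> edges K" "\<gamma> s \<in> c'" then show ?thesis using s01 unfolding A1_def A2_def by blast
      qed
    qed
    moreover have "A1 \<inter> A2 \<inter> I = {}"
      unfolding A1_def A2_def using edges_disjoint [OF K c(1)] by blast
    moreover have "connected I" unfolding I_def by simp
    ultimately have "A1 \<inter> I = {} \<or> A2 \<inter> I = {}" using o connectedD by blast
    moreover have "r \<in> A1 \<inter> I" using r c(3) unfolding A1_def I_def by simp
    ultimately have "A2 \<inter> I = {}" by blast
    then have "\<kappa> r \<in> A1" using \<open>I \<subseteq> A1 \<union> A2\<close> unfolding I_def by auto
    then show "k y \<in> c" using \<gamma>\<kappa> [OF r(1)] r(2) by (simp add: A1_def)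
  qed
qed

text \<open>The composite of h with the inverse of h' is a self-map as in
  \<open>arc_self_map\<close>. This is the substitute for pointwise equality: gluings with equal
  ends act equally on cells.\<close>

lemma arc_cell_iso_unique:
  assumes L: "cw2 L"
    and h: "cell_iso h (restrict_complex K B) (restrict_complex L C)"
    and h': "cell_iso h' (restrict_complex K B) (restrict_complex L C)"
    and e0: "h (\<gamma> 0) = h' (\<gamma> 0)" and e1: "h (\<gamma> 1) = h' (\<gamma> 1)"
  shows "v \<in> verts K \<inter> B \<Longrightarrow> h v = h' v"
    and "c \<in> edges K \<Longrightarrow> c \<subseteq> B \<Longrightarrow> h ` c = h' ` c"
proof -
  have hh: "homeomorphic_map (subtopology (ctop K) B) (subtopology (ctop L) C) h"
    "h ` (verts K \<inter> B) = verts L \<inter> C" "(`) h ` {e \<in> edges K. e \<subseteq> B} = {e \<in> edges L. e \<subseteq> C}"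
    using h unfolding cell_iso_def by simp_all
  have hh': "homeomorphic_map (subtopology (ctop K) B) (subtopology (ctop L) C) h'"
    "h' ` (verts K \<inter> B) = verts L \<inter> C" "(`) h' ` {e \<in> edges K. e \<subseteq> B} = {e \<in> edges L. e \<subseteq> C}"
    using h' unfolding cell_iso_def by simp_all
  obtain g where g: "homeomorphic_map (subtopology (ctop L) C) (subtopology (ctop K) B) g"
    "\<And>x. x \<in> topspace (subtopology (ctop K) B) \<Longrightarrow> g (h' x) = x"
    "\<And>y. y \<in> topspace (subtopology (ctop L) C) \<Longrightarrow> h' (g y) = y"
    using homeomorphic_map_inverse [OF hh'(1)] by metis
  have top: "topspace (subtopology (ctop K) B) = B" using arc_subset by (simp add: Int_absorb1)
  have \<gamma>B: "\<gamma> 0 \<in> B" "\<gamma> 1 \<in> B" using arc_image by auto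
  have k: "homeomorphic_map (subtopology (ctop K) B) (subtopology (ctop K) B) (g \<circ> h)"
    using hh(1) g(1) by (rule homeomorphic_map_compose)
  have "(g \<circ> h) ` (verts K \<inter> B) = g ` h' ` (verts K \<inter> B)" unfolding image_comp [symmetric] hh(2) hh'(2) ..
  also have "\<dots> = verts K \<inter> B" using g(2) top by (force simp: image_image)
  finally have kv: "(g \<circ> h) ` (verts K \<inter> B) = verts K \<inter> B" .
  have k0: "(g \<circ> h) (\<gamma> 0) = \<gamma> 0" and k1: "(g \<circ> h) (\<gamma> 1) = \<gamma> 1"
    using g(2) [of "\<gamma> 0"] g(2) [of "\<gamma> 1"] top \<gamma>B e0 e1 by (simp_all del: topspace_subtopology)
  have hk: "h' ((g \<circ> h) y) = h y" if "y \<in> B" for y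
    using g(3) homeomorphic_mapD(2) [OF hh(1)] top that by force
  show "h v = h' v" if "v \<in> verts K \<inter> B" for v
    using arc_self_map(1) [OF k kv k0 k1 that] hk [of v] that by simp
  show "h ` c = h' ` c" if c: "c \<in> edges K" "c \<subseteq> B" for c
  proof -
    obtain y where y: "y \<in> c" using cell_nonempty [OF K edge_cell [OF K c(1)]] by blast
    have "(g \<circ> h) y \<in> c" using arc_self_map(2) [OF k kv k0 k1 c y] .
    then have "h y \<in> h' ` c" using hk [of y] y c(2) by (metis image_eqI subsetD)
    moreover have "h y \<in> h ` c" using y by blast
    moreover have "h ` c \<in> edges L" "h' ` c \<in> edges L" using hh(3) hh'(3) c by blast+
    ultimately show ?thesis using edges_disjoint [OF L] by blast
  qed
qed

end

section \<open>Rigidity of isometries along an edge\<close>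

lemma moebius_denominator:
  assumes "cmod v < 1" "cmod z < 1" shows "1 - cnj v * z \<noteq> 0"
proof
  assume "1 - cnj v * z = 0"
  then have "cnj v * z = 1" by simp
  then have "cmod v * cmod z = 1" by (metis complex_mod_cnj norm_mult norm_one)
  moreover have "cmod v * cmod z < 1"
    using assms mult_strict_mono' [of "cmod v" 1 "cmod z" 1] by simp
  ultimately show False by simp
qed

text \<open>Divided by 1 minus the squared modulus of z, the right side depends on z only through
  \<open>hyp_ratio v z\<close>.\<close>

lemma moebius_denominator_square:
  "(cmod (1 - cnj v * z))\<^sup>2 = (cmod (v - z))\<^sup>2 + (1 - (cmod v)\<^sup>2) * (1 - (cmod z)\<^sup>2)"
  unfolding cmod_power2 by (simp add: power2_eq_square algebra_simps)

lemma moebius_difference: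
  assumes "1 - cnj v * z \<noteq> 0" "1 - cnj v * z' \<noteq> 0"
  shows "(z - v) / (1 - cnj v * z) - (z' - v) / (1 - cnj v * z')
    = (z - z') * (1 - of_real ((cmod v)\<^sup>2)) / ((1 - cnj v * z) * (1 - cnj v * z'))"
proof -
  have "(z - v) * (1 - cnj v * z') - (z' - v) * (1 - cnj v * z) = (z - z') * (1 - v * cnj v)"
    by (simp add: algebra_simps)
  also have "v * cnj v = of_real ((cmod v)\<^sup>2)" by (rule complex_norm_square [symmetric])
  finally show ?thesis using assms by (simp add: diff_frac_eq)
qed

text \<open>In the Poincare disc, isometries fixing the centre are Euclidean isometries; a Moebius
  map moves v to the centre. This lets both geometries share the elementary argument about two
  circles.\<close>

lemma isometry_chart:
  assumes v: "v \<in> plane G" and w: "w \<in> plane G" and ne: "v \<noteq> w"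
  obtains \<psi> :: "complex \<Rightarrow> complex" where "continuous_on (plane G) \<psi>" "inj_on \<psi> (plane G)"
    "\<psi> v = 0" "\<psi> w \<noteq> 0" "Im (\<psi> w) = 0"
    "\<And>J z z'. isometry G J \<Longrightarrow> J v = v \<Longrightarrow> z \<in> plane G \<Longrightarrow> z' \<in> plane G \<Longrightarrow>
      cmod (\<psi> (J z) - \<psi> (J z')) = cmod (\<psi> z - \<psi> z')"
proof (cases G)
  case Euclidean
  \<comment> \<open>The factor \<open>cnj (w - v)\<close> turns w onto the real axis and scales all
    distances equally.\<close>
  define \<psi> where "\<psi> z = (z - v) * cnj (w - v)" for z
  have c: "cnj (w - v) \<noteq> 0" using ne by auto
  show thesis
  proof (rule that [of \<psi>])
    show "continuous_on (plane G) \<psi>" unfolding \<psi>_def by (intro continuous_intros)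
    show "inj_on \<psi> (plane G)" using c unfolding \<psi>_def inj_on_def by simp
    show "\<psi> v = 0" by (simp add: \<psi>_def)
    show "\<psi> w \<noteq> 0" using c ne by (simp add: \<psi>_def)
    show "Im (\<psi> w) = 0" unfolding \<psi>_def complex_mult_cnj by simp
    fix J z z' assume J: "isometry G J" and z: "z \<in> plane G" "z' \<in> plane G"
    have diff: "\<psi> x - \<psi> y = (x - y) * cnj (w - v)" for x y by (simp add: \<psi>_def algebra_simps)
    have "dist (J z) (J z') = dist z z'" using isometry_dist [OF J z] Euclidean by simp
    then show "cmod (\<psi> (J z) - \<psi> (J z')) = cmod (\<psi> z - \<psi> z')"
      unfolding diff norm_mult by (simp add: dist_norm)
  qed
next
  case Hyperbolic
  define M where "M z = (z - v) / (1 - cnj v * z)" for z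
  \<comment> \<open>M moves v to 0, and the conjugate factor again makes the image of w
    real.\<close>
  define \<psi> where "\<psi> z = M z * cnj (M w)" for z
  have v1: "cmod v < 1" using v Hyperbolic by simp
  have den: "1 - cnj v * z \<noteq> 0" if "z \<in> plane G" for z
    using moebius_denominator [OF v1] that Hyperbolic by simp
  have vpos: "0 < 1 - (cmod v)\<^sup>2" using disc_pos v Hyperbolic by simp
  have Mdiff: "cmod (M z - M z') = cmod (z - z') * (1 - (cmod v)\<^sup>2) / (cmod (1 - cnj v * z) * cmod (1 - cnj v * z'))"
    if "z \<in> plane G" "z' \<in> plane G" for z z'
  proof -
    have "cmod (1 - of_real ((cmod v)\<^sup>2)) = 1 - (cmod v)\<^sup>2"
      using vpos by (metis norm_of_real of_real_1 of_real_diff abs_of_pos)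
    then show ?thesis
      unfolding M_def moebius_difference [OF den [OF that(1)] den [OF that(2)]] norm_divide norm_mult by simp
  qed
  have Minj: "z = z'" if "z \<in> plane G" "z' \<in> plane G" "M z = M z'" for z z'
    using Mdiff [OF that(1,2)] that(3) vpos den [OF that(1)] den [OF that(2)] by simp
  have Mv: "M v = 0" by (simp add: M_def)
  have Mw: "M w \<noteq> 0" using Minj [OF v w] Mv ne by auto
  show thesis
  proof (rule that [of \<psi>])
    show "continuous_on (plane G) \<psi>"
      unfolding \<psi>_def M_def using den by (intro continuous_intros) auto
    show "inj_on \<psi> (plane G)"
      using Mw Minj unfolding \<psi>_def inj_on_def by simp
    show "\<psi> v = 0" by (simp add: \<psi>_def Mv)
    show "\<psi> w \<noteq> 0" using Mw by (simp add: \<psi>_def)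
    show "Im (\<psi> w) = 0" unfolding \<psi>_def complex_mult_cnj by simp
    fix J z z' assume J: "isometry G J" "J v = v" and z: "z \<in> plane G" "z' \<in> plane G"
    \<comment> \<open>The Euclidean distance of Moebius images is determined by
      \<open>hyp_ratio\<close> of the two points and by their values of q. Since q depends only on
      \<open>hyp_ratio\<close> to v, isometries fixing v preserve it.\<close>
    define q where "q z = (cmod (1 - cnj v * z))\<^sup>2 / (1 - (cmod z)\<^sup>2)" for z
    have zpos: "0 < 1 - (cmod z)\<^sup>2" if "z \<in> plane G" for z using disc_pos that Hyperbolic by simp
    have q: "q z = (1 - (cmod v)\<^sup>2) * (1 + hyp_ratio v z / 2)" if "z \<in> plane G" for z
    proof -
      have "(D + a * c) / c = a * (1 + 2 * D / (a * c) / 2)" if "0 < a" "0 < c" for a c D :: real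
        using that by (simp add: field_simps)
      then show ?thesis unfolding q_def moebius_denominator_square hyp_ratio_def using vpos zpos [OF that] by blast
    qed
    have qpos: "0 < q z" if "z \<in> plane G" for z
      unfolding q_def using zpos [OF that] den [OF that] by simp
    have sq: "(cmod (M x - M y))\<^sup>2 = (1 - (cmod v)\<^sup>2)\<^sup>2 * (hyp_ratio x y / 2) / (q x * q y)"
      if "x \<in> plane G" "y \<in> plane G" for x y
    proof -
      have *: "X * A / (n1 * n2) = A * (2 * X / (c1 * c2) / 2) / (n1 / c1 * (n2 / c2))"
        if "0 < c1" "0 < c2" "0 < n1" "0 < n2" for X A c1 c2 n1 n2 :: real
        using that by (simp add: field_simps)
      have "0 < (cmod (1 - cnj v * x))\<^sup>2" "0 < (cmod (1 - cnj v * y))\<^sup>2"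
        using den [OF that(1)] den [OF that(2)] by simp_all
      then show ?thesis
        unfolding Mdiff [OF that] hyp_ratio_def q_def power_divide power_mult_distrib
        using zpos [OF that(1)] zpos [OF that(2)] by (intro *)
    qed
    have Jin: "J x \<in> plane G" if "x \<in> plane G" for x using isometry_in [OF J(1) that] .
    have hr: "hyp_ratio (J x) (J y) = hyp_ratio x y" if "x \<in> plane G" "y \<in> plane G" for x y
    proof -
      have "plane_dist Hyperbolic (J x) (J y) = plane_dist Hyperbolic x y"
        using isometry_dist [OF J(1) that] Hyperbolic by simp
      then show ?thesis
        using plane_dist_hyp_eq_iff [of "J x" "J y" x y] Jin [OF that(1)] Jin [OF that(2)] that Hyperbolic
        by (simp del: plane_dist.simps)
    qed
    have qJ: "q (J x) = q x" if "x \<in> plane G" for x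
      using q [OF Jin [OF that]] q [OF that] hr [OF v that] J(2) by simp
    have "(cmod (M (J z) - M (J z')))\<^sup>2 = (cmod (M z - M z'))\<^sup>2"
      unfolding sq [OF Jin [OF z(1)] Jin [OF z(2)]] sq [OF z] hr [OF z] qJ [OF z(1)] qJ [OF z(2)] ..
    then have "cmod (M (J z) - M (J z')) = cmod (M z - M z')" by simp
    then show "cmod (\<psi> (J z) - \<psi> (J z')) = cmod (\<psi> z - \<psi> z')"
      unfolding \<psi>_def left_diff_distrib [symmetric] norm_mult by simp
  qed
qed

text \<open>Circles around the two real centres 0 and a meet in points that are conjugate to each
  other.\<close>

lemma eq_or_cnj_of_dist:
  fixes p q :: complex
  assumes "cmod p = cmod q" "cmod (p - a) = cmod (q - a)" "a \<noteq> 0" "Im a = 0"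
  shows "p = q \<or> p = cnj q"
proof -
  have 1: "(Re p)\<^sup>2 + (Im p)\<^sup>2 = (Re q)\<^sup>2 + (Im q)\<^sup>2"
    using assms(1) by (metis cmod_power2)
  have "(Re p - Re a)\<^sup>2 + (Im p)\<^sup>2 = (Re q - Re a)\<^sup>2 + (Im q)\<^sup>2"
    using arg_cong [OF assms(2), of "\<lambda>x. x\<^sup>2"] assms(4) by (simp add: cmod_power2)
  then have "2 * Re p * Re a = 2 * Re q * Re a" using 1 unfolding power2_diff by linarith
  then have "Re a * Re p = Re a * Re q" by (simp add: mult.commute)
  moreover have "Re a \<noteq> 0" using assms(3,4) by (simp add: complex_eq_iff)
  ultimately have re: "Re p = Re q" by simp
  then have "(Im p)\<^sup>2 = (Im q)\<^sup>2" using 1 by simp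
  then have "Im p = Im q \<or> Im p = - Im q" by (simp add: power2_eq_iff)
  then show ?thesis using re by (auto simp: complex_eq_iff)
qed

lemma connected_subset_of_disjoint_opens:
  assumes "connected S" "S \<subseteq> \<Union>\<F>" "\<And>F. F \<in> \<F> \<Longrightarrow> open F" "disjoint \<F>" "F \<in> \<F>" "S \<inter> F \<noteq> {}"
  shows "S \<subseteq> F"
proof -
  have "open F" "open (\<Union>(\<F> - {F}))" using assms(3,5) by auto
  moreover have "F \<inter> \<Union>(\<F> - {F}) \<inter> S = {}"
    using assms(4,5) unfolding pairwise_def disjnt_def by blast
  moreover have "S \<subseteq> F \<union> \<Union>(\<F> - {F})" using assms(2) by blast
  ultimately have "F \<inter> S = {} \<or> \<Union>(\<F> - {F}) \<inter> S = {}" by (rule connectedD [OF assms(1)])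
  then show ?thesis using assms(2,6) by blast
qed

text \<open>
  An isometry preserving an arc and fixing its two end points is the identity or the reflection in the
  line through them; in the second case the arc lies on that line, and the two sides of the line near an
  interior point of the arc are exchanged.
\<close>

lemma isometry_fixing_arc:
  fixes \<gamma> :: "real \<Rightarrow> complex"
  assumes J: "isometry G J" and \<gamma>: "continuous_on {0..1} \<gamma>" "inj_on \<gamma> {0..1}" "\<gamma> ` {0..1} \<subseteq> plane G"
    and fix0: "J (\<gamma> 0) = \<gamma> 0" and fix1: "J (\<gamma> 1) = \<gamma> 1" and inv: "J ` \<gamma> ` {0..1} = \<gamma> ` {0..1}"
    and m: "m \<in> \<gamma> ` {0..1}" and N: "open N" "m \<in> N" "N \<subseteq> plane G"
    and \<F>: "\<And>F. F \<in> \<F> \<Longrightarrow> open F" "disjoint \<F>" "N - \<gamma> ` {0..1} \<subseteq> \<Union>\<F>"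
    and F: "F1 \<in> \<F>" "F2 \<in> \<F>" "F1 \<noteq> F2" "m \<in> closure F1" "m \<in> closure F2"
    and z: "z \<in> plane G" "J z \<noteq> z"
  shows "J ` F1 \<inter> F2 \<noteq> {}"
proof -
  have ends: "\<gamma> 0 \<in> plane G" "\<gamma> 1 \<in> plane G" using \<gamma>(3) by auto
  have ne: "\<gamma> 0 \<noteq> \<gamma> 1" using inj_onD [OF \<gamma>(2), of 0 1] by auto
  obtain \<psi> :: "complex \<Rightarrow> complex" where \<psi>: "continuous_on (plane G) \<psi>" "inj_on \<psi> (plane G)"
    "\<psi> (\<gamma> 0) = 0" "\<psi> (\<gamma> 1) \<noteq> 0" "Im (\<psi> (\<gamma> 1)) = 0"
    and \<psi>_dist0: "\<And>J x y. isometry G J \<Longrightarrow> J (\<gamma> 0) = \<gamma> 0 \<Longrightarrow> x \<in> plane G \<Longrightarrow> y \<in> plane G \<Longrightarrow>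
      cmod (\<psi> (J x) - \<psi> (J y)) = cmod (\<psi> x - \<psi> y)"
    using isometry_chart [OF ends ne] by metis
  note \<psi>_dist = \<psi>_dist0 [OF J fix0]
  have Jin: "J x \<in> plane G" if "x \<in> plane G" for x using isometry_in [OF J that] .
  have cases: "\<psi> (J x) = \<psi> x \<or> \<psi> (J x) = cnj (\<psi> x)" if x: "x \<in> plane G" for x
  proof (rule eq_or_cnj_of_dist)
    show "cmod (\<psi> (J x)) = cmod (\<psi> x)" using \<psi>_dist [OF x ends(1)] fix0 \<psi>(3) by simp
    show "cmod (\<psi> (J x) - \<psi> (\<gamma> 1)) = cmod (\<psi> x - \<psi> (\<gamma> 1))" using \<psi>_dist [OF x ends(2)] fix1 by simp
  qed (use \<psi> in auto)
  \<comment> \<open>z rules out the identity. A fixed point off the real axis would be equidistant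
    from the image of z and its conjugate, which would put that image on the axis and z would be
    fixed.\<close>
  have refl: "\<psi> (J x) = cnj (\<psi> x)" if x: "x \<in> plane G" for x
  proof (rule ccontr)
    assume nc: "\<psi> (J x) \<noteq> cnj (\<psi> x)"
    then have px: "\<psi> (J x) = \<psi> x" using cases [OF x] by blast
    have imx: "Im (\<psi> x) \<noteq> 0" using nc px by (auto simp: complex_eq_iff)
    have "\<psi> (J z) \<noteq> \<psi> z" using inj_onD [OF \<psi>(2)] z Jin by blast
    then have cz: "\<psi> (J z) = cnj (\<psi> z)" using cases [OF z(1)] by blast
    have "cmod (cnj (\<psi> z) - \<psi> x) = cmod (\<psi> z - \<psi> x)" using \<psi>_dist [OF z(1) x] px cz by simp
    then have "(cmod (cnj (\<psi> z) - \<psi> x))\<^sup>2 = (cmod (\<psi> z - \<psi> x))\<^sup>2" by simp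
    then have "Im (\<psi> z) * Im (\<psi> x) = 0"
      unfolding cmod_power2 by (simp add: power2_eq_square algebra_simps)
    then have "Im (\<psi> z) = 0" using imx by simp
    then have "\<psi> (J z) = \<psi> z" using cz by (simp add: complex_eq_iff)
    then show False using \<open>\<psi> (J z) \<noteq> \<psi> z\<close> by simp
  qed
  have JJ: "J (J x) = x" if x: "x \<in> plane G" for x
    using inj_onD [OF \<psi>(2) _ Jin [OF Jin [OF x]] x] refl [OF Jin [OF x]] refl [OF x] by simp
  obtain g where g: "continuous_on (\<gamma> ` {0..1}) g" "\<And>s. s \<in> {0..1} \<Longrightarrow> g (\<gamma> s) = s"
    by (rule that [OF continuous_on_inv_into [OF \<gamma>(1) compact_Icc \<gamma>(2)]]) (rule the_inv_into_f_f [OF \<gamma>(2)])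
  have J\<gamma>: "J (\<gamma> s) \<in> \<gamma> ` {0..1}" if "s \<in> {0..1}" for s using inv that by blast
  define \<kappa> where "\<kappa> s = g (J (\<gamma> s))" for s
  have \<kappa>01: "\<kappa> s \<in> {0..1}" and \<gamma>\<kappa>: "\<gamma> (\<kappa> s) = J (\<gamma> s)" if s: "s \<in> {0..1}" for s
  proof -
    obtain t where "t \<in> {0..1}" "J (\<gamma> s) = \<gamma> t" using J\<gamma> [OF s] by blast
    then show "\<kappa> s \<in> {0..1}" "\<gamma> (\<kappa> s) = J (\<gamma> s)" using g(2) by (simp_all add: \<kappa>_def)
  qed
  have \<kappa>\<kappa>: "\<kappa> (\<kappa> s) = s" if s: "s \<in> {0..1}" for s
  proof -
    have "\<gamma> (\<kappa> (\<kappa> s)) = \<gamma> s" using \<gamma>\<kappa> [OF \<kappa>01 [OF s]] \<gamma>\<kappa> [OF s] JJ [of "\<gamma> s"] image_subset_iff [THEN iffD1, OF \<gamma>(3)] s by simp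
    then show ?thesis using inj_onD [OF \<gamma>(2)] \<kappa>01 s by blast
  qed
  have "continuous_on {0..1} (\<lambda>s. J (\<gamma> s))"
    by (rule continuous_on_compose2 [OF continuous_on_isometry [OF J] \<gamma>(1,3)])
  then have "continuous_on {0..1} \<kappa>"
    unfolding \<kappa>_def by (rule continuous_on_compose2 [OF g(1)]) (use J\<gamma> in blast)
  moreover have "inj_on \<kappa> {0..1}" using \<kappa>\<kappa> by (metis inj_onI)
  moreover have "\<kappa> 0 = 0" "\<kappa> 1 = 1" using fix0 fix1 g(2) by (simp_all add: \<kappa>_def)
  ultimately have mono: "\<kappa> x < \<kappa> y" if "0 \<le> x" "x < y" "y \<le> 1" for x y
    using strict_mono_of_inj that by blast
  \<comment> \<open>An increasing involution of the interval is the identity, so J fixes the arc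
    pointwise and the arc lies on the axis of the reflection.\<close>
  have \<kappa>_id: "\<kappa> s = s" if s: "s \<in> {0..1}" for s
  proof (rule ccontr)
    assume "\<kappa> s \<noteq> s"
    then consider "\<kappa> s < s" | "s < \<kappa> s" by fastforce
    then show False
    proof cases
      case 1
      then have "\<kappa> (\<kappa> s) < \<kappa> s" using mono [of "\<kappa> s" s] \<kappa>01 [OF s] s by simp
      then show False using \<kappa>\<kappa> [OF s] 1 by simp
    next
      case 2
      then have "\<kappa> s < \<kappa> (\<kappa> s)" using mono [of s "\<kappa> s"] \<kappa>01 [OF s] s by simp
      then show False using \<kappa>\<kappa> [OF s] 2 by simp
    qed
  qed
  have real: "Im (\<psi> x) = 0" if x: "x \<in> \<gamma> ` {0..1}" for x
  proof -
    obtain s where s: "s \<in> {0..1}" "x = \<gamma> s" using x by blast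
    have "J x = x" using \<gamma>\<kappa> [OF s(1)] \<kappa>_id [OF s(1)] s(2) by simp
    then have "\<psi> x = cnj (\<psi> x)" using refl [of x] x \<gamma>(3) by auto
    then show ?thesis by (metis complex_cnj_cancel_iff cnj.sel(2) neg_equal_zero)
  qed
  have "open (\<psi> ` N)"
    using invariance_of_domain [OF continuous_on_subset [OF \<psi>(1) N(3)] N(1) inj_on_subset [OF \<psi>(2) N(3)]] .
  moreover have "\<psi> m \<in> \<psi> ` N" using N(2) by blast
  ultimately obtain \<epsilon> where \<epsilon>: "\<epsilon> > 0" "ball (\<psi> m) \<epsilon> \<subseteq> \<psi> ` N" using openE by blast
  obtain \<theta> where \<theta>: "homeomorphism N (\<psi> ` N) \<psi> \<theta>"
    using invariance_of_domain_homeomorphism [OF N(1) continuous_on_subset [OF \<psi>(1) N(3)] _ inj_on_subset [OF \<psi>(2) N(3)]]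
    by auto
  \<comment> \<open>For s = 1 and s = -1 these are the two open half-discs beside the axis; the sign
    convention lets \<open>- s\<close> denote the opposite side.\<close>
  define U where "U s = {p \<in> ball (\<psi> m) \<epsilon>. 0 < s * Im p}" for s :: real
  have conv: "convex (U s)" for s
  proof -
    have "convex {p :: complex. 0 < s * Im p}"
    proof -
      have "{p :: complex. 0 < s * Im p} = {p. inner (Complex 0 s) p > 0}" by (auto simp: inner_complex_def)
      then show ?thesis by (simp add: convex_halfspace_gt)
    qed
    then have "convex (ball (\<psi> m) \<epsilon> \<inter> {p. 0 < s * Im p})" by (intro convex_Int convex_ball)
    then show ?thesis by (simp add: U_def Int_def)
  qed
  have mreal: "Im (\<psi> m) = 0" by (rule real [OF m])
  have Une: "U s \<noteq> {}" if "s \<noteq> 0" for s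
  proof -
    have "\<psi> m + Complex 0 (sgn s * \<epsilon> / 2) \<in> U s"
    proof -
      have "cmod (Complex 0 (sgn s * \<epsilon> / 2)) < \<epsilon>"
        using \<epsilon>(1) that by (simp add: cmod_def abs_mult abs_sgn_eq)
      moreover have "0 < s * (sgn s * \<epsilon> / 2)"
      proof -
        have "s * (sgn s * \<epsilon> / 2) = \<bar>s\<bar> * \<epsilon> / 2" by (simp add: abs_sgn)
        moreover have "0 < \<bar>s\<bar> * \<epsilon> / 2" using \<epsilon>(1) that by simp
        ultimately show ?thesis by (simp only:)
      qed
      ultimately show ?thesis using mreal by (simp add: U_def dist_norm)
    qed
    then show ?thesis by blast
  qed
  define H where "H s = \<theta> ` U s" for s
  have UN: "U s \<subseteq> \<psi> ` N" for s using \<epsilon>(2) by (auto simp: U_def)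
  have \<psi>\<theta>: "\<psi> (\<theta> p) = p" "\<theta> p \<in> N" if "p \<in> \<psi> ` N" for p
    using \<theta> that unfolding homeomorphism_def by blast+
  have \<theta>\<psi>: "\<theta> (\<psi> x) = x" if "x \<in> N" for x using \<theta> that unfolding homeomorphism_def by blast
  have HN: "H s \<subseteq> N" for s using \<psi>\<theta>(2) UN unfolding H_def by blast
  have memH: "x \<in> H s \<longleftrightarrow> \<psi> x \<in> U s" if "x \<in> plane G" for x s
  proof
    assume "x \<in> H s" then show "\<psi> x \<in> U s" using \<psi>\<theta>(1) UN unfolding H_def by (metis imageE subsetD)
  next
    assume px: "\<psi> x \<in> U s"
    then have "\<theta> (\<psi> x) \<in> N" "\<psi> (\<theta> (\<psi> x)) = \<psi> x" using \<psi>\<theta> UN by blast+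
    then have "\<theta> (\<psi> x) = x" using inj_onD [OF \<psi>(2)] N(3) that by blast
    then show "x \<in> H s" using px unfolding H_def by (metis image_eqI)
  qed
  have Hconn: "connected (H s)" for s
  proof -
    have "continuous_on (U s) \<theta>" using \<theta> UN unfolding homeomorphism_def by (metis continuous_on_subset)
    then show ?thesis unfolding H_def using conv convex_connected connected_continuous_image by blast
  qed
  have Hcover: "H s \<subseteq> \<Union>\<F>" for s
  proof
    fix x assume x: "x \<in> H s"
    then have "x \<in> N" using HN by blast
    then have "\<psi> x \<in> U s" using memH x N(3) by blast
    then have "x \<notin> \<gamma> ` {0..1}" using real unfolding U_def by force
    then show "x \<in> \<Union>\<F>" using \<open>x \<in> N\<close> \<F>(3) by blast
  qed
  \<comment> \<open>F is open and adherent to m, and an open set does not fit into the axis, so F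
    meets a side. Each side is connected and avoids the arc, hence lies in a single member of the
    family.\<close>
  have side: "H 1 \<subseteq> F \<or> H (-1) \<subseteq> F" if FF: "F \<in> \<F>" "m \<in> closure F" for F
  proof -
    define V where "V = N \<inter> \<psi> -` ball (\<psi> m) \<epsilon>"
    have Vo: "open V"
      unfolding V_def using continuous_open_preimage [OF continuous_on_subset [OF \<psi>(1) N(3)] N(1) open_ball] .
    have "m \<in> V" using N(2) \<epsilon>(1) by (simp add: V_def)
    then have "V \<inter> F \<noteq> {}" using Vo FF(2) open_Int_closure_eq_empty by blast
    moreover have VFo: "open (V \<inter> F)" using Vo \<F>(1) [OF FF(1)] by blast
    moreover have VFN: "V \<inter> F \<subseteq> plane G" using N(3) by (auto simp: V_def)
    ultimately have o: "open (\<psi> ` (V \<inter> F))" "\<psi> ` (V \<inter> F) \<noteq> {}"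
      using invariance_of_domain [OF continuous_on_subset [OF \<psi>(1)] _ inj_on_subset [OF \<psi>(2)], of "V \<inter> F"] by auto
    have "\<not> \<psi> ` (V \<inter> F) \<subseteq> {p. inner (Complex 0 1) p = 0}"
    proof
      assume "\<psi> ` (V \<inter> F) \<subseteq> {p. inner (Complex 0 1) p = 0}"
      then have "\<psi> ` (V \<inter> F) \<subseteq> interior {p. inner (Complex 0 1) p = 0}" using o(1) by (rule interior_maximal)
      moreover have "interior {p. inner (Complex 0 1) p = (0::real)} = {}"
        by (rule interior_hyperplane) (simp add: complex_eq_iff)
      ultimately show False using o(2) by blast
    qed
    then obtain x where x: "x \<in> V" "x \<in> F" "Im (\<psi> x) \<noteq> 0" by (auto simp: inner_complex_def)
    then have "\<psi> x \<in> U 1 \<or> \<psi> x \<in> U (-1)" unfolding U_def V_def by auto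
    moreover have "x \<in> plane G" using x(1) N(3) by (auto simp: V_def)
    ultimately have "x \<in> H 1 \<or> x \<in> H (-1)" using memH by blast
    then show ?thesis
      using connected_subset_of_disjoint_opens [OF Hconn Hcover \<F>(1,2) FF(1)] x(2) by blast
  qed
  have "H 1 \<noteq> {}" "H (-1) \<noteq> {}" using Une unfolding H_def by simp_all
  moreover have "F1 \<inter> F2 = {}" using \<F>(2) F unfolding pairwise_def disjnt_def by blast
  ultimately have "(H 1 \<subseteq> F1 \<and> H (-1) \<subseteq> F2) \<or> (H (-1) \<subseteq> F1 \<and> H 1 \<subseteq> F2)"
    using side [OF F(1,4)] side [OF F(2,5)] by blast
  then obtain s where s: "s \<noteq> 0" "H s \<subseteq> F1" "H (- s) \<subseteq> F2"
    by (metis minus_minus zero_neq_neg_one zero_neq_one)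
  obtain x where x: "x \<in> H s" using Une [OF s(1)] unfolding H_def by blast
  then have xp: "x \<in> plane G" using HN N(3) by blast
  then have "\<psi> x \<in> U s" using memH x by blast
  then have "cnj (\<psi> x) \<in> U (- s)"
  proof -
    have "dist (\<psi> m) (cnj (\<psi> x)) = dist (\<psi> m) (\<psi> x)"
    proof -
      have "\<psi> m - cnj (\<psi> x) = cnj (\<psi> m - \<psi> x)" using mreal by (simp add: complex_eq_iff)
      then show ?thesis unfolding dist_norm by (metis complex_mod_cnj)
    qed
    then show ?thesis using \<open>\<psi> x \<in> U s\<close> by (simp add: U_def)
  qed
  then have "\<psi> (J x) \<in> U (- s)" using refl [OF xp] by simp
  then have "J x \<in> H (- s)" using memH Jin [OF xp] by blast
  then show ?thesis using s x by blast
qed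

lemma restrict_typed [simp]:
  "ftype (restrict_complex K A) = ftype K" "fmap (restrict_complex K A) = fmap K"
  by (simp_all add: restrict_complex_def)

section \<open>The types of the faces of an iterate\<close>

text \<open>Computed from the patches \<sigma>(T) alone, without models or gluings, so it applies to
  iterates and to supertiles of the tiling alike.\<close>

primrec types_of_iterate :: "('a, 't) presub \<Rightarrow> nat \<Rightarrow> 't \<Rightarrow> 't set" where
  "types_of_iterate S 0 i = {i}"
| "types_of_iterate S (Suc n) i = (\<Union>j\<in>types_of_iterate S n i. ftype (img S j) ` faces (img S j))"

lemma glued_faces: "glued S P Q \<iota> \<Longrightarrow> faces Q = (\<Union>f\<in>faces P. (`) (\<iota> f) ` faces (img S (ftype P f)))"
  unfolding glued_def by (elim conjE)

lemma glued_edges: "glued S P Q \<iota> \<Longrightarrow> edges Q = (\<Union>f\<in>faces P. (`) (\<iota> f) ` edges (img S (ftype P f)))"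
  unfolding glued_def by (elim conjE)

lemma glued_verts: "glued S P Q \<iota> \<Longrightarrow> verts Q = (\<Union>f\<in>faces P. \<iota> f ` verts (img S (ftype P f)))"
  unfolding glued_def by (elim conjE)

lemma glued_patch: "glued S P Q \<iota> \<Longrightarrow> is_patch (tile S) Q"
  unfolding glued_def by (elim conjE)

lemma glued_quotient:
  "glued S P Q \<iota> \<Longrightarrow>
    quotient_map (sum_topology (\<lambda>f. ctop (img S (ftype P f))) (faces P)) (ctop Q) (\<lambda>(f, y). \<iota> f y)"
  unfolding glued_def by (elim conjE)

lemma glued_typing:
  assumes "glued S P Q \<iota>" "f \<in> faces P" "g \<in> faces (img S (ftype P f))"
  shows "ftype Q (\<iota> f ` g) = ftype (img S (ftype P f)) g"
    and "c \<in> cells (restrict_complex (img S (ftype P f)) (closed_cell (img S (ftype P f)) g)) \<Longrightarrow>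
      fmap Q (\<iota> f ` g) ` \<iota> f ` c = fmap (img S (ftype P f)) g ` c"
proof -
  have "\<forall>f\<in>faces P. let R = img S (ftype P f) in \<forall>g\<in>faces R.
        ftype Q (\<iota> f ` g) = ftype R g \<and>
        (\<forall>c\<in>cells (restrict_complex R (closed_cell R g)).
           fmap Q (\<iota> f ` g) ` \<iota> f ` c = fmap R g ` c)"
    using assms(1) unfolding glued_def by (elim conjE)
  then have "ftype Q (\<iota> f ` g) = ftype (img S (ftype P f)) g \<and>
        (\<forall>c\<in>cells (restrict_complex (img S (ftype P f)) (closed_cell (img S (ftype P f)) g)).
           fmap Q (\<iota> f ` g) ` \<iota> f ` c = fmap (img S (ftype P f)) g ` c)"
    using assms(2,3) unfolding Let_def by blast
  then show "ftype Q (\<iota> f ` g) = ftype (img S (ftype P f)) g"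
    and "c \<in> cells (restrict_complex (img S (ftype P f)) (closed_cell (img S (ftype P f)) g)) \<Longrightarrow>
      fmap Q (\<iota> f ` g) ` \<iota> f ` c = fmap (img S (ftype P f)) g ` c"
    by blast+
qed

lemma glued_gluing:
  assumes "glued S P Q \<iota>"
  obtains h where "edge_gluing S P h"
    "\<forall>f\<in>faces P. \<forall>y\<in>topspace (ctop (img S (ftype P f))).
      \<forall>f'\<in>faces P. \<forall>y'\<in>topspace (ctop (img S (ftype P f'))).
      \<iota> f y = \<iota> f' y' \<longleftrightarrow> ((f, y), (f', y')) \<in> (gluing_rel S P h)\<^sup>*"
proof -
  have "\<exists>h. edge_gluing S P h \<and>
        (\<forall>f\<in>faces P. \<forall>y\<in>topspace (ctop (img S (ftype P f))).
         \<forall>f'\<in>faces P. \<forall>y'\<in>topspace (ctop (img S (ftype P f'))).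
           \<iota> f y = \<iota> f' y' \<longleftrightarrow> ((f, y), (f', y')) \<in> (gluing_rel S P h)\<^sup>*)"
    using assms unfolding glued_def by (elim conjE)
  then show thesis by (elim exE conjE) (rule that)
qed

lemma glued_types:
  assumes g: "glued S P Q \<iota>"
  shows "ftype Q ` faces Q = (\<Union>j\<in>ftype P ` faces P. ftype (img S j) ` faces (img S j))"
proof -
  have "ftype Q ` faces Q = (\<Union>f\<in>faces P. (\<lambda>a. ftype Q (\<iota> f ` a)) ` faces (img S (ftype P f)))"
    unfolding glued_faces [OF g] by (simp add: image_UN image_image)
  also have "\<dots> = (\<Union>f\<in>faces P. ftype (img S (ftype P f)) ` faces (img S (ftype P f)))"
    using glued_typing(1) [OF g] by (intro SUP_cong image_cong refl) auto
  finally show ?thesis by simp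
qed

lemma iterate_types:
  "iterate S n i P \<phi> \<Longrightarrow> ftype P ` faces P = types_of_iterate S n i"
proof (induction n arbitrary: P \<phi>)
  case 0
  then show ?case by (auto simp: single_tile_def)
next
  case (Suc n)
  then obtain P' \<psi> \<iota> where P': "iterate S n i P' \<psi>" "glued S P' P \<iota>" by auto
  show ?case using Suc.IH [OF P'(1)] glued_types [OF P'(2)] by simp
qed

section \<open>Geometric realizations\<close>

text \<open>It names the witnesses hidden in \<open>sigma_infinity\<close> and
  \<open>geometric_realization\<close>. A single \<iota> serves all levels, so the subdivision of a
  face does not depend on the level at which the face is viewed.\<close>

locale realized_complex =
  fixes S :: "('a, 't::finite) presub" and G :: geometry and \<Gamma> :: "(complex \<Rightarrow> complex) set"
    and \<P> :: "'l labelled_tile set set" and \<T> :: "'l labelled_tile set" and t :: 't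
    and ty :: "complex set \<Rightarrow> 't" and \<tau> :: "complex set \<Rightarrow> complex \<Rightarrow> 'a"
    and A :: "nat \<Rightarrow> complex set" and \<iota> :: "complex set \<Rightarrow> 'a \<Rightarrow> complex" and f\<^sub>0 :: "complex set"
    and proto :: "'t \<Rightarrow> 'l labelled_tile set" and R :: "'t \<Rightarrow> 'l labelled_tile" and \<rho> :: "'t \<Rightarrow> 'a \<Rightarrow> complex"
    and Y :: "(complex, 'a, 't) typed_complex" and P :: "nat \<Rightarrow> (complex, 'a, 't) typed_complex"
  assumes pre: "pre_substitution S" and tiling: "is_tiling G \<Gamma> \<P> \<T>"
    and Y_def: "Y = tiling_complex G \<T> ty \<tau>" and P_def: "P = (\<lambda>k. restrict_complex Y (A k))"
    and base: "single_tile S t (P 0) f\<^sub>0"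
    and A_Suc: "A k \<subseteq> A (Suc k)" and glue: "glued S (P k) (P (Suc k)) \<iota>"
    and top_Y: "topspace (ctop Y) = (\<Union>k. A k)"
    and faces_Y: "faces Y = (\<Union>k. faces (P k))"
    and closed_Y: "closedin (ctop Y) C \<longleftrightarrow>
      C \<subseteq> topspace (ctop Y) \<and> (\<forall>k. closedin (ctop (P k)) (C \<inter> A k))"
    and proto_R: "R i \<in> proto i" and proto_\<P>: "proto i \<in> \<P>"
    and \<rho>: "homeomorphic_map (ctop (tile S i)) (top_of_set (fst (R i))) (\<rho> i)"
    and placed: "u \<in> \<T> \<Longrightarrow> prototile_of G \<Gamma> u = proto (ty (interior (fst u))) \<and>
      (\<exists>g\<in>\<Gamma>. fst u = g ` fst (R (ty (interior (fst u)))) \<and>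
        (\<forall>c\<in>cells (tile S (ty (interior (fst u)))). \<tau> (interior (fst u)) ` g ` \<rho> (ty (interior (fst u))) ` c = c))"
begin

section \<open>The tiling complex and its exhaustion by the patches \<open>P k\<close>\<close>

lemma \<Gamma>: "subgroup \<Gamma> (isom_group G)"
  using tiling by (simp add: is_tiling_def)

lemma polygon: "topological_polygon (tile S i)"
  and img_patch: "is_patch (tile S) (img S i)"
  and smap_homeo: "homeomorphic_map (ctop (tile S i)) (ctop (img S i)) (smap S i)"
  and smap_verts: "smap S i ` verts (tile S i) \<subseteq> verts (img S i) \<inter> boundary_circle (img S i)"
  using pre unfolding pre_substitution_def by blast+

lemma tile_cw2: "cw2 (tile S i)"
  by (rule polygon_cw2 [OF polygon])

lemma img_cw2: "cw2 (img S i)" and img_disc: "is_disc (img S i)"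
  using patch_cw2 [OF img_patch tile_cw2] patch_disc [OF img_patch tile_cw2] .

lemma Y_simps: "ctop Y = top_of_set (plane G)" "verts Y = tiling_vertices \<T>"
  "edges Y = components ((\<Union>u\<in>\<T>. frontier (fst u)) - tiling_vertices \<T>)"
  "faces Y = (\<lambda>u. interior (fst u)) ` \<T>" "ftype Y = ty" "fmap Y = \<tau>"
  unfolding Y_def tiling_complex_def by simp_all

lemma ftype_P [simp]: "ftype (P k) = ty" and fmap_P [simp]: "fmap (P k) = \<tau>"
  by (simp_all add: P_def Y_simps)

lemma plane_A: "plane G = (\<Union>k. A k)"
  using top_Y by (simp add: Y_simps)

lemma A_subset: "A k \<subseteq> plane G"
  using plane_A by blast

lemma A_mono: "k \<le> l \<Longrightarrow> A k \<subseteq> A l"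
  using lift_Suc_mono_le [of A] A_Suc by blast

lemma ctop_P [simp]: "ctop (P k) = top_of_set (A k)"
  using A_subset [of k] by (simp add: P_def Y_simps subtopology_subtopology Int_absorb1)

lemma P_patch: "is_patch (tile S) (P k)"
proof (cases k)
  case 0
  then show ?thesis using base unfolding single_tile_def by blast
next
  case (Suc n)
  then show ?thesis using glued_patch [OF glue] by simp
qed

lemma P_cw2: "cw2 (P k)" and P_disc: "is_disc (P k)"
  using patch_cw2 [OF P_patch tile_cw2] patch_disc [OF P_patch tile_cw2] .

lemma compact_A: "compact (A k)"
proof -
  have "compact_space (top_of_set (A k))" using disc_compact [OF P_disc [of k]] by simp
  then have "compactin euclidean (A k)" by (subst compactin_subspace) simp
  then show ?thesis by simp
qed

text \<open>\<open>A k\<close> is compact, so closures relative to it are closures in the complex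
  numbers, independent of k.\<close>

lemma closed_cell_P: "c \<subseteq> A k \<Longrightarrow> closed_cell (P k) c = closure c"
  using closure_minimal [OF _ compact_imp_closed [OF compact_A]]
  by (simp add: closure_of_subtopology Int_absorb1)

lemma faces_P: "faces (P k) = {f \<in> faces Y. f \<subseteq> A k}"
  and edges_P: "edges (P k) = {e \<in> edges Y. e \<subseteq> A k}"
  and verts_P: "verts (P k) = verts Y \<inter> A k"
  and cells_P: "c \<in> cells (P k) \<longleftrightarrow> c \<in> cells Y \<and> c \<subseteq> A k"
  unfolding P_def by (auto simp: cells_restrict)

lemma face_in_P:
  assumes "f \<in> faces Y" obtains k where "f \<in> faces (P k)"
  using assms faces_Y by blast

lemma faces_P_mono: "k \<le> l \<Longrightarrow> faces (P k) \<subseteq> faces (P l)"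
  using A_mono [of k l] unfolding faces_P by blast

lemma faces_in_P:
  assumes "f \<in> faces Y" "g \<in> faces Y"
  obtains k where "f \<in> faces (P k)" "g \<in> faces (P k)"
proof -
  obtain k l where "f \<in> faces (P k)" "g \<in> faces (P l)" using face_in_P assms by metis
  then have "f \<in> faces (P (max k l))" "g \<in> faces (P (max k l))"
    using faces_P_mono [of k "max k l"] faces_P_mono [of l "max k l"] by auto
  then show thesis by (rule that)
qed

lemma closure_face: "f \<in> faces (P k) \<Longrightarrow> closed_cell (P k) f = closure f"
  by (rule closed_cell_P) (simp add: faces_P)

lemma closure_face_subset: "f \<in> faces (P k) \<Longrightarrow> closure f \<subseteq> A k"
  using closure_minimal [OF _ compact_imp_closed [OF compact_A]] by (simp add: faces_P)

lemma face_open: "f \<in> faces Y \<Longrightarrow> open f"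
  by (auto simp: Y_simps)

lemma faces_disjoint_Y: "f \<in> faces Y \<Longrightarrow> g \<in> faces Y \<Longrightarrow> x \<in> f \<Longrightarrow> x \<in> g \<Longrightarrow> f = g"
  using faces_in_P [of f g] faces_disjoint [OF P_cw2] by metis

lemma face_nonempty: "f \<in> faces Y \<Longrightarrow> f \<noteq> {}"
  using face_in_P cell_nonempty [OF P_cw2 face_cell [OF P_cw2]] by metis

text \<open>The usual argument for increasing unions with the weak topology: points chosen outside
  each \<open>A k\<close> form a set all of whose subsets are closed, so this set is finite.\<close>

lemma compact_subset_A:
  assumes K: "compact K" "K \<subseteq> plane G" obtains k where "K \<subseteq> A k"
proof (rule ccontr)
  assume "\<not> thesis"
  then have "\<forall>k. \<exists>x. x \<in> K \<and> x \<notin> A k" using that by blast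
  then obtain x where x: "\<And>k. x k \<in> K" "\<And>k. x k \<notin> A k" by metis
  have fin: "D \<inter> A k \<subseteq> x ` {..<k}" if D: "D \<subseteq> range x" for D k
  proof
    fix y assume y: "y \<in> D \<inter> A k"
    then obtain j where j: "y = x j" using D by blast
    have "j < k" using x(2) [of j] A_mono [of k j] y j by (meson Int_iff leI subsetD)
    then show "y \<in> x ` {..<k}" using j by blast
  qed
  have "finite (range x)"
  proof (rule finite_if_subsets_closed)
    show "compactin (ctop Y) K" using K by (simp add: Y_simps compactin_subtopology)
    show "range x \<subseteq> K" using x by blast
    fix D assume D: "D \<subseteq> range x"
    show "closedin (ctop Y) D"
    proof (rule closed_Y [THEN iffD2], intro conjI allI)
      show "D \<subseteq> topspace (ctop Y)" using D x K by (auto simp: Y_simps)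
      fix k
      have "finite (D \<inter> A k)" using fin [OF D] finite_subset by blast
      then show "closedin (ctop (P k)) (D \<inter> A k)"
        by (intro closedin_Hausdorff_finite [OF cw2_Hausdorff [OF P_cw2]]) auto
    qed
  qed
  moreover have "\<exists>k. y \<in> A k" if "y \<in> range x" for y using that x(1) K(2) plane_A by blast
  then obtain n where n: "\<And>y. y \<in> range x \<Longrightarrow> y \<in> A (n y)" by metis
  ultimately have "finite (n ` range x)" by simp
  \<comment> \<open>Finitely many points lie in a common \<open>A k\<close>, against the choice of
    the point with that index.\<close>
  then have "n y \<le> Max (n ` range x)" if "y \<in> range x" for y using that by simp
  then have "x (Max (n ` range x)) \<in> A (Max (n ` range x))"
    using n [of "x (Max (n ` range x))"] A_mono by blast
  then show False using x(2) by blast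
qed

subsection \<open>Closed faces\<close>

lemma face_iso:
  assumes "f \<in> faces (P k)"
  shows "cell_iso (\<tau> f) (restrict_complex (P k) (closure f)) (tile S (ty f))"
  using patch_face_iso [OF P_patch tile_cw2 assms] closure_face [OF assms] by simp

lemma face_homeo:
  assumes f: "f \<in> faces Y"
  shows "homeomorphic_map (top_of_set (closure f)) (ctop (tile S (ty f))) (\<tau> f)"
proof -
  obtain k where k: "f \<in> faces (P k)" using face_in_P [OF f] .
  have "ctop (restrict_complex (P k) (closure f)) = top_of_set (closure f)"
    using closure_face_subset [OF k] by (simp add: subtopology_subtopology Int_absorb1)
  then show ?thesis using face_iso [OF k] unfolding cell_iso_def by simp
qed

lemma face_inj: "f \<in> faces Y \<Longrightarrow> inj_on (\<tau> f) (closure f)"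
  using homeomorphic_mapD(3) [OF face_homeo] by simp

lemma face_image: "f \<in> faces Y \<Longrightarrow> \<tau> f ` closure f = topspace (ctop (tile S (ty f)))"
  using homeomorphic_mapD(2) [OF face_homeo] by simp

lemma face_cell_image:
  assumes f: "f \<in> faces Y" and c: "c \<in> cells Y" "c \<subseteq> closure f"
  shows "\<tau> f ` c \<in> cells (tile S (ty f))"
proof -
  obtain k where k: "f \<in> faces (P k)" using face_in_P [OF f] .
  have "c \<in> cells (restrict_complex (P k) (closure f))"
    using c closure_face_subset [OF k] by (simp add: cells_restrict cells_P)
  then show ?thesis using cell_iso_cells [OF face_iso [OF k]] by blast
qed

lemma face_edge_image:
  assumes f: "f \<in> faces Y" and e: "e \<in> edges Y" "e \<subseteq> closure f"
  shows "\<tau> f ` e \<in> edges (tile S (ty f))"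
proof -
  obtain k where k: "f \<in> faces (P k)" using face_in_P [OF f] .
  have "e \<in> edges (restrict_complex (P k) (closure f))"
    using e closure_face_subset [OF k] by (auto simp: edges_P)
  then show ?thesis using face_iso [OF k] unfolding cell_iso_def by blast
qed

lemma face_vert_preimage:
  assumes f: "f \<in> faces Y" and w: "w \<in> verts (tile S (ty f))"
  obtains v where "v \<in> verts Y" "v \<in> closure f" "\<tau> f v = w"
proof -
  obtain k where k: "f \<in> faces (P k)" using face_in_P [OF f] .
  have "w \<in> \<tau> f ` verts (restrict_complex (P k) (closure f))"
    using w face_iso [OF k] unfolding cell_iso_def by blast
  then show thesis using that by (auto simp: verts_P)
qed

lemma edge_in_P: "f \<in> faces (P k) \<Longrightarrow> e \<in> edges Y \<Longrightarrow> e \<subseteq> closure f \<Longrightarrow> e \<in> edges (P k)"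
  using closure_face_subset edges_P by blast

lemma face_closed_edge:
  assumes f: "f \<in> faces Y" and e: "e \<subseteq> closure f"
  shows "\<tau> f ` closure e = closed_cell (tile S (ty f)) (\<tau> f ` e)"
proof -
  have "top_of_set (closure f) closure_of e = closure e"
    using e closure_minimal [OF e] by (simp add: closure_of_subtopology Int_absorb1)
  then show ?thesis using homeomorphic_map_closure_of [OF face_homeo [OF f], of e] e by simp
qed

lemma edge_arc:
  assumes f: "f \<in> faces Y" and e: "e \<in> edges Y" "e \<subseteq> closure f"
  obtains \<gamma> :: "real \<Rightarrow> complex" where "continuous_on {0..1} \<gamma>" "inj_on \<gamma> {0..1}" "\<gamma> ` {0..1} = closure e"
    "\<gamma> ` {0<..<1} = e" "\<gamma> 0 \<in> verts Y" "\<gamma> 1 \<in> verts Y"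
proof -
  let ?K = "tile S (ty f)"
  have ed: "\<tau> f ` e \<in> edges ?K" by (rule face_edge_image [OF f e])
  obtain \<gamma> :: "real \<Rightarrow> 'a" where \<gamma>: "homeomorphic_map (top_of_set {0..1}) (subtopology (ctop ?K) (closed_cell ?K (\<tau> f ` e))) \<gamma>"
    "\<gamma> ` {0<..<1} = \<tau> f ` e" "\<gamma> 0 \<in> verts ?K" "\<gamma> 1 \<in> verts ?K" "\<gamma> 0 \<noteq> \<gamma> 1"
    by (rule polygon_edge [OF polygon ed])
  obtain \<theta> where \<theta>: "homeomorphic_map (ctop ?K) (top_of_set (closure f)) \<theta>"
    "\<And>x. x \<in> topspace (top_of_set (closure f)) \<Longrightarrow> \<theta> (\<tau> f x) = x"
    "\<And>y. y \<in> topspace (ctop ?K) \<Longrightarrow> \<tau> f (\<theta> y) = y"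
    using homeomorphic_map_inverse [OF face_homeo [OF f]] by metis
  have cl: "closure e \<subseteq> closure f" by (rule closure_minimal [OF e(2) closed_closure])
  have inv: "\<theta> ` \<tau> f ` B = B" if "B \<subseteq> closure f" for B
    using \<theta>(2) that by (force simp: image_image)
  have top: "topspace (subtopology (ctop ?K) (closed_cell ?K (\<tau> f ` e))) = \<tau> f ` closure e"
    unfolding face_closed_edge [OF f e(2)] by (simp add: Int_absorb1 closure_of_subset_topspace)
  have im: "\<gamma> ` {0..1} = \<tau> f ` closure e" using homeomorphic_mapD(2) [OF \<gamma>(1)] top by simp
  have cont: "continuous_map (top_of_set {0..1}) (ctop ?K) \<gamma>"
    using homeomorphic_mapD(1) [OF \<gamma>(1)] by (rule continuous_map_into_fulltopology)
  show thesis
  proof (rule that [of "\<theta> \<circ> \<gamma>"])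
    have "continuous_map (top_of_set {0..1}) (top_of_set (closure f)) (\<theta> \<circ> \<gamma>)"
      using cont homeomorphic_mapD(1) [OF \<theta>(1)] by (rule continuous_map_compose)
    then show "continuous_on {0..1} (\<theta> \<circ> \<gamma>)" by (auto dest: continuous_map_into_fulltopology)
    show "inj_on (\<theta> \<circ> \<gamma>) {0..1}"
    proof (rule comp_inj_on)
      show "inj_on \<gamma> {0..1}" using homeomorphic_mapD(3) [OF \<gamma>(1)] by simp
      show "inj_on \<theta> (\<gamma> ` {0..1})"
        using homeomorphic_mapD(3) [OF \<theta>(1)] by (rule inj_on_subset) (use im face_image [OF f] cl in blast)
    qed
    show "(\<theta> \<circ> \<gamma>) ` {0..1} = closure e" unfolding image_comp [symmetric] im by (rule inv [OF cl])
    show "(\<theta> \<circ> \<gamma>) ` {0<..<1} = e" unfolding image_comp [symmetric] \<gamma>(2) by (rule inv [OF e(2)])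
    have v: "\<theta> w \<in> verts Y" if w: "w \<in> verts ?K" for w
    proof -
      obtain v where v: "v \<in> verts Y" "v \<in> closure f" "\<tau> f v = w" using face_vert_preimage [OF f w] .
      then show ?thesis using \<theta>(2) [of v] by simp
    qed
    show "(\<theta> \<circ> \<gamma>) 0 \<in> verts Y" "(\<theta> \<circ> \<gamma>) 1 \<in> verts Y" using v \<gamma>(3,4) by simp_all
  qed
qed

subsection \<open>The subdivision of a face\<close>

lemma sub_cont:
  assumes f: "f \<in> faces Y" shows "continuous_map (ctop (img S (ty f))) (top_of_set (plane G)) (\<iota> f)"
proof -
  obtain k where k: "f \<in> faces (P k)" using face_in_P [OF f] .
  have "continuous_map (sum_topology (\<lambda>f. ctop (img S (ftype (P k) f))) (faces (P k))) (ctop (P (Suc k))) (\<lambda>(f, y). \<iota> f y)"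
    by (rule quotient_imp_continuous_map [OF glued_quotient [OF glue]])
  moreover have "continuous_map (ctop (img S (ftype (P k) f))) (sum_topology (\<lambda>f. ctop (img S (ftype (P k) f))) (faces (P k))) (\<lambda>y. (f, y))"
    by (rule continuous_map_component_injection [OF k])
  ultimately have "continuous_map (ctop (img S (ftype (P k) f))) (ctop (P (Suc k))) ((\<lambda>(f, y). \<iota> f y) \<circ> (\<lambda>y. (f, y)))"
    by (rule continuous_map_compose [rotated])
  then have "continuous_map (ctop (img S (ty f))) (top_of_set (A (Suc k))) (\<iota> f)" by (simp add: comp_def)
  then have "continuous_map (ctop (img S (ty f))) euclidean (\<iota> f)"
    and "\<iota> f ` topspace (ctop (img S (ty f))) \<subseteq> A (Suc k)"
    by (auto simp: continuous_map_in_subtopology)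
  moreover from this A_subset [of "Suc k"] have "\<iota> f ` topspace (ctop (img S (ty f))) \<subseteq> plane G" by blast
  ultimately show ?thesis by (auto simp: continuous_map_in_subtopology)
qed

lemma sub_face:
  assumes f: "f \<in> faces Y" and a: "a \<in> faces (img S (ty f))"
  shows "\<iota> f ` a \<in> faces Y" "ty (\<iota> f ` a) = ftype (img S (ty f)) a"
    and "c \<in> cells (img S (ty f)) \<Longrightarrow> c \<subseteq> closed_cell (img S (ty f)) a \<Longrightarrow>
      \<tau> (\<iota> f ` a) ` \<iota> f ` c = fmap (img S (ty f)) a ` c"
proof -
  obtain k where k: "f \<in> faces (P k)" using face_in_P [OF f] .
  have "\<iota> f ` a \<in> faces (P (Suc k))" using glued_faces [OF glue [of k]] k a by auto
  then show "\<iota> f ` a \<in> faces Y" by (simp add: faces_P)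
  show "ty (\<iota> f ` a) = ftype (img S (ty f)) a" using glued_typing(1) [OF glue k] a by simp
  show "\<tau> (\<iota> f ` a) ` \<iota> f ` c = fmap (img S (ty f)) a ` c"
    if "c \<in> cells (img S (ty f))" "c \<subseteq> closed_cell (img S (ty f)) a" for c
    using glued_typing(2) [OF glue k, of a c] a that by (simp add: cells_restrict)
qed

lemma sub_edge: "f \<in> faces Y \<Longrightarrow> c \<in> edges (img S (ty f)) \<Longrightarrow> \<iota> f ` c \<in> edges Y"
proof -
  assume f: "f \<in> faces Y" and c: "c \<in> edges (img S (ty f))"
  obtain k where k: "f \<in> faces (P k)" using face_in_P [OF f] .
  have "\<iota> f ` c \<in> edges (P (Suc k))" using glued_edges [OF glue [of k]] k c by auto
  then show "\<iota> f ` c \<in> edges Y" by (simp add: edges_P)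
qed

lemma sub_vert: "f \<in> faces Y \<Longrightarrow> v \<in> verts (img S (ty f)) \<Longrightarrow> \<iota> f v \<in> verts Y"
proof -
  assume f: "f \<in> faces Y" and v: "v \<in> verts (img S (ty f))"
  obtain k where k: "f \<in> faces (P k)" using face_in_P [OF f] .
  have "\<iota> f v \<in> verts (P (Suc k))" using glued_verts [OF glue [of k]] k v by auto
  then show "\<iota> f v \<in> verts Y" by (simp add: verts_P)
qed

text \<open>The closed cell is compact, so its continuous image is closed; continuity gives the
  other inclusion.\<close>

lemma sub_closure:
  assumes f: "f \<in> faces Y" and c: "c \<subseteq> topspace (ctop (img S (ty f)))"
  shows "closure (\<iota> f ` c) = \<iota> f ` closed_cell (img S (ty f)) c"
proof
  let ?K = "img S (ty f)"
  note cont = continuous_map_into_fulltopology [OF sub_cont [OF f]]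
  have "compactin (ctop ?K) (closed_cell ?K c)"
    using closedin_compact_space [OF disc_compact [OF img_disc]] by simp
  then have "compactin euclidean (\<iota> f ` closed_cell ?K c)" by (rule image_compactin [OF _ cont])
  then have "closed (\<iota> f ` closed_cell ?K c)" by (simp add: compact_imp_closed)
  moreover have "\<iota> f ` c \<subseteq> \<iota> f ` closed_cell ?K c" using closure_of_subset [OF c] by blast
  ultimately show "closure (\<iota> f ` c) \<subseteq> \<iota> f ` closed_cell ?K c" by (rule closure_minimal [rotated])
  show "\<iota> f ` closed_cell ?K c \<subseteq> closure (\<iota> f ` c)"
    using continuous_map_image_closure_subset [OF cont, of c] by simp
qed

text \<open>The edge path \<open>\<sigma>(d)\<close> of an edge \<open>d\<close> of \<open>T\<^sub>i\<close>, as a subset of \<open>\<sigma>(T\<^sub>i)\<close>.\<close>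

definition edge_path :: "'t \<Rightarrow> 'a set \<Rightarrow> 'a set" where
  "edge_path i d = smap S i ` closed_cell (tile S i) d"

lemma edge_path_boundary:
  assumes "d \<in> edges (tile S i)" shows "edge_path i d \<subseteq> boundary_circle (img S i)"
  using boundary_circle_homeo [OF smap_homeo] polygon_closed_edge_boundary [OF polygon assms]
  unfolding edge_path_def by blast

lemma edge_path_arc:
  assumes d: "d \<in> edges (tile S i)"
  obtains \<gamma> :: "real \<Rightarrow> 'a" where
    "homeomorphic_map (top_of_set {0..1}) (subtopology (ctop (img S i)) (edge_path i d)) (smap S i \<circ> \<gamma>)"
    "\<gamma> ` {0..1} = closed_cell (tile S i) d" "\<gamma> 0 \<in> verts (tile S i)" "\<gamma> 1 \<in> verts (tile S i)"
proof -
  obtain \<gamma> :: "real \<Rightarrow> 'a" where \<gamma>: "homeomorphic_map (top_of_set {0..1}) (subtopology (ctop (tile S i)) (closed_cell (tile S i) d)) \<gamma>"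
    "\<gamma> ` {0<..<1} = d" "\<gamma> 0 \<in> verts (tile S i)" "\<gamma> 1 \<in> verts (tile S i)" "\<gamma> 0 \<noteq> \<gamma> 1"
    by (rule polygon_edge [OF polygon d])
  have ct: "closed_cell (tile S i) d \<subseteq> topspace (ctop (tile S i))" by (rule closure_of_subset_topspace)
  then have "smap S i ` closed_cell (tile S i) d \<subseteq> topspace (ctop (img S i))"
    using homeomorphic_mapD(2) [OF smap_homeo] by blast
  then have "homeomorphic_map (subtopology (ctop (tile S i)) (closed_cell (tile S i) d))
    (subtopology (ctop (img S i)) (edge_path i d)) (smap S i)"
    using ct unfolding edge_path_def
    by (intro homeomorphic_map_subtopologies [OF smap_homeo]) (simp add: Int_absorb1)
  then have "homeomorphic_map (top_of_set {0..1}) (subtopology (ctop (img S i)) (edge_path i d)) (smap S i \<circ> \<gamma>)"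
    by (rule homeomorphic_map_compose [OF \<gamma>(1)])
  moreover have "\<gamma> ` {0..1} = closed_cell (tile S i) d"
    using homeomorphic_mapD(2) [OF \<gamma>(1)] ct by (simp add: Int_absorb1)
  ultimately show thesis using that \<gamma>(3,4) by blast
qed

lemma sub_image_eq:
  assumes "f \<in> faces (P k)" "e \<subseteq> closure f"
  shows "sub_image S (P k) f (closed_cell (P k) e) = edge_path (ty f) (\<tau> f ` e)"
proof -
  have f: "f \<in> faces Y" using assms(1) by (simp add: faces_P)
  have "e \<subseteq> A k" using assms closure_face_subset by blast
  then show ?thesis
    unfolding sub_image_def edge_path_def closed_cell_P [OF \<open>e \<subseteq> A k\<close>]
    by (simp add: face_closed_edge [OF f assms(2)])
qed

text \<open>h is taken from the gluing at some level containing both faces. As \<iota> is common to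
  all levels, the identification it yields does not mention that level.\<close>

lemma sub_gluing:
  assumes f: "f \<in> faces Y" "f' \<in> faces Y" "f \<noteq> f'" and e: "e \<in> edges Y" "e \<subseteq> closure f" "e \<subseteq> closure f'"
  obtains h where
    "cell_iso h (restrict_complex (img S (ty f)) (edge_path (ty f) (\<tau> f ` e)))
      (restrict_complex (img S (ty f')) (edge_path (ty f') (\<tau> f' ` e)))"
    "\<And>v. v \<in> verts Y \<Longrightarrow> v \<in> closure e \<Longrightarrow> h (smap S (ty f) (\<tau> f v)) = smap S (ty f') (\<tau> f' v)"
    "\<And>y. y \<in> edge_path (ty f) (\<tau> f ` e) \<Longrightarrow> \<iota> f y = \<iota> f' (h y)"
proof -
  obtain k where k: "f \<in> faces (P k)" "f' \<in> faces (P k)" using faces_in_P [OF f(1,2)] .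
  have ek: "e \<in> edges (P k)" by (rule edge_in_P [OF k(1) e(1,2)])
  have eA: "e \<subseteq> A k" using ek by (simp add: edges_P)
  have cl: "closed_cell (P k) e = closure e" by (rule closed_cell_P [OF eA])
  have ef: "e \<subseteq> closed_cell (P k) f" "e \<subseteq> closed_cell (P k) f'"
    using e closure_face k by simp_all
  obtain h where h: "edge_gluing S (P k) h"
    and rel: "\<forall>f\<in>faces (P k). \<forall>y\<in>topspace (ctop (img S (ftype (P k) f))).
      \<forall>f'\<in>faces (P k). \<forall>y'\<in>topspace (ctop (img S (ftype (P k) f'))).
      \<iota> f y = \<iota> f' y' \<longleftrightarrow> ((f, y), (f', y')) \<in> (gluing_rel S (P k) h)\<^sup>*"
    by (rule glued_gluing [OF glue [of k]])
  have "cell_iso (h e f f')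
          (restrict_complex (img S (ftype (P k) f)) (sub_image S (P k) f (closed_cell (P k) e)))
          (restrict_complex (img S (ftype (P k) f')) (sub_image S (P k) f' (closed_cell (P k) e))) \<and>
        (\<forall>v \<in> verts (P k) \<inter> closed_cell (P k) e.
           h e f f' (smap S (ftype (P k) f) (fmap (P k) f v)) = smap S (ftype (P k) f') (fmap (P k) f' v))"
    using h ek k f(3) ef unfolding edge_gluing_def by blast
  then have iso: "cell_iso (h e f f') (restrict_complex (img S (ty f)) (edge_path (ty f) (\<tau> f ` e)))
      (restrict_complex (img S (ty f')) (edge_path (ty f') (\<tau> f' ` e)))"
    and vs: "\<forall>v \<in> verts (P k) \<inter> closure e. h e f f' (smap S (ty f) (\<tau> f v)) = smap S (ty f') (\<tau> f' v)"
    unfolding sub_image_eq [OF k(1) e(2)] sub_image_eq [OF k(2) e(3)] unfolding cl by simp_all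
  show thesis
  proof (rule that [OF iso])
    fix v assume "v \<in> verts Y" "v \<in> closure e"
    moreover have "closure e \<subseteq> A k" using closure_minimal [OF eA compact_imp_closed [OF compact_A]] .
    ultimately show "h e f f' (smap S (ty f) (\<tau> f v)) = smap S (ty f') (\<tau> f' v)"
      using vs by (auto simp: verts_P)
  next
    fix y assume y: "y \<in> edge_path (ty f) (\<tau> f ` e)"
    have "((f, y), (f', h e f f' y)) \<in> gluing_rel S (P k) h"
      unfolding gluing_rel_def using ek k f(3) ef y sub_image_eq [OF k(1) e(2)] by blast
    moreover have yt: "y \<in> topspace (ctop (img S (ty f)))"
      using y edge_path_boundary [OF face_edge_image [OF f(1) e(1,2)]] unfolding boundary_circle_def by blast
    moreover have "h e f f' y \<in> topspace (ctop (img S (ty f')))"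
    proof -
      have hm: "homeomorphic_map (subtopology (ctop (img S (ty f))) (edge_path (ty f) (\<tau> f ` e)))
        (subtopology (ctop (img S (ty f'))) (edge_path (ty f') (\<tau> f' ` e))) (h e f f')"
        using iso unfolding cell_iso_def by simp
      have "y \<in> topspace (subtopology (ctop (img S (ty f))) (edge_path (ty f) (\<tau> f ` e)))" using y yt by simp
      then have "h e f f' y \<in> topspace (subtopology (ctop (img S (ty f'))) (edge_path (ty f') (\<tau> f' ` e)))"
        using homeomorphic_mapD(2) [OF hm] by blast
      then show ?thesis by simp
    qed
    ultimately show "\<iota> f y = \<iota> f' (h e f f' y)"
      using rel k by fastforce
  qed
qed

text \<open>Gluing only identifies points of edge paths. These lie on the boundary circle of
  \<sigma>(T), which open faces avoid, so the class of a point of an open face is trivial.\<close>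

lemma sub_face_inj:
  assumes f: "f \<in> faces Y" "f' \<in> faces Y" and a: "a \<in> faces (img S (ty f))" "y \<in> a"
    and y': "y' \<in> topspace (ctop (img S (ty f')))" and eq: "\<iota> f y = \<iota> f' y'"
  shows "f = f' \<and> y = y'"
proof -
  obtain k where k: "f \<in> faces (P k)" "f' \<in> faces (P k)" using faces_in_P [OF f] .
  obtain h where rel: "\<forall>f\<in>faces (P k). \<forall>y\<in>topspace (ctop (img S (ftype (P k) f))).
      \<forall>f'\<in>faces (P k). \<forall>y'\<in>topspace (ctop (img S (ftype (P k) f'))).
      \<iota> f y = \<iota> f' y' \<longleftrightarrow> ((f, y), (f', y')) \<in> (gluing_rel S (P k) h)\<^sup>*"
    by (rule glued_gluing [OF glue [of k]])
  have "y \<in> topspace (ctop (img S (ty f)))"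
    using cw2_cell_subset [OF img_cw2 face_cell [OF img_cw2 a(1)]] a(2) by blast
  then have "((f, y), (f', y')) \<in> (gluing_rel S (P k) h)\<^sup>*"
    using rel k y' eq by fastforce
  then show ?thesis
  proof (cases rule: converse_rtranclE)
    case (step z)
    then obtain e where e: "e \<in> edges (P k)" "e \<subseteq> closed_cell (P k) f"
      "y \<in> sub_image S (P k) f (closed_cell (P k) e)"
      unfolding gluing_rel_def by blast
    have ef: "e \<subseteq> closure f" using e(2) closure_face [OF k(1)] by simp
    have eY: "e \<in> edges Y" using e(1) by (simp add: edges_P)
    have "y \<in> boundary_circle (img S (ty f))"
      using e(3) edge_path_boundary [OF face_edge_image [OF f(1) eY ef]]
      unfolding sub_image_eq [OF k(1) ef] by blast
    then show ?thesis using face_not_boundary [OF img_cw2 img_disc a(1)] a(2) by blast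
  qed simp
qed

subsection \<open>Pairs of adjacent faces\<close>

text \<open>
  Two pairs of adjacent faces that look the same.  Of the common edges only the end points have to
  correspond pointwise: the gluing maps at two places may differ inside an edge, but they are determined
  on cells by the end points.
\<close>

definition parallel :: "complex set \<Rightarrow> complex set \<Rightarrow> complex set \<Rightarrow> complex set \<Rightarrow> bool" where
  "parallel f1 f2 g1 g2 \<longleftrightarrow>
     f1 \<in> faces Y \<and> f2 \<in> faces Y \<and> g1 \<in> faces Y \<and> g2 \<in> faces Y \<and> f1 \<noteq> f2 \<and> g1 \<noteq> g2 \<and>
     ty f1 = ty g1 \<and> ty f2 = ty g2 \<and>
     (\<exists>e\<in>edges Y. \<exists>e'\<in>edges Y. e \<subseteq> closure f1 \<and> e \<subseteq> closure f2 \<and> e' \<subseteq> closure g1 \<and> e' \<subseteq> closure g2 \<and>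
        \<tau> f1 ` e = \<tau> g1 ` e' \<and> \<tau> f2 ` e = \<tau> g2 ` e' \<and>
        (\<forall>v\<in>verts Y \<inter> closure e. \<exists>v'\<in>verts Y \<inter> closure e'. \<tau> f1 v = \<tau> g1 v' \<and> \<tau> f2 v = \<tau> g2 v'))"

lemma sub_face_closure:
  assumes f: "f \<in> faces Y" and a: "a \<in> faces (img S (ty f))" and c: "c \<subseteq> closed_cell (img S (ty f)) a"
  shows "\<iota> f ` c \<subseteq> closure (\<iota> f ` a)"
  using c sub_closure [OF f cw2_cell_subset [OF img_cw2 face_cell [OF img_cw2 a]]] by blast

lemma verts_closure_sub_edge:
  assumes f: "f \<in> faces Y" and c: "c \<in> edges (img S (ty f))"
    and v: "v \<in> verts Y" "v \<in> closure (\<iota> f ` c)"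
  obtains w where "w \<in> verts (img S (ty f))" "w \<in> closed_cell (img S (ty f)) c" "v = \<iota> f w"
proof -
  let ?K = "img S (ty f)"
  have cK: "c \<subseteq> topspace (ctop ?K)" by (rule cw2_cell_subset [OF img_cw2 edge_cell [OF img_cw2 c]])
  obtain w where w: "w \<in> closed_cell ?K c" "v = \<iota> f w" using v(2) unfolding sub_closure [OF f cK] by blast
  have "w \<notin> c"
  proof
    assume "w \<in> c"
    obtain k where k: "f \<in> faces (P k)" using face_in_P [OF f] .
    have ec: "\<iota> f ` c \<in> edges (P (Suc k))" using glued_edges [OF glue [of k]] k c by auto
    have "v \<in> \<iota> f ` c" using \<open>w \<in> c\<close> w by blast
    moreover have "v \<in> verts (P (Suc k))" using v(1) ec \<open>v \<in> \<iota> f ` c\<close> by (auto simp: verts_P edges_P)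
    ultimately show False using vert_notin_edge [OF P_cw2 _ ec] by blast
  qed
  then have "w \<in> verts ?K" using closed_cell_edge_subset [OF img_cw2 c] w(1) by blast
  then show thesis using that w by blast
qed

text \<open>The common part of the two ways in which parallel pairs arise: inside one \<sigma>(T),
  and across a subdivided edge. h and h' may differ inside c; only their effect on cells is
  used.\<close>

lemma parallel_sub:
  assumes f: "f1 \<in> faces Y" "f2 \<in> faces Y" "g1 \<in> faces Y" "g2 \<in> faces Y"
    and ty: "ty g1 = ty f1" "ty g2 = ty f2"
    and a: "a \<in> faces (img S (ty f1))" and b: "b \<in> faces (img S (ty f2))"
    and ne: "\<iota> f1 ` a \<noteq> \<iota> f2 ` b" "\<iota> g1 ` a \<noteq> \<iota> g2 ` b"
    and c: "c \<in> edges (img S (ty f1))" "c \<subseteq> closed_cell (img S (ty f1)) a"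
    and d: "d \<in> edges (img S (ty f2))" "d \<subseteq> closed_cell (img S (ty f2)) b"
    and h: "h ` c = d" "h' ` c = d"
    and hf: "\<And>y. y \<in> closed_cell (img S (ty f1)) c \<Longrightarrow> \<iota> f1 y = \<iota> f2 (h y)"
    and hg: "\<And>y. y \<in> closed_cell (img S (ty f1)) c \<Longrightarrow> \<iota> g1 y = \<iota> g2 (h' y)"
    and hv: "\<And>w. w \<in> verts (img S (ty f1)) \<Longrightarrow> w \<in> closed_cell (img S (ty f1)) c \<Longrightarrow>
      h w = h' w \<and> h w \<in> verts (img S (ty f2)) \<and> h w \<in> closed_cell (img S (ty f2)) d"
  shows "parallel (\<iota> f1 ` a) (\<iota> f2 ` b) (\<iota> g1 ` a) (\<iota> g2 ` b)"
proof -
  let ?K = "img S (ty f1)" and ?L = "img S (ty f2)"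
  have a': "a \<in> faces (img S (ty g1))" and b': "b \<in> faces (img S (ty g2))" using a b ty by simp_all
  have cK: "c \<subseteq> topspace (ctop ?K)" by (rule cw2_cell_subset [OF img_cw2 edge_cell [OF img_cw2 c(1)]])
  have dL: "d \<subseteq> topspace (ctop ?L)" by (rule cw2_cell_subset [OF img_cw2 edge_cell [OF img_cw2 d(1)]])
  have ccl: "c \<subseteq> closed_cell ?K c" by (rule closure_of_subset [OF cK])
  have ef: "\<iota> f1 ` c = \<iota> f2 ` d"
  proof -
    have "\<iota> f1 ` c = \<iota> f2 ` h ` c" unfolding image_image using hf ccl by (intro image_cong) auto
    then show ?thesis using h by simp
  qed
  have eg: "\<iota> g1 ` c = \<iota> g2 ` d"
  proof -
    have "\<iota> g1 ` c = \<iota> g2 ` h' ` c" unfolding image_image using hg ccl by (intro image_cong) auto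
    then show ?thesis using h by simp
  qed
  have cc: "c \<in> cells ?K" "d \<in> cells ?L" using edge_cell [OF img_cw2] c(1) d(1) by blast+
  have t1: "\<tau> (\<iota> f1 ` a) ` \<iota> f1 ` C = \<tau> (\<iota> g1 ` a) ` \<iota> g1 ` C"
    if "C \<in> cells ?K" "C \<subseteq> closed_cell ?K a" for C
    using sub_face(3) [OF f(1) a that] sub_face(3) [OF f(3) a', of C] that ty by simp
  have t2: "\<tau> (\<iota> f2 ` b) ` \<iota> f2 ` C = \<tau> (\<iota> g2 ` b) ` \<iota> g2 ` C"
    if "C \<in> cells ?L" "C \<subseteq> closed_cell ?L b" for C
    using sub_face(3) [OF f(2) b that] sub_face(3) [OF f(4) b', of C] that ty by simp
  have clc: "closed_cell ?K c \<subseteq> closed_cell ?K a" by (rule closure_of_minimal [OF c(2)]) simp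
  have cld: "closed_cell ?L d \<subseteq> closed_cell ?L b" by (rule closure_of_minimal [OF d(2)]) simp
  have vv: "\<exists>v'\<in>verts Y \<inter> closure (\<iota> g1 ` c).
      \<tau> (\<iota> f1 ` a) v = \<tau> (\<iota> g1 ` a) v' \<and> \<tau> (\<iota> f2 ` b) v = \<tau> (\<iota> g2 ` b) v'"
    if v: "v \<in> verts Y \<inter> closure (\<iota> f1 ` c)" for v
  proof -
    obtain w where w: "w \<in> verts ?K" "w \<in> closed_cell ?K c" "v = \<iota> f1 w"
      using verts_closure_sub_edge [OF f(1) c(1)] v by blast
    note hw = hv [OF w(1,2)]
    have v2: "v = \<iota> f2 (h w)" using hf [OF w(2)] w(3) by simp
    have g2: "\<iota> g1 w = \<iota> g2 (h w)" using hg [OF w(2)] hw by simp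
    have "\<iota> g1 w \<in> verts Y" using sub_vert [OF f(3), of w] w(1) ty by simp
    moreover have "\<iota> g1 w \<in> closure (\<iota> g1 ` c)" using sub_closure [OF f(3), of c] cK w(2) ty by auto
    moreover have "{\<tau> (\<iota> f1 ` a) v} = {\<tau> (\<iota> g1 ` a) (\<iota> g1 w)}"
      using t1 [of "{w}"] vert_cell [OF img_cw2 w(1)] w(2,3) clc by auto
    moreover have "{\<tau> (\<iota> f2 ` b) v} = {\<tau> (\<iota> g2 ` b) (\<iota> g1 w)}"
      using t2 [of "{h w}"] vert_cell [OF img_cw2, of "h w"] hw v2 g2 cld by auto
    ultimately show ?thesis by blast
  qed
  show ?thesis
    unfolding parallel_def
  proof (intro conjI)
    show "\<iota> f1 ` a \<in> faces Y" "\<iota> f2 ` b \<in> faces Y" "\<iota> g1 ` a \<in> faces Y" "\<iota> g2 ` b \<in> faces Y"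
      using sub_face(1) f a b a' b' by blast+
    show "\<iota> f1 ` a \<noteq> \<iota> f2 ` b" "\<iota> g1 ` a \<noteq> \<iota> g2 ` b" by (rule ne)+
    show "ty (\<iota> f1 ` a) = ty (\<iota> g1 ` a)" using sub_face(2) [OF f(1) a] sub_face(2) [OF f(3) a'] ty by simp
    show "ty (\<iota> f2 ` b) = ty (\<iota> g2 ` b)" using sub_face(2) [OF f(2) b] sub_face(2) [OF f(4) b'] ty by simp
    show "\<exists>e\<in>edges Y. \<exists>e'\<in>edges Y. e \<subseteq> closure (\<iota> f1 ` a) \<and> e \<subseteq> closure (\<iota> f2 ` b) \<and>
        e' \<subseteq> closure (\<iota> g1 ` a) \<and> e' \<subseteq> closure (\<iota> g2 ` b) \<and>
        \<tau> (\<iota> f1 ` a) ` e = \<tau> (\<iota> g1 ` a) ` e' \<and> \<tau> (\<iota> f2 ` b) ` e = \<tau> (\<iota> g2 ` b) ` e' \<and>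
        (\<forall>v\<in>verts Y \<inter> closure e. \<exists>v'\<in>verts Y \<inter> closure e'.
          \<tau> (\<iota> f1 ` a) v = \<tau> (\<iota> g1 ` a) v' \<and> \<tau> (\<iota> f2 ` b) v = \<tau> (\<iota> g2 ` b) v')"
    proof (rule bexI [of _ "\<iota> f1 ` c"], rule bexI [of _ "\<iota> g1 ` c"], intro conjI)
      show "\<iota> f1 ` c \<subseteq> closure (\<iota> f1 ` a)" by (rule sub_face_closure [OF f(1) a c(2)])
      show "\<iota> f1 ` c \<subseteq> closure (\<iota> f2 ` b)" unfolding ef by (rule sub_face_closure [OF f(2) b d(2)])
      show "\<iota> g1 ` c \<subseteq> closure (\<iota> g1 ` a)" using sub_face_closure [OF f(3) a'] c(2) ty by simp
      show "\<iota> g1 ` c \<subseteq> closure (\<iota> g2 ` b)" unfolding eg using sub_face_closure [OF f(4) b'] d(2) ty by simp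
      show "\<tau> (\<iota> f1 ` a) ` \<iota> f1 ` c = \<tau> (\<iota> g1 ` a) ` \<iota> g1 ` c" by (rule t1 [OF cc(1) c(2)])
      show "\<tau> (\<iota> f2 ` b) ` \<iota> f1 ` c = \<tau> (\<iota> g2 ` b) ` \<iota> g1 ` c" unfolding ef eg by (rule t2 [OF cc(2) d(2)])
      show "\<forall>v\<in>verts Y \<inter> closure (\<iota> f1 ` c). \<exists>v'\<in>verts Y \<inter> closure (\<iota> g1 ` c).
        \<tau> (\<iota> f1 ` a) v = \<tau> (\<iota> g1 ` a) v' \<and> \<tau> (\<iota> f2 ` b) v = \<tau> (\<iota> g2 ` b) v'" using vv by blast
      show "\<iota> f1 ` c \<in> edges Y" by (rule sub_edge [OF f(1) c(1)])
      show "\<iota> g1 ` c \<in> edges Y" using sub_edge [OF f(3), of c] c(1) ty by simp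
    qed
  qed
qed

lemma sub_faces_distinct:
  assumes f: "f \<in> faces Y" "f' \<in> faces Y" and a: "a \<in> faces (img S (ty f))" and b: "b \<in> faces (img S (ty f'))"
    and eq: "\<iota> f ` a = \<iota> f' ` b"
  shows "f = f' \<and> a = b"
proof -
  obtain y where y: "y \<in> a" using cell_nonempty [OF img_cw2 face_cell [OF img_cw2 a]] by blast
  then obtain y' where y': "y' \<in> b" "\<iota> f y = \<iota> f' y'" using eq by blast
  have "y' \<in> topspace (ctop (img S (ty f')))"
    using cw2_cell_subset [OF img_cw2 face_cell [OF img_cw2 b]] y'(1) by blast
  then have "f = f' \<and> y = y'" using sub_face_inj [OF f a y _ y'(2)] by blast
  then show ?thesis using faces_disjoint [OF img_cw2 a, of b y] b y y'(1) by simp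
qed

text \<open>Inside one patch \<sigma>(T) the common edge is literally the same for both faces, so
  the identity serves as both gluing maps.\<close>

lemma parallel_siblings:
  assumes f: "f \<in> faces Y" "g \<in> faces Y" and ty: "ty f = ty g"
    and ab: "(a, b) \<in> face_adj (img S (ty f))"
  shows "parallel (\<iota> f ` a) (\<iota> f ` b) (\<iota> g ` a) (\<iota> g ` b)"
proof -
  let ?K = "img S (ty f)"
  obtain c where a: "a \<in> faces ?K" and b: "b \<in> faces ?K" and ne: "a \<noteq> b"
    and c: "c \<in> edges ?K" "c \<subseteq> closed_cell ?K a" "c \<subseteq> closed_cell ?K b"
    using ab unfolding face_adj_def [OF img_patch tile_cw2] by blast
  have "\<iota> f ` a \<noteq> \<iota> f ` b" using sub_faces_distinct [OF f(1,1) a b] ne by blast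
  moreover have "\<iota> g ` a \<noteq> \<iota> g ` b" using sub_faces_distinct [OF f(2,2), of a b] a b ty ne by auto
  ultimately show ?thesis
    using parallel_sub [OF f(1,1) f(2,2) ty [symmetric] ty [symmetric] a b _ _ c(1,2) c(1,3), of id id] by simp
qed

text \<open>The gluings at the two places join the same edge paths and agree at the ends, since the
  end points of the common edges correspond. By \<open>arc_cell_iso_unique\<close> they agree on
  cells, so any edge of the path has matching faces on its sides.\<close>

lemma parallel_descend:
  assumes par: "parallel f1 f2 g1 g2"
  obtains a b where "a \<in> faces (img S (ty f1))" "b \<in> faces (img S (ty f2))"
    "parallel (\<iota> f1 ` a) (\<iota> f2 ` b) (\<iota> g1 ` a) (\<iota> g2 ` b)"
proof -
  from par obtain e e' where f: "f1 \<in> faces Y" "f2 \<in> faces Y" "g1 \<in> faces Y" "g2 \<in> faces Y" "f1 \<noteq> f2" "g1 \<noteq> g2"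
    and ty: "ty g1 = ty f1" "ty g2 = ty f2" and e: "e \<in> edges Y" "e \<subseteq> closure f1" "e \<subseteq> closure f2"
    and e': "e' \<in> edges Y" "e' \<subseteq> closure g1" "e' \<subseteq> closure g2"
    and te: "\<tau> g1 ` e' = \<tau> f1 ` e" "\<tau> g2 ` e' = \<tau> f2 ` e"
    and tv: "\<And>v. v \<in> verts Y \<inter> closure e \<Longrightarrow> \<exists>v'\<in>verts Y \<inter> closure e'. \<tau> f1 v = \<tau> g1 v' \<and> \<tau> f2 v = \<tau> g2 v'"
    unfolding parallel_def by (metis (no_types, lifting))
  let ?K = "img S (ty f1)" and ?L = "img S (ty f2)"
  define B where "B = edge_path (ty f1) (\<tau> f1 ` e)"
  define C where "C = edge_path (ty f2) (\<tau> f2 ` e)"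
  obtain h where h: "cell_iso h (restrict_complex ?K B) (restrict_complex ?L C)"
    and h_v: "\<And>v. v \<in> verts Y \<Longrightarrow> v \<in> closure e \<Longrightarrow> h (smap S (ty f1) (\<tau> f1 v)) = smap S (ty f2) (\<tau> f2 v)"
    and h_\<iota>: "\<And>y. y \<in> B \<Longrightarrow> \<iota> f1 y = \<iota> f2 (h y)"
    using sub_gluing [OF f(1,2,5) e] unfolding B_def C_def by metis
  obtain h' where h': "cell_iso h' (restrict_complex ?K B) (restrict_complex ?L C)"
    and h'_v: "\<And>v. v \<in> verts Y \<Longrightarrow> v \<in> closure e' \<Longrightarrow> h' (smap S (ty f1) (\<tau> g1 v)) = smap S (ty f2) (\<tau> g2 v)"
    and h'_\<iota>: "\<And>y. y \<in> B \<Longrightarrow> \<iota> g1 y = \<iota> g2 (h' y)"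
    using sub_gluing [OF f(3,4,6) e'] unfolding B_def C_def ty te by metis
  have d: "\<tau> f1 ` e \<in> edges (tile S (ty f1))" by (rule face_edge_image [OF f(1) e(1,2)])
  obtain \<gamma> :: "real \<Rightarrow> 'a" where
    \<gamma>: "homeomorphic_map (top_of_set {0..1}) (subtopology (ctop ?K) B) (smap S (ty f1) \<circ> \<gamma>)"
    "\<gamma> ` {0..1} = closed_cell (tile S (ty f1)) (\<tau> f1 ` e)" "\<gamma> 0 \<in> verts (tile S (ty f1))" "\<gamma> 1 \<in> verts (tile S (ty f1))"
    unfolding B_def by (rule edge_path_arc [OF d])
  have BC: "B \<subseteq> boundary_circle ?K" unfolding B_def by (rule edge_path_boundary [OF d])
  have ends: "(smap S (ty f1) \<circ> \<gamma>) 0 \<in> verts ?K" "(smap S (ty f1) \<circ> \<gamma>) 1 \<in> verts ?K"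
    using smap_verts \<gamma>(3,4) by auto
  \<comment> \<open>A polygon vertex on the edge lifts to a vertex of Y in the closed face and to a
    point of the closed edge. Injectivity of the face map identifies the two, so the matching of end
    points applies.\<close>
  have match: "h (smap S (ty f1) w) = h' (smap S (ty f1) w)"
    if w: "w \<in> verts (tile S (ty f1))" "w \<in> closed_cell (tile S (ty f1)) (\<tau> f1 ` e)" for w
  proof -
    obtain v where v: "v \<in> verts Y" "v \<in> closure f1" "\<tau> f1 v = w" using face_vert_preimage [OF f(1) w(1)] .
    obtain v1 where v1: "v1 \<in> closure e" "\<tau> f1 v1 = w"
      using w(2) unfolding face_closed_edge [OF f(1) e(2), symmetric] by blast
    have "v1 \<in> closure f1" using v1(1) closure_minimal [OF e(2) closed_closure] by blast
    then have "v = v1" using inj_onD [OF face_inj [OF f(1)]] v v1(2) by metis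
    then have ve: "v \<in> closure e" using v1(1) by simp
    then obtain v' where v': "v' \<in> verts Y" "v' \<in> closure e'" "\<tau> f1 v = \<tau> g1 v'" "\<tau> f2 v = \<tau> g2 v'"
      using tv [of v] v(1) by blast
    show ?thesis using h_v [OF v(1) ve] h'_v [OF v'(1,2)] v' v(3) by simp
  qed
  have "\<gamma> 0 \<in> closed_cell (tile S (ty f1)) (\<tau> f1 ` e)" "\<gamma> 1 \<in> closed_cell (tile S (ty f1)) (\<tau> f1 ` e)"
    unfolding \<gamma>(2) [symmetric] by auto
  then have m0: "h ((smap S (ty f1) \<circ> \<gamma>) 0) = h' ((smap S (ty f1) \<circ> \<gamma>) 0)"
    and m1: "h ((smap S (ty f1) \<circ> \<gamma>) 1) = h' ((smap S (ty f1) \<circ> \<gamma>) 1)"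
    using match \<gamma>(3,4) by simp_all
  note arc = img_cw2 img_disc \<gamma>(1) BC ends
  note unique = arc_cell_iso_unique [OF arc img_cw2 h h' m0 m1]
  \<comment> \<open>An arc has a point besides the finitely many vertices, and the edge through it
    lies in B.\<close>
  have "infinite B"
  proof
    assume "finite B"
    then have "finite ((smap S (ty f1) \<circ> \<gamma>) ` {0..1})" using arc_image [OF arc] by simp
    then have "finite {0..1::real}" using arc_inj [OF arc] finite_imageD by blast
    then show False using infinite_Icc [of "0::real" 1] by simp
  qed
  then obtain y where y: "y \<in> B" "y \<notin> verts ?K"
    using disc_finite(1) [OF img_cw2 img_disc] by (meson finite_subset subsetI)
  obtain c where c: "c \<in> edges ?K" "y \<in> c" using arc_cases [OF arc y(1)] y(2) by metis
  have cB: "c \<subseteq> B" by (rule arc_edge_subset [OF arc c y(1)])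
  obtain a where a: "a \<in> faces ?K" "c \<subseteq> closed_cell ?K a" using patch_edge_face [OF img_patch tile_cw2 c(1)] .
  have hhom: "homeomorphic_map (subtopology (ctop ?K) B) (subtopology (ctop ?L) C) h"
    "h ` (verts ?K \<inter> B) = verts ?L \<inter> C" "(`) h ` {e \<in> edges ?K. e \<subseteq> B} = {e \<in> edges ?L. e \<subseteq> C}"
    using h unfolding cell_iso_def by simp_all
  have hc: "h ` c \<in> edges ?L" using hhom(3) c(1) cB by blast
  obtain b where b: "b \<in> faces ?L" "h ` c \<subseteq> closed_cell ?L b" using patch_edge_face [OF img_patch tile_cw2 hc] .
  have Bt: "B \<subseteq> topspace (ctop ?K)" by (rule arc_subset [OF arc])
  have "compactin (ctop ?K) B"
    using image_compactin [OF _ continuous_map_into_fulltopology [OF homeomorphic_mapD(1) [OF \<gamma>(1)]], of "{0..1}"]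
      arc_image [OF arc] by (simp add: compactin_subtopology)
  then have "closedin (ctop ?K) B" using cw2_Hausdorff [OF img_cw2] compactin_imp_closedin by blast
  then have clB: "closed_cell ?K c \<subseteq> B" by (rule closure_of_minimal [OF cB])
  have hcl: "h w \<in> closed_cell ?L (h ` c)" if w: "w \<in> closed_cell ?K c" for w
  proof -
    have "h ` (subtopology (ctop ?K) B closure_of c) \<subseteq> ctop ?L closure_of h ` c"
      by (rule continuous_map_image_closure_subset [OF continuous_map_into_fulltopology [OF homeomorphic_mapD(1) [OF hhom(1)]]])
    moreover have "w \<in> subtopology (ctop ?K) B closure_of c"
      using w clB cB by (auto simp: closure_of_subtopology Int_absorb1)
    ultimately show ?thesis by blast
  qed
  have "parallel (\<iota> f1 ` a) (\<iota> f2 ` b) (\<iota> g1 ` a) (\<iota> g2 ` b)"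
  proof (rule parallel_sub [OF f(1-4) ty a(1) b(1) _ _ c(1) a(2) hc b(2) refl])
    show "\<iota> f1 ` a \<noteq> \<iota> f2 ` b" using sub_faces_distinct [OF f(1,2) a(1) b(1)] f(5) by blast
    show "\<iota> g1 ` a \<noteq> \<iota> g2 ` b" using sub_faces_distinct [OF f(3,4), of a b] a(1) b(1) ty f(6) by auto
    show "h' ` c = h ` c" using unique(2) [OF c(1) cB] by simp
    show "\<iota> f1 y = \<iota> f2 (h y)" if "y \<in> closed_cell ?K c" for y using h_\<iota> clB that by blast
    show "\<iota> g1 y = \<iota> g2 (h' y)" if "y \<in> closed_cell ?K c" for y using h'_\<iota> clB that by blast
    show "h w = h' w \<and> h w \<in> verts ?L \<and> h w \<in> closed_cell ?L (h ` c)"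
      if "w \<in> verts ?K" "w \<in> closed_cell ?K c" for w
      using unique(1) [of w] hhom(2) hcl that clB by blast
  qed
  then show thesis using that a(1) b(1) by blast
qed

subsection \<open>Isometries between faces of the same type\<close>

text \<open>Cells are matched as sets because the face maps are only controlled cell by cell; for
  vertices this is a pointwise condition.\<close>

definition carries :: "(complex \<Rightarrow> complex) \<Rightarrow> complex set \<Rightarrow> complex set \<Rightarrow> bool" where
  "carries H f g \<longleftrightarrow> H \<in> \<Gamma> \<and> H ` f = g \<and> H ` closure f = closure g \<and>
     (\<forall>c\<in>cells Y. \<forall>c'\<in>cells Y. c \<subseteq> closure f \<and> c' \<subseteq> closure g \<and> \<tau> f ` c = \<tau> g ` c' \<longrightarrow> H ` c = c')"

lemma tile_closure:
  assumes "u \<in> \<T>" shows "closure (interior (fst u)) = fst u"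
  using tiling_is_tile [OF tiling assms] by (simp add: is_tile_def)

text \<open>Both tiles are placed copies of the same representative \<open>R i\<close>, by k and k'
  in \<Gamma>; H is k' after the inverse of k.\<close>

lemma carries_exists:
  assumes f: "f \<in> faces Y" and g: "g \<in> faces Y" and ty: "ty f = ty g"
  shows "\<exists>H. carries H f g"
proof -
  obtain u where u: "u \<in> \<T>" "f = interior (fst u)" using f by (auto simp: Y_simps)
  obtain u' where u': "u' \<in> \<T>" "g = interior (fst u')" using g by (auto simp: Y_simps)
  have cl: "closure f = fst u" "closure g = fst u'" using tile_closure u u' by simp_all
  let ?i = "ty f"
  obtain k where k: "k \<in> \<Gamma>" "fst u = k ` fst (R ?i)" "\<forall>c\<in>cells (tile S ?i). \<tau> f ` k ` \<rho> ?i ` c = c"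
    using placed [OF u(1)] u(2) by blast
  obtain k' where k': "k' \<in> \<Gamma>" "fst u' = k' ` fst (R ?i)" "\<forall>c\<in>cells (tile S ?i). \<tau> g ` k' ` \<rho> ?i ` c = c"
    using placed [OF u'(1)] u'(2) ty by auto
  obtain l where l: "l \<in> \<Gamma>" "\<And>z. z \<in> plane G \<Longrightarrow> l (k z) = z" "\<And>z. z \<in> plane G \<Longrightarrow> k (l z) = z"
    using subgroup_inv [OF \<Gamma> k(1)] by metis
  obtain H where H: "H \<in> \<Gamma>" "\<And>z. z \<in> plane G \<Longrightarrow> H z = k' (l z)"
    using subgroup_mult [OF \<Gamma> k'(1) l(1)] by metis
  note iso = subgroup_isometry [OF \<Gamma>]
  have fu: "fst u \<subseteq> plane G" using tiling_is_tile [OF tiling u(1)] by (simp add: is_tile_def)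
  have RG: "fst (R ?i) \<subseteq> plane G"
  proof -
    have "\<P> \<subseteq> labelled_tiles G // tile_equiv G \<Gamma>" using tiling by (simp add: is_tiling_def prototiles_def)
    then have "proto ?i \<in> labelled_tiles G // tile_equiv G \<Gamma>" using proto_\<P> by blast
    then obtain w where "proto ?i = tile_equiv G \<Gamma> `` {w}" by (rule quotientE)
    then have "R ?i \<in> labelled_tiles G" using proto_R [of ?i] by (auto simp: tile_equiv_def)
    then show ?thesis by (auto simp: labelled_tiles_def is_tile_def)
  qed
  have Hk: "H ` k ` B = k' ` B" if "B \<subseteq> fst (R ?i)" for B
  proof -
    have "H (k x) = k' x" if "x \<in> B" for x
    proof -
      have "x \<in> plane G" using that \<open>B \<subseteq> fst (R ?i)\<close> RG by blast
      then show ?thesis using H(2) [of "k x"] l(2) isometry_in [OF iso [OF k(1)]] by simp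
    qed
    then show ?thesis by (simp add: image_image)
  qed
  have Hcl: "H ` closure f = closure g" unfolding cl k(2) k'(2) by (rule Hk) simp
  have "H ` f = interior (H ` fst u)" unfolding u(2) using isometry_interior_image [OF iso [OF H(1)] fu] by simp
  also have "\<dots> = g" using Hcl cl u'(2) by simp
  finally have Hf: "H ` f = g" .
  \<comment> \<open>The face map is injective on the closed tile, so a cell is recovered from its
    image d as the placed copy of d.\<close>
  have pull: "C = m ` \<rho> ?i ` d"
    if F: "F \<in> faces Y" "ty F = ?i" "closure F = m ` fst (R ?i)" "\<forall>c\<in>cells (tile S ?i). \<tau> F ` m ` \<rho> ?i ` c = c"
      and C: "C \<subseteq> closure F" "\<tau> F ` C = d" "d \<in> cells (tile S ?i)" for F m C d
  proof -
    have "\<rho> ?i ` d \<subseteq> fst (R ?i)"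
      using homeomorphic_mapD(2) [OF \<rho> [of ?i]] cw2_cell_subset [OF tile_cw2 C(3)] by auto
    then have sub: "m ` \<rho> ?i ` d \<subseteq> closure F" unfolding F(3) by (rule image_mono)
    have "\<tau> F ` C = \<tau> F ` m ` \<rho> ?i ` d" using bspec [OF F(4) C(3)] C(2) by simp
    then show ?thesis using inj_on_image_eq_iff [OF face_inj [OF F(1)] C(1) sub] by simp
  qed
  have "H ` c = c'" if c: "c \<in> cells Y" "c' \<in> cells Y" "c \<subseteq> closure f" "c' \<subseteq> closure g" "\<tau> f ` c = \<tau> g ` c'" for c c'
  proof -
    let ?d = "\<tau> f ` c"
    have d: "?d \<in> cells (tile S ?i)" by (rule face_cell_image [OF f c(1,3)])
    have 1: "c = k ` \<rho> ?i ` ?d"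
      by (rule pull [OF f refl _ k(3) c(3) refl d]) (simp add: cl k(2))
    have 2: "c' = k' ` \<rho> ?i ` ?d"
      by (rule pull [OF g ty [symmetric] _ k'(3) c(4) c(5) [symmetric] d]) (simp add: cl k'(2))
    have "\<rho> ?i ` ?d \<subseteq> fst (R ?i)"
      using homeomorphic_mapD(2) [OF \<rho> [of ?i]] cw2_cell_subset [OF tile_cw2 d] by auto
    then show ?thesis using 1 2 Hk by metis
  qed
  then have "carries H f g" using H(1) Hf Hcl unfolding carries_def by blast
  then show ?thesis by blast
qed

text \<open>An arbitrary choice; \<open>parallel_rigid\<close> shows that the choices for parallel
  pairs coincide.\<close>

definition hmap :: "complex set \<Rightarrow> complex set \<Rightarrow> complex \<Rightarrow> complex" where
  "hmap f g = (SOME H. carries H f g)"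

lemma hmap: "f \<in> faces Y \<Longrightarrow> g \<in> faces Y \<Longrightarrow> ty f = ty g \<Longrightarrow> carries (hmap f g) f g"
  unfolding hmap_def by (rule someI_ex [OF carries_exists])

text \<open>A small closed ball around m lies in one \<open>A k\<close>, which has finitely many
  cells. Removing its vertices and the closed edges other than e leaves only faces and points of
  e.\<close>

lemma edge_neighbourhood:
  assumes f: "f \<in> faces Y" and e: "e \<in> edges Y" "e \<subseteq> closure f" and m: "m \<in> e"
  obtains N where "open N" "m \<in> N" "N \<subseteq> plane G" "N - closure e \<subseteq> \<Union>(faces Y)"
proof -
  have mG: "m \<in> plane G"
  proof -
    obtain k where "f \<in> faces (P k)" using face_in_P [OF f] .
    then show ?thesis using m e(2) closure_face_subset A_subset by blast
  qed
  then obtain \<delta> where \<delta>: "\<delta> > 0" "cball m \<delta> \<subseteq> plane G"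
    using open_plane open_contains_cball by metis
  obtain k where k: "cball m \<delta> \<subseteq> A k" using compact_subset_A [OF compact_cball \<delta>(2)] .
  define Q where "Q = verts (P k) \<union> (\<Union>c\<in>edges (P k) - {e}. closure c)"
  have fin: "finite (verts (P k))" "finite (edges (P k))" using disc_finite [OF P_cw2 P_disc] by auto
  have Q: "closed Q" unfolding Q_def using fin by (intro closed_Un closed_UN finite_imp_closed) auto
  obtain l where l: "f \<in> faces (P l)" using face_in_P [OF f] .
  \<comment> \<open>A level containing both e and all cells of \<open>P k\<close>, so that
    disjointness of cells can be applied to them together.\<close>
  define n where "n = max k l"
  have en: "e \<in> edges (P n)"
    using edge_in_P [OF l e] A_mono [of l n] unfolding edges_P n_def by auto
  have sub: "verts (P k) \<subseteq> verts (P n)" "edges (P k) \<subseteq> edges (P n)"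
    using A_mono [of k n] unfolding edges_P verts_P n_def by auto
  have mQ: "m \<notin> Q"
  proof
    assume "m \<in> Q"
    then consider "m \<in> verts (P n)" | c where "c \<in> edges (P n)" "c \<noteq> e" "m \<in> closure c"
      unfolding Q_def using sub by blast
    then show False
    proof cases
      case 1 then show False using vert_notin_edge [OF P_cw2 _ en] m by blast
    next
      case 2
      then have "closure c = closed_cell (P n) c" using closed_cell_P [of c n] by (simp add: edges_P)
      then have "m \<in> c \<union> verts (P n)" using closed_cell_edge_subset [OF P_cw2 2(1)] 2(3) by blast
      then show False
        using vert_notin_edge [OF P_cw2 _ en] m edges_disjoint [OF P_cw2 2(1) en] 2(2) by blast
    qed
  qed
  show thesis
  proof (rule that [of "ball m \<delta> - Q"])
    show "open (ball m \<delta> - Q)" using Q by (intro open_Diff open_ball)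
    show "m \<in> ball m \<delta> - Q" using \<delta>(1) mQ by simp
    show "ball m \<delta> - Q \<subseteq> plane G" using \<delta>(2) ball_subset_cball by blast
    show "ball m \<delta> - Q - closure e \<subseteq> \<Union>(faces Y)"
    proof
      fix z assume z: "z \<in> ball m \<delta> - Q - closure e"
      have "z \<in> A k" using z k ball_subset_cball by blast
      then have "z \<in> \<Union>(cells (P k))" using cw2_Union_cells [OF P_cw2 [of k]] by simp
      then obtain c where c: "c \<in> cells (P k)" "z \<in> c" by blast
      have "c \<notin> (\<lambda>v. {v}) ` verts (P k)" using z c(2) unfolding Q_def by blast
      moreover have "c \<notin> edges (P k)" using z c(2) closure_subset [of c] unfolding Q_def by blast
      ultimately have "c \<in> faces (P k)" using c(1) unfolding cells_def by blast
      then show "z \<in> \<Union>(faces Y)" using c(2) faces_P by blast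
    qed
  qed
qed

lemma vert_cell_Y: "v \<in> verts Y \<Longrightarrow> {v} \<in> cells Y"
  and edge_cell_Y: "e \<in> edges Y \<Longrightarrow> e \<in> cells Y"
  by (simp_all add: cells_def)

text \<open>The composite J of the first element with the inverse of the second preserves the common
  edge and fixes its ends. If J were nontrivial it would send a point of f1 into f2, and the first
  element would send this point into both g1 and g2.\<close>

lemma parallel_rigid:
  assumes par: "parallel f1 f2 g1 g2" and z: "z \<in> plane G"
  shows "hmap f1 g1 z = hmap f2 g2 z"
proof (rule ccontr)
  assume neq: "hmap f1 g1 z \<noteq> hmap f2 g2 z"
  from par obtain e e' where f: "f1 \<in> faces Y" "f2 \<in> faces Y" "g1 \<in> faces Y" "g2 \<in> faces Y" "f1 \<noteq> f2" "g1 \<noteq> g2"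
    and ty: "ty f1 = ty g1" "ty f2 = ty g2" and e: "e \<in> edges Y" "e \<subseteq> closure f1" "e \<subseteq> closure f2"
    and e': "e' \<in> edges Y" "e' \<subseteq> closure g1" "e' \<subseteq> closure g2"
    and te: "\<tau> f1 ` e = \<tau> g1 ` e'" "\<tau> f2 ` e = \<tau> g2 ` e'"
    and tv: "\<And>v. v \<in> verts Y \<inter> closure e \<Longrightarrow> \<exists>v'\<in>verts Y \<inter> closure e'. \<tau> f1 v = \<tau> g1 v' \<and> \<tau> f2 v = \<tau> g2 v'"
    unfolding parallel_def by (metis (no_types, lifting))
  let ?H1 = "hmap f1 g1" and ?H2 = "hmap f2 g2"
  have H1: "?H1 \<in> \<Gamma>" "?H1 ` f1 = g1"
    "\<And>c c'. c \<in> cells Y \<Longrightarrow> c' \<in> cells Y \<Longrightarrow> c \<subseteq> closure f1 \<Longrightarrow> c' \<subseteq> closure g1 \<Longrightarrow> \<tau> f1 ` c = \<tau> g1 ` c' \<Longrightarrow> ?H1 ` c = c'"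
    using hmap [OF f(1,3) ty(1)] unfolding carries_def by blast+
  have H2: "?H2 \<in> \<Gamma>" "?H2 ` f2 = g2"
    "\<And>c c'. c \<in> cells Y \<Longrightarrow> c' \<in> cells Y \<Longrightarrow> c \<subseteq> closure f2 \<Longrightarrow> c' \<subseteq> closure g2 \<Longrightarrow> \<tau> f2 ` c = \<tau> g2 ` c' \<Longrightarrow> ?H2 ` c = c'"
    using hmap [OF f(2,4) ty(2)] unfolding carries_def by blast+
  obtain K where K: "K \<in> \<Gamma>" "\<And>z. z \<in> plane G \<Longrightarrow> K (?H2 z) = z" "\<And>z. z \<in> plane G \<Longrightarrow> ?H2 (K z) = z"
    using subgroup_inv [OF \<Gamma> H2(1)] by metis
  obtain J where J: "J \<in> \<Gamma>" "\<And>z. z \<in> plane G \<Longrightarrow> J z = K (?H1 z)"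
    using subgroup_mult [OF \<Gamma> K(1) H1(1)] by metis
  note iso = subgroup_isometry [OF \<Gamma>]
  have H2J: "?H2 (J x) = ?H1 x" if "x \<in> plane G" for x
    using J(2) [OF that] K(3) isometry_in [OF iso [OF H1(1)] that] by simp
  have JI: "J x = y" if "x \<in> plane G" "y \<in> plane G" "?H1 x = ?H2 y" for x y
    using J(2) [OF that(1)] K(2) [OF that(2)] that(3) by simp
  have closG: "closure h \<subseteq> plane G" if h: "h \<in> faces Y" for h
  proof -
    obtain k where "h \<in> faces (P k)" using face_in_P [OF h] .
    then show ?thesis using closure_face_subset A_subset by blast
  qed
  obtain \<gamma> :: "real \<Rightarrow> complex" where \<gamma>: "continuous_on {0..1} \<gamma>" "inj_on \<gamma> {0..1}" "\<gamma> ` {0..1} = closure e"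
    "\<gamma> ` {0<..<1} = e" "\<gamma> 0 \<in> verts Y" "\<gamma> 1 \<in> verts Y"
    using edge_arc [OF f(1) e(1,2)] .
  have cle: "closure e \<subseteq> closure f1" "closure e \<subseteq> closure f2"
    by (rule closure_minimal [OF e(2) closed_closure], rule closure_minimal [OF e(3) closed_closure])
  have cle': "closure e' \<subseteq> closure g1" "closure e' \<subseteq> closure g2"
    by (rule closure_minimal [OF e'(2) closed_closure], rule closure_minimal [OF e'(3) closed_closure])
  have eG: "closure e \<subseteq> plane G" using cle(1) closG [OF f(1)] by blast
  \<comment> \<open>For singleton cells \<open>carries\<close> is pointwise: both elements send v to
    the same v'.\<close>
  have fix_v: "J v = v" if v: "v \<in> verts Y" "v \<in> closure e" for v
  proof -
    obtain v' where v': "v' \<in> verts Y" "v' \<in> closure e'" "\<tau> f1 v = \<tau> g1 v'" "\<tau> f2 v = \<tau> g2 v'"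
      using tv [of v] v by blast
    have "?H1 ` {v} = {v'}"
      by (rule H1(3)) (use v v' cle cle' vert_cell_Y in auto)
    moreover have "?H2 ` {v} = {v'}"
      by (rule H2(3)) (use v v' cle cle' vert_cell_Y in auto)
    ultimately have "?H1 v = ?H2 v" by simp
    then show ?thesis using JI [of v v] v(2) eG by blast
  qed
  have ends: "\<gamma> 0 \<in> closure e" "\<gamma> 1 \<in> closure e" unfolding \<gamma>(3) [symmetric] by auto
  have "?H1 ` e = e'" by (rule H1(3) [OF edge_cell_Y [OF e(1)] edge_cell_Y [OF e'(1)] e(2) e'(2) te(1)])
  moreover have "?H2 ` e = e'" by (rule H2(3) [OF edge_cell_Y [OF e(1)] edge_cell_Y [OF e'(1)] e(3) e'(3) te(2)])
  ultimately have He: "?H1 ` e = ?H2 ` e" by simp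
  have eG': "e \<subseteq> plane G" using eG closure_subset by blast
  have Je: "J ` e = e"
  proof
    show "J ` e \<subseteq> e"
    proof
      fix y assume "y \<in> J ` e"
      then obtain x where x: "x \<in> e" "y = J x" by blast
      then obtain w where w: "w \<in> e" "?H1 x = ?H2 w" using He by blast
      then have "J x = w" using JI [of x w] x w eG' by blast
      then show "y \<in> e" using x w by simp
    qed
    show "e \<subseteq> J ` e"
    proof
      fix w assume w: "w \<in> e"
      then obtain x where x: "x \<in> e" "?H1 x = ?H2 w" using He by (metis imageE imageI)
      then have "J x = w" using JI [of x w] w eG' by blast
      then show "w \<in> J ` e" using x(1) by blast
    qed
  qed
  have I01: "{0..1::real} = {0<..<1} \<union> {0, 1}" by auto
  have cl_e: "closure e = e \<union> {\<gamma> 0, \<gamma> 1}" unfolding \<gamma>(3) [symmetric] I01 image_Un \<gamma>(4) by simp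
  have f0: "J (\<gamma> 0) = \<gamma> 0" and f1: "J (\<gamma> 1) = \<gamma> 1" using fix_v \<gamma>(5,6) ends by blast+
  have Jcl: "J ` \<gamma> ` {0..1} = \<gamma> ` {0..1}" unfolding \<gamma>(3) cl_e image_Un Je using f0 f1 by simp
  have "\<gamma> (1/2) \<in> e" unfolding \<gamma>(4) [symmetric] by (intro imageI) simp
  then obtain m where m: "m \<in> e" by blast
  obtain N where N: "open N" "m \<in> N" "N \<subseteq> plane G" "N - closure e \<subseteq> \<Union>(faces Y)"
    using edge_neighbourhood [OF f(1) e(1,2) m] .
  have dis: "disjoint (faces Y)"
    using faces_disjoint_Y unfolding pairwise_def disjnt_def by blast
  have m\<gamma>: "m \<in> \<gamma> ` {0..1}" unfolding \<gamma>(3) cl_e using m by blast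
  have "J ` f1 \<inter> f2 \<noteq> {}"
  proof (rule isometry_fixing_arc [OF iso [OF J(1)] \<gamma>(1,2) _ f0 f1 Jcl m\<gamma> N(1-3) _ dis _ f(1,2,5) _ _ z])
    show "\<gamma> ` {0..1} \<subseteq> plane G" unfolding \<gamma>(3) by (rule eG)
    show "open F" if "F \<in> faces Y" for F using face_open that .
    show "N - \<gamma> ` {0..1} \<subseteq> \<Union>(faces Y)" unfolding \<gamma>(3) by (rule N(4))
    show "m \<in> closure f1" "m \<in> closure f2" using m e by blast+
    show "J z \<noteq> z" using H2J [OF z] neq by auto
  qed
  then obtain x where x: "x \<in> f1" "J x \<in> f2" by blast
  have "x \<in> plane G" using x(1) closG [OF f(1)] closure_subset by blast
  then have "?H1 x \<in> g2" using H2J x(2) H2(2) by (metis imageI)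
  moreover have "?H1 x \<in> g1" using H1(2) x(1) by blast
  ultimately show False using faces_disjoint_Y f by blast
qed

subsection \<open>Supertiles\<close>

text \<open>A relation on pairs, so that iterating it records which faces of two supertiles of the
  same type come from the same successive choices of a.\<close>

definition child :: "((complex set \<times> complex set) \<times> (complex set \<times> complex set)) set" where
  "child = {((f, g), (\<iota> f ` a, \<iota> g ` a)) | f g a.
     f \<in> faces Y \<and> g \<in> faces Y \<and> ty f = ty g \<and> a \<in> faces (img S (ty f))}"

definition descendants :: "nat \<Rightarrow> complex set \<Rightarrow> complex set \<Rightarrow> (complex set \<times> complex set) set" where
  "descendants n f g = (child ^^ n) `` {(f, g)}"

definition supertile :: "nat \<Rightarrow> complex set \<Rightarrow> complex set set" where
  "supertile n f = fst ` descendants n f f"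

lemma descendants_0 [simp]: "descendants 0 f g = {(f, g)}"
  by (auto simp: descendants_def)

text \<open>\<open>relpow\<close> appends the last generation; here the first one is split off,
  because the inductions proceed from the top face.\<close>

lemma descendants_Suc:
  assumes "f \<in> faces Y" "g \<in> faces Y" "ty f = ty g"
  shows "descendants (Suc n) f g = (\<Union>a\<in>faces (img S (ty f)). descendants n (\<iota> f ` a) (\<iota> g ` a))"
proof -
  have "child `` {(f, g)} = (\<lambda>a. (\<iota> f ` a, \<iota> g ` a)) ` faces (img S (ty f))"
  proof (intro subset_antisym subsetI)
    fix p assume "p \<in> child `` {(f, g)}"
    then show "p \<in> (\<lambda>a. (\<iota> f ` a, \<iota> g ` a)) ` faces (img S (ty f))" unfolding child_def by blast
  next
    fix p assume "p \<in> (\<lambda>a. (\<iota> f ` a, \<iota> g ` a)) ` faces (img S (ty f))"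
    then obtain a where "a \<in> faces (img S (ty f))" "p = (\<iota> f ` a, \<iota> g ` a)" by blast
    then have "((f, g), p) \<in> child" unfolding child_def using assms by blast
    then show "p \<in> child `` {(f, g)}" by blast
  qed
  moreover have "child ^^ Suc n = child O child ^^ n"
    by (metis relpow_commute relpow.simps(2))
  ultimately show ?thesis unfolding descendants_def by (auto simp: relcomp_Image)
qed

lemma descendants_faces:
  assumes "f \<in> faces Y" "g \<in> faces Y" "ty f = ty g" "(F, F') \<in> descendants n f g"
  shows "F \<in> faces Y \<and> F' \<in> faces Y \<and> ty F = ty F'"
  using assms
proof (induction n arbitrary: f g)
  case (Suc n)
  obtain a where a: "a \<in> faces (img S (ty f))" "(F, F') \<in> descendants n (\<iota> f ` a) (\<iota> g ` a)"
    using Suc.prems(4) unfolding descendants_Suc [OF Suc.prems(1-3)] by blast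
  have "a \<in> faces (img S (ty g))" using a(1) Suc.prems(3) by simp
  then show ?case
    using Suc.IH [OF _ _ _ a(2)] sub_face(1,2) [OF Suc.prems(1) a(1)] sub_face(1,2) [OF Suc.prems(2), of a] Suc.prems(3)
    by simp
qed simp

text \<open>However far two adjacent faces are subdivided, some small faces still meet along their
  common border, in corresponding ways at both places.\<close>

lemma parallel_descendants:
  assumes "parallel f1 f2 g1 g2"
  shows "\<exists>F1 G1 F2 G2. (F1, G1) \<in> descendants n f1 g1 \<and> (F2, G2) \<in> descendants n f2 g2 \<and> parallel F1 F2 G1 G2"
  using assms
proof (induction n arbitrary: f1 f2 g1 g2)
  case (Suc n)
  obtain a b where ab: "a \<in> faces (img S (ty f1))" "b \<in> faces (img S (ty f2))"
    "parallel (\<iota> f1 ` a) (\<iota> f2 ` b) (\<iota> g1 ` a) (\<iota> g2 ` b)"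
    by (rule parallel_descend [OF Suc.prems])
  have f: "f1 \<in> faces Y" "f2 \<in> faces Y" "g1 \<in> faces Y" "g2 \<in> faces Y" "ty f1 = ty g1" "ty f2 = ty g2"
    using Suc.prems unfolding parallel_def by blast+
  obtain F1 G1 F2 G2 where "(F1, G1) \<in> descendants n (\<iota> f1 ` a) (\<iota> g1 ` a)"
    "(F2, G2) \<in> descendants n (\<iota> f2 ` b) (\<iota> g2 ` b)" "parallel F1 F2 G1 G2"
    using Suc.IH [OF ab(3)] by blast
  then show ?case
    unfolding descendants_Suc [OF f(1,3,5)] descendants_Suc [OF f(2,4,6)] using ab(1,2) by blast
qed auto

text \<open>The induction hypothesis gives one element of \<Gamma> for each face a of \<sigma>(T).
  For adjacent a and b, parallel descendants belong to both sub-supertiles, so rigidity equates the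
  two elements; connectedness through edges does the rest.\<close>

lemma supertiles_congruent:
  assumes "f \<in> faces Y" "g \<in> faces Y" "ty f = ty g"
  shows "\<exists>H\<in>\<Gamma>. \<forall>(F, F') \<in> descendants n f g. \<forall>z\<in>plane G. hmap F F' z = H z"
  using assms
proof (induction n arbitrary: f g)
  case 0
  have "hmap f g \<in> \<Gamma>" using hmap [OF 0] unfolding carries_def by blast
  then show ?case by auto
next
  case (Suc n)
  let ?K = "img S (ty f)"
  have "\<exists>H. H \<in> \<Gamma> \<and> (\<forall>(F, F') \<in> descendants n (\<iota> f ` a) (\<iota> g ` a). \<forall>z\<in>plane G. hmap F F' z = H z)"
    if a: "a \<in> faces ?K" for a
  proof -
    have "a \<in> faces (img S (ty g))" using a Suc.prems(3) by simp
    then have "\<iota> f ` a \<in> faces Y" "\<iota> g ` a \<in> faces Y" "ty (\<iota> f ` a) = ty (\<iota> g ` a)"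
      using sub_face(1,2) [OF Suc.prems(1) a] sub_face(1,2) [OF Suc.prems(2), of a] Suc.prems(3) by simp_all
    then show ?thesis using Suc.IH by blast
  qed
  then have "\<exists>H. \<forall>a\<in>faces ?K. H a \<in> \<Gamma> \<and>
      (\<forall>(F, F') \<in> descendants n (\<iota> f ` a) (\<iota> g ` a). \<forall>z\<in>plane G. hmap F F' z = H a z)"
    by (intro bchoice ballI)
  then obtain H where HH: "\<forall>a\<in>faces ?K. H a \<in> \<Gamma> \<and>
      (\<forall>(F, F') \<in> descendants n (\<iota> f ` a) (\<iota> g ` a). \<forall>z\<in>plane G. hmap F F' z = H a z)" by (rule exE)
  have H: "\<And>a. a \<in> faces ?K \<Longrightarrow> H a \<in> \<Gamma>"
    "\<And>a F F' z. a \<in> faces ?K \<Longrightarrow> (F, F') \<in> descendants n (\<iota> f ` a) (\<iota> g ` a) \<Longrightarrow> z \<in> plane G \<Longrightarrow> hmap F F' z = H a z"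
    using HH by blast+
  have adj: "H a z = H b z" if ab: "(a, b) \<in> face_adj ?K" and z: "z \<in> plane G" for a b z
  proof -
    have a: "a \<in> faces ?K" "b \<in> faces ?K" using ab unfolding face_adj_def [OF img_patch tile_cw2] by blast+
    obtain F1 G1 F2 G2 where "(F1, G1) \<in> descendants n (\<iota> f ` a) (\<iota> g ` a)"
      "(F2, G2) \<in> descendants n (\<iota> f ` b) (\<iota> g ` b)" "parallel F1 F2 G1 G2"
      using parallel_descendants [OF parallel_siblings [OF Suc.prems ab]] by blast
    then show ?thesis using H(2) [OF a(1)] H(2) [OF a(2)] parallel_rigid z by metis
  qed
  have "faces ?K \<noteq> {}"
  proof
    assume "faces ?K = {}"
    then have "topspace (ctop ?K) = {}" using disc_closed_faces_cover [OF img_cw2 img_disc] by simp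
    moreover obtain h where "homeomorphic_map (ctop ?K) (top_of_set (cball 0 1 :: complex set)) h"
      using disc_homeo [OF img_disc] .
    ultimately have "cball (0::complex) 1 = {}" using homeomorphic_mapD(2) by fastforce
    then show False by simp
  qed
  then obtain a0 where a0: "a0 \<in> faces ?K" by blast
  have all: "H b z = H a0 z" if b: "b \<in> faces ?K" and z: "z \<in> plane G" for b z
  proof -
    have "(a0, b) \<in> (face_adj ?K)\<^sup>*" by (rule patch_faces_connected [OF img_patch tile_cw2 a0 b])
    then show ?thesis
    proof (induction rule: rtrancl_induct)
      case (step y b)
      then show ?case using adj [OF step(2) z] by simp
    qed simp
  qed
  show ?case
  proof (rule bexI [of _ "H a0"])
    show "\<forall>(F, F') \<in> descendants (Suc n) f g. \<forall>z\<in>plane G. hmap F F' z = H a0 z"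
      unfolding descendants_Suc [OF Suc.prems] using H(2) all by (auto split: prod.splits) 
    show "H a0 \<in> \<Gamma>" by (rule H(1) [OF a0])
  qed
qed

section \<open>Composition of levels, types and extent of supertiles\<close>

lemma supertile_0 [simp]: "supertile 0 f = {f}"
  by (simp add: supertile_def)

lemma fst_descendants:
  assumes "f \<in> faces Y" "g \<in> faces Y" "ty f = ty g"
  shows "fst ` descendants n f g = supertile n f" "snd ` descendants n f g = supertile n g"
proof -
  have "fst ` descendants n f g = supertile n f \<and> snd ` descendants n f g = supertile n g"
    using assms
  proof (induction n arbitrary: f g)
    case (Suc n)
    have im: "img S (ty g) = img S (ty f)" using Suc.prems(3) by simp
    have ch: "\<iota> f ` a \<in> faces Y \<and> \<iota> g ` a \<in> faces Y \<and> ty (\<iota> f ` a) = ty (\<iota> g ` a)"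
      if "a \<in> faces (img S (ty f))" for a
      using sub_face(1,2) [OF Suc.prems(1) that] sub_face(1,2) [OF Suc.prems(2), of a] im that by simp
    have st: "supertile (Suc n) h = (\<Union>a\<in>faces (img S (ty h)). supertile n (\<iota> h ` a))" if "h \<in> faces Y" for h
      unfolding supertile_def descendants_Suc [OF that that refl] by (simp add: image_UN)
    show ?case
      unfolding descendants_Suc [OF Suc.prems] image_UN st [OF Suc.prems(1)] st [OF Suc.prems(2)] im
      using Suc.IH ch by (intro conjI SUP_cong refl) blast+
  qed simp
  then show "fst ` descendants n f g = supertile n f" "snd ` descendants n f g = supertile n g" by blast+
qed

lemma supertile_Suc:
  "f \<in> faces Y \<Longrightarrow> supertile (Suc n) f = (\<Union>a\<in>faces (img S (ty f)). supertile n (\<iota> f ` a))"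
  unfolding supertile_def by (simp add: descendants_Suc image_UN)

lemma supertile_faces: "f \<in> faces Y \<Longrightarrow> supertile n f \<subseteq> faces Y"
proof
  fix F assume f: "f \<in> faces Y" and "F \<in> supertile n f"
  then obtain F' where "(F, F') \<in> descendants n f f" unfolding supertile_def by auto
  then show "F \<in> faces Y" using descendants_faces [OF f f refl] by blast
qed

lemma supertile_add:
  "f \<in> faces Y \<Longrightarrow> supertile (m + n) f = (\<Union>g\<in>supertile m f. supertile n g)"
proof (induction m arbitrary: f)
  case (Suc m)
  have "supertile (Suc m + n) f = (\<Union>a\<in>faces (img S (ty f)). supertile (m + n) (\<iota> f ` a))"
    using supertile_Suc [OF Suc.prems] by simp
  also have "\<dots> = (\<Union>a\<in>faces (img S (ty f)). \<Union>g\<in>supertile m (\<iota> f ` a). supertile n g)"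
    using Suc.IH sub_face(1) [OF Suc.prems] by (intro SUP_cong refl) blast
  finally show ?case unfolding supertile_Suc [OF Suc.prems] by simp
qed simp

lemma supertile_1: "f \<in> faces Y \<Longrightarrow> supertile 1 f = (`) (\<iota> f) ` faces (img S (ty f))"
  using supertile_Suc [of f 0] by auto

lemma supertile_types: "f \<in> faces Y \<Longrightarrow> ty ` supertile n f = types_of_iterate S n (ty f)"
proof (induction n)
  case (Suc n)
  have "ty ` supertile (Suc n) f = (\<Union>g\<in>supertile n f. ty ` supertile 1 g)"
    using supertile_add [OF Suc.prems, of n 1] by (simp add: image_UN)
  also have "\<dots> = (\<Union>g\<in>supertile n f. ftype (img S (ty g)) ` faces (img S (ty g)))"
  proof (intro SUP_cong refl)
    fix g assume "g \<in> supertile n f"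
    then have g: "g \<in> faces Y" using supertile_faces [OF Suc.prems] by blast
    show "ty ` supertile 1 g = ftype (img S (ty g)) ` faces (img S (ty g))"
      unfolding supertile_1 [OF g] image_image using sub_face(2) [OF g] by (intro image_cong refl) simp
  qed
  also have "\<dots> = (\<Union>j\<in>ty ` supertile n f. ftype (img S j) ` faces (img S j))" by simp
  finally show ?case using Suc.IH [OF Suc.prems] by simp
qed simp

lemma faces_P_Suc: "faces (P (Suc k)) = (\<Union>f\<in>faces (P k). supertile 1 f)"
proof -
  have "faces (P (Suc k)) = (\<Union>f\<in>faces (P k). (`) (\<iota> f) ` faces (img S (ty f)))"
    using glued_faces [OF glue [of k]] by simp
  also have "\<dots> = (\<Union>f\<in>faces (P k). supertile 1 f)"
    using supertile_1 faces_P [of k] by (intro SUP_cong refl) simp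
  finally show ?thesis .
qed

text \<open>This is why supertiles of a fixed level n cover the plane: the faces of every
  \<open>P (k + n)\<close> are grouped into such supertiles.\<close>

lemma faces_P_add: "faces (P (k + n)) = (\<Union>f\<in>faces (P k). supertile n f)"
proof (induction n)
  case (Suc n)
  have "faces (P (k + Suc n)) = (\<Union>f\<in>faces (P k). \<Union>g\<in>supertile n f. supertile 1 g)"
    using faces_P_Suc [of "k + n"] Suc by simp
  also have "\<dots> = (\<Union>f\<in>faces (P k). supertile (n + 1) f)"
    using supertile_add [of _ n 1] faces_P [of k] by (intro SUP_cong refl) simp
  finally show ?case by simp
qed simp

lemma base_face: "faces (P 0) = {f\<^sub>0}" "ty f\<^sub>0 = t" "f\<^sub>0 \<in> faces Y"
  using base faces_P [of 0] unfolding single_tile_def by auto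

lemma faces_P_supertile: "faces (P k) = supertile k f\<^sub>0"
  using faces_P_add [of 0 k] base_face by simp

lemma finite_supertile:
  assumes "f \<in> faces Y" shows "finite (supertile n f)"
proof -
  obtain k where "f \<in> faces (P k)" using face_in_P [OF assms] .
  then have "supertile n f \<subseteq> faces (P (k + n))" unfolding faces_P_add by blast
  then show ?thesis using disc_finite(3) [OF P_cw2 P_disc] finite_subset by blast
qed

abbreviation region :: "nat \<Rightarrow> complex set \<Rightarrow> complex set" where
  "region n f \<equiv> \<Union>F\<in>supertile n f. closure F"

lemma compact_supertile:
  assumes f: "f \<in> faces Y" shows "compact (region n f)" "region n f \<subseteq> plane G"
proof -
  have "compact (closure F) \<and> closure F \<subseteq> plane G" if "F \<in> supertile n f" for F
  proof -
    have "F \<in> faces Y" using supertile_faces [OF f] that by blast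
    then obtain u where u: "u \<in> \<T>" "F = interior (fst u)" by (auto simp: Y_simps)
    then show ?thesis using tiling_is_tile [OF tiling u(1)] tile_closure [OF u(1)] by (simp add: is_tile_def)
  qed
  then show "compact (region n f)" "region n f \<subseteq> plane G"
    using finite_supertile [OF f] by (auto intro!: compact_UN)
qed

lemma supertile_copy:
  assumes f: "f \<in> faces Y" "g \<in> faces Y" "ty f = ty g"
  obtains H where "H \<in> \<Gamma>" "\<And>F F'. (F, F') \<in> descendants n f g \<Longrightarrow> H ` closure F = closure F'"
    "H ` region n f = region n g"
proof -
  obtain H where H: "H \<in> \<Gamma>" "\<forall>(F, F') \<in> descendants n f g. \<forall>z\<in>plane G. hmap F F' z = H z"
    using supertiles_congruent [OF f] by blast
  have img: "H ` closure F = closure F'" if FF: "(F, F') \<in> descendants n f g" for F F'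
  proof -
    have F: "F \<in> faces Y" "F' \<in> faces Y" "ty F = ty F'" using descendants_faces [OF f FF] by blast+
    have "closure F \<subseteq> plane G" using compact_supertile(2) [OF F(1), of 0] by simp
    moreover have "\<forall>z\<in>plane G. hmap F F' z = H z" using H(2) FF by blast
    ultimately have "H ` closure F = hmap F F' ` closure F" by (intro image_cong refl) auto
    also have "\<dots> = closure F'" using hmap [OF F] unfolding carries_def by blast
    finally show ?thesis .
  qed
  have "H ` (\<Union>F\<in>fst ` descendants n f g. closure F) = (\<Union>F\<in>snd ` descendants n f g. closure F)"
    unfolding image_UN image_image using img by (intro SUP_cong refl) auto
  then have "H ` region n f = region n g"
    unfolding fst_descendants [OF f] .
  then show thesis using that H(1) img by blast
qed

subsection \<open>Repetitivity\<close>

definition tiles_of :: "complex set set \<Rightarrow> 'l labelled_tile set" where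
  "tiles_of \<F> = {u \<in> \<T>. interior (fst u) \<in> \<F>}"

lemma interior_nonempty: "u \<in> \<T> \<Longrightarrow> interior (fst u) \<noteq> {}"
  using face_nonempty by (auto simp: Y_simps)

text \<open>Tiles with the same set and different labels are excluded too: their nonempty interiors
  would overlap.\<close>

lemma interior_inj: "inj_on (\<lambda>u. interior (fst u)) \<T>"
proof (rule inj_onI)
  fix u v assume uv: "u \<in> \<T>" "v \<in> \<T>" "interior (fst u) = interior (fst v)"
  have "interior (fst u) \<inter> interior (fst v) \<noteq> {}" using interior_nonempty [OF uv(1)] uv(3) by simp
  then show "u = v" using tiling uv(1,2) unfolding is_tiling_def by blast
qed

lemma support_tiles_of:
  assumes "\<F> \<subseteq> faces Y" shows "support (tiles_of \<F>) = (\<Union>F\<in>\<F>. closure F)"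
proof
  show "support (tiles_of \<F>) \<subseteq> (\<Union>F\<in>\<F>. closure F)"
    unfolding support_def tiles_of_def using tile_closure by fastforce
  show "(\<Union>F\<in>\<F>. closure F) \<subseteq> support (tiles_of \<F>)"
  proof (rule UN_least)
    fix F assume F: "F \<in> \<F>"
    then obtain u where u: "u \<in> \<T>" "F = interior (fst u)" using assms by (auto simp: Y_simps)
    then have "closure F = fst u" using tile_closure by simp
    then show "closure F \<subseteq> support (tiles_of \<F>)" using u F unfolding support_def tiles_of_def by blast
  qed
qed

text \<open>Congruence of the underlying sets does not give equality of labelled tiles; the labels
  agree because the type determines the prototile, whose members share a label.\<close>

lemma label_eq:
  assumes u: "u \<in> \<T>" "v \<in> \<T>" and ty: "ty (interior (fst u)) = ty (interior (fst v))"
  shows "snd u = snd v"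
proof -
  have eq: "prototile_of G \<Gamma> u = prototile_of G \<Gamma> v" using placed u ty by simp
  obtain k where k: "k \<in> \<Gamma>" "\<And>z. z \<in> plane G \<Longrightarrow> k z = z" using subgroup_one [OF \<Gamma>] by metis
  have vt: "is_tile G (fst v)" by (rule tiling_is_tile [OF tiling u(2)])
  then have "k ` fst v = (\<lambda>z. z) ` fst v" using k(2) by (intro image_cong refl) (auto simp: is_tile_def)
  then have "v \<in> prototile_of G \<Gamma> v"
    using vt k(1) by (auto simp: prototile_of_def tile_equiv_def labelled_tiles_def intro!: bexI [of _ k])
  then have "v \<in> prototile_of G \<Gamma> u" using eq by simp
  then show ?thesis by (simp add: prototile_of_def tile_equiv_def)
qed

lemma act_tiles_of:
  assumes f: "f \<in> faces Y" "g \<in> faces Y" "ty f = ty g"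
  obtains H where "H \<in> \<Gamma>" "act H (tiles_of (supertile n f)) \<subseteq> \<T>"
    "support (act H (tiles_of (supertile n f))) = region n g"
proof -
  obtain H where H: "H \<in> \<Gamma>" "\<And>F F'. (F, F') \<in> descendants n f g \<Longrightarrow> H ` closure F = closure F'"
    "H ` region n f = region n g"
    using supertile_copy [OF f] by metis
  have "(H ` fst u, snd u) \<in> \<T>" if u: "u \<in> tiles_of (supertile n f)" for u
  proof -
    have uT: "u \<in> \<T>" "interior (fst u) \<in> supertile n f" using u by (auto simp: tiles_of_def)
    then obtain F' where F': "(interior (fst u), F') \<in> descendants n f g"
      unfolding fst_descendants(1) [OF f, symmetric] by auto
    have F: "F' \<in> faces Y" "ty (interior (fst u)) = ty F'" using descendants_faces [OF f F'] by blast+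
    then obtain v where v: "v \<in> \<T>" "F' = interior (fst v)" by (auto simp: Y_simps)
    have "H ` fst u = fst v" using H(2) [OF F'] tile_closure uT(1) v by simp
    moreover have "snd u = snd v" using label_eq [OF uT(1) v(1)] F(2) v(2) by simp
    ultimately have "(H ` fst u, snd u) = v" by simp
    then show ?thesis using v(1) by simp
  qed
  then have "act H (tiles_of (supertile n f)) \<subseteq> \<T>" by (auto simp: act_eq)
  moreover have "support (act H (tiles_of (supertile n f))) = region n g"
    unfolding support_act support_tiles_of [OF supertile_faces [OF f(1)]] H(3) ..
  ultimately show thesis using that H(1) by blast
qed

lemma support_P: "(\<Union>F\<in>supertile k f\<^sub>0. closure F) = A k"
proof -
  have "A k = (\<Union>F\<in>faces (P k). closed_cell (P k) F)"
    using disc_closed_faces_cover [OF P_cw2 P_disc, of k] by simp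
  also have "\<dots> = (\<Union>F\<in>faces (P k). closure F)"
    using closure_face by (intro SUP_cong refl) blast
  finally show ?thesis by (simp add: faces_P_supertile)
qed

text \<open>For each type one region is bounded by compactness, and the others of that type are
  isometric to it.\<close>

lemma supertile_bound:
  obtains D where "\<And>f x y. f \<in> faces Y \<Longrightarrow> x \<in> region n f \<Longrightarrow>
    y \<in> region n f \<Longrightarrow> plane_dist G x y \<le> D"
proof -
  have "\<exists>D. \<forall>f. f \<in> faces Y \<and> ty f = j \<longrightarrow> (\<forall>x\<in>region n f.
    \<forall>y\<in>region n f. plane_dist G x y \<le> D)" for j
  \<comment> \<open>If the type j does not occur as a face, any bound will do.\<close>
  proof (cases "\<exists>f. f \<in> faces Y \<and> ty f = j")
    case True
    then obtain f where f: "f \<in> faces Y" "ty f = j" by blast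
    let ?X = "region n f"
    have X: "compact ?X" "?X \<subseteq> plane G" by (rule compact_supertile [OF f(1)])+
    have "continuous_on (?X \<times> ?X) (\<lambda>p. plane_dist G (fst p) (snd p))"
      using X(2) by (intro continuous_on_plane_dist continuous_intros) auto
    moreover have "compact (?X \<times> ?X)" by (rule compact_Times [OF X(1) X(1)])
    ultimately have "compact ((\<lambda>p. plane_dist G (fst p) (snd p)) ` (?X \<times> ?X))"
      by (rule compact_continuous_image)
    then have "bdd_above ((\<lambda>p. plane_dist G (fst p) (snd p)) ` (?X \<times> ?X))"
      by (intro bounded_imp_bdd_above compact_imp_bounded)
    then obtain D where "\<And>r. r \<in> (\<lambda>p. plane_dist G (fst p) (snd p)) ` (?X \<times> ?X) \<Longrightarrow> r \<le> D"
      unfolding bdd_above_def by blast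
    then have D: "plane_dist G x y \<le> D" if "x \<in> ?X" "y \<in> ?X" for x y using that by force
    have "plane_dist G x y \<le> D"
      if g: "g \<in> faces Y" "ty g = j" and x: "x \<in> region n g"
        and y: "y \<in> region n g" for g x y
    proof -
      obtain H where H: "H \<in> \<Gamma>" "H ` ?X = region n g"
        using supertile_copy [OF f(1) g(1)] f(2) g(2) by metis
      obtain x' y' where xy: "x' \<in> ?X" "y' \<in> ?X" "x = H x'" "y = H y'" using x y unfolding H(2) [symmetric] by blast
      have "x' \<in> plane G" "y' \<in> plane G" using xy(1,2) X(2) by (blast intro: subsetD)+
      then have "plane_dist G x y = plane_dist G x' y'"
        unfolding xy(3,4) by (rule isometry_dist [OF subgroup_isometry [OF \<Gamma> H(1)]])
      then show ?thesis using D [OF xy(1,2)] by simp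
    qed
    then show ?thesis by blast
  qed blast
  then obtain D where D: "\<And>j f x y. f \<in> faces Y \<Longrightarrow> ty f = j \<Longrightarrow> x \<in> region n f \<Longrightarrow>
    y \<in> region n f \<Longrightarrow> plane_dist G x y \<le> D j"
    by metis
  show thesis
  \<comment> \<open>The maximum exists because the type \<open>'t\<close> of tile indices is
    finite.\<close>
  proof (rule that [of "Max (range D)"])
    fix f x y assume "f \<in> faces Y" "x \<in> region n f" "y \<in> region n f"
    then have "plane_dist G x y \<le> D (ty f)" using D by blast
    also have "\<dots> \<le> Max (range D)" by simp
    finally show "plane_dist G x y \<le> Max (range D)" .
  qed
qed

text \<open>D bounds the diameter of supertiles of level m + k. The one around c contains, after m
  subdivisions, a face of type t, whose supertile of level k is a copy of the wanted patch.\<close>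

theorem realization_repetitive:
  assumes prim: "\<And>i. t \<in> types_of_iterate S m i"
  shows "\<exists>D. \<forall>c\<in>plane G. \<exists>g\<in>\<Gamma>. act g (tiles_of (supertile k f\<^sub>0)) \<subseteq> \<T> \<and>
    support (act g (tiles_of (supertile k f\<^sub>0))) \<subseteq> plane_cball G c D"
proof -
  obtain D where D: "\<And>f x y. f \<in> faces Y \<Longrightarrow> x \<in> region (m + k) f \<Longrightarrow>
    y \<in> region (m + k) f \<Longrightarrow> plane_dist G x y \<le> D"
    by (rule supertile_bound [of "m + k"], rule that)
  have "\<exists>g\<in>\<Gamma>. act g (tiles_of (supertile k f\<^sub>0)) \<subseteq> \<T> \<and>
    support (act g (tiles_of (supertile k f\<^sub>0))) \<subseteq> plane_cball G c D" if c: "c \<in> plane G" for c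
  proof -
    obtain n where "c \<in> A n" using c plane_A by blast
    \<comment> \<open>Raising the level by m + k lets the faces around c be grouped into supertiles
      of that level over faces of \<open>P n\<close>.\<close>
    then have "c \<in> A (n + (m + k))" using A_mono [of n "n + (m + k)"] by auto
    then obtain F where F: "F \<in> faces (P (n + (m + k)))" "c \<in> closure F"
      unfolding support_P [symmetric] faces_P_supertile by blast
    then obtain f where f: "f \<in> faces (P n)" "F \<in> supertile (m + k) f" unfolding faces_P_add by blast
    have fY: "f \<in> faces Y" using f(1) faces_P by blast
    have "t \<in> ty ` supertile m f" unfolding supertile_types [OF fY] by (rule prim)
    then obtain g where g: "g \<in> supertile m f" "ty g = t" by blast
    have gY: "g \<in> faces Y" using supertile_faces [OF fY] g(1) by blast
    have sub: "supertile k g \<subseteq> supertile (m + k) f" unfolding supertile_add [OF fY] using g(1) by blast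
    obtain H where H: "H \<in> \<Gamma>" "act H (tiles_of (supertile k f\<^sub>0)) \<subseteq> \<T>"
      "support (act H (tiles_of (supertile k f\<^sub>0))) = region k g"
      using act_tiles_of [OF base_face(3) gY] base_face(2) g(2) by metis
    have cX: "c \<in> region (m + k) f" using F(2) f(2) by blast
    have "region k g \<subseteq> plane_cball G c D"
    proof
      fix y assume "y \<in> region k g"
      then have y: "y \<in> region (m + k) f" using sub by blast
      then have "y \<in> plane G" using compact_supertile(2) [OF fY] by (blast intro: subsetD)
      then show "y \<in> plane_cball G c D" using D [OF fY cX y] by (simp add: plane_cball_def)
    qed
    then show ?thesis using H by (intro bexI [of _ H] conjI) simp_all
  qed
  then show ?thesis by blast
qed

text \<open>The patches \<sigma>^k(T) of the tiling form the exhausting family: each is a disc,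
  hence connected, and every compact set lies in one of them.\<close>

theorem realization_minimal:
  assumes prim: "\<And>i. t \<in> types_of_iterate S m i" and b: "b \<in> plane G"
  shows "minimal_system (subtopology (tiling_topology G \<Gamma> b \<P>) (tiling_hull G \<Gamma> b \<P> \<T>)) (tiling_orbit \<Gamma>)"
proof (rule repetitive_imp_minimal [OF b tiling])
  let ?F = "range (\<lambda>k. tiles_of (supertile k f\<^sub>0))"
  show "fst u \<noteq> {}" if "u \<in> \<T>" for u using interior_nonempty [OF that] by auto
  have supp: "support (tiles_of (supertile k f\<^sub>0)) = A k" for k
    using support_tiles_of [OF supertile_faces [OF base_face(3)]] support_P by simp
  show "finite p \<and> p \<subseteq> \<T> \<and> connected (support p)" if p: "p \<in> ?F" for p
  proof -
    obtain k where k: "p = tiles_of (supertile k f\<^sub>0)" using p by blast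
    have "finite p"
    proof (rule finite_imageD)
      show "finite ((\<lambda>u. interior (fst u)) ` p)"
        by (rule finite_subset [OF _ finite_supertile [OF base_face(3), of k]]) (auto simp: k tiles_of_def)
      show "inj_on (\<lambda>u. interior (fst u)) p"
        by (rule inj_on_subset [OF interior_inj]) (auto simp: k tiles_of_def)
    qed
    moreover have "connected (A k)"
    proof -
      obtain h where h: "homeomorphic_map (top_of_set (A k)) (top_of_set (cball 0 1 :: complex set)) h"
        using disc_homeo [OF P_disc [of k]] by auto
      obtain g where g: "homeomorphic_map (top_of_set (cball 0 1 :: complex set)) (top_of_set (A k)) g"
        using homeomorphic_map_inverse [OF h] by metis
      have "continuous_on (cball 0 1) g" "g ` cball 0 1 = A k"
        using homeomorphic_mapD(1,2) [OF g] by (auto dest: continuous_map_into_fulltopology)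
      then show ?thesis using connected_continuous_image [of "cball 0 1" g] by simp
    qed
    ultimately show ?thesis using supp k by (auto simp: tiles_of_def)
  qed
  show "\<exists>p\<in>?F. K \<subseteq> support p" if K: "compact K" "K \<subseteq> plane G" for K
  proof -
    obtain k where "K \<subseteq> A k" using compact_subset_A [OF K] .
    then show ?thesis using supp by auto
  qed
  show "\<exists>R. \<forall>c\<in>plane G. \<exists>g\<in>\<Gamma>. act g p \<subseteq> \<T> \<and> support (act g p) \<subseteq> plane_cball G c R"
    if "p \<in> ?F" for p
    using that realization_repetitive [OF prim] by blast
qed

end

section \<open>From the definitions to the locale of realized complexes\<close>

theorem proposition6p8:
  fixes S :: "('a, 't::finite) presub" and t :: 't
    and G :: geometry and b :: complex and \<Gamma> :: "(complex \<Rightarrow> complex) set"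
    and \<P> :: "'l::finite labelled_tile set set" and \<T> :: "'l labelled_tile set"
  assumes "topological_substitution S" and "primitive_substitution S"
    and "b \<in> plane G" and "is_tiling G \<Gamma> \<P> \<T>"
    and "geometric_realization G \<Gamma> \<P> \<T> S t"
  shows "minimal_system (subtopology (tiling_topology G \<Gamma> b \<P>) (tiling_hull G \<Gamma> b \<P> \<T>)) (tiling_orbit \<Gamma>)"
proof -
  have pre: "pre_substitution S" using assms(1) by (simp add: topological_substitution_def)
  obtain k S' where k: "is_power S k S'" "pure_primitive S'"
    using assms(2) unfolding primitive_substitution_def by blast
  \<comment> \<open>The exponent of primitivity serves as the level m: a face of type t occurs in
    \<sigma>^k(T) for every tile T.\<close>
  have prim: "t \<in> types_of_iterate S k i" for i
  proof -
    have "\<forall>i j. \<exists>f\<in>faces (img S' i). f \<subseteq> core (img S' i) \<and> ftype (img S' i) f = j"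
      using k(2) unfolding pure_primitive_def by (elim conjE)
    then obtain f where f: "f \<in> faces (img S' i)" "ftype (img S' i) f = t" by blast
    have "iterate S k i (img S' i) (smap S' i)" using k(1) unfolding is_power_def by blast
    then have "ftype (img S' i) ` faces (img S' i) = types_of_iterate S k i" by (rule iterate_types)
    then show ?thesis using f by blast
  qed
  obtain ty :: "complex set \<Rightarrow> 't" and \<tau> :: "complex set \<Rightarrow> complex \<Rightarrow> 'a"
    and proto :: "'t \<Rightarrow> 'l labelled_tile set" and R :: "'t \<Rightarrow> 'l labelled_tile" and \<rho> :: "'t \<Rightarrow> 'a \<Rightarrow> complex"
    where inf: "sigma_infinity S t (tiling_complex G \<T> ty \<tau>)" and proto: "range proto \<subseteq> \<P>"
      and R: "\<forall>i. R i \<in> proto i \<and> homeomorphic_map (ctop (tile S i)) (top_of_set (fst (R i))) (\<rho> i)"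
      and placed: "\<forall>u\<in>\<T>. let f = interior (fst u); i = ty f in
          prototile_of G \<Gamma> u = proto i \<and>
          (\<exists>g\<in>\<Gamma>. fst u = g ` fst (R i) \<and>
             (\<forall>c\<in>cells (tile S i). \<tau> f ` g ` \<rho> i ` c = c))"
    using assms(5) unfolding geometric_realization_def by (elim exE conjE)
  let ?Y = "tiling_complex G \<T> ty \<tau>"
  obtain A :: "nat \<Rightarrow> complex set" and \<iota> f\<^sub>0 where
    A: "single_tile S t (restrict_complex ?Y (A 0)) f\<^sub>0"
      "\<forall>k. A k \<subseteq> A (Suc k) \<and> glued S (restrict_complex ?Y (A k)) (restrict_complex ?Y (A (Suc k))) \<iota>"
      "topspace (ctop ?Y) = (\<Union>k. A k)" "faces ?Y = (\<Union>k. faces (restrict_complex ?Y (A k)))"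
      "\<forall>C. closedin (ctop ?Y) C \<longleftrightarrow>
          C \<subseteq> topspace (ctop ?Y) \<and> (\<forall>k. closedin (ctop (restrict_complex ?Y (A k))) (C \<inter> A k))"
    using inf unfolding sigma_infinity_def Let_def by (elim exE conjE)
  \<comment> \<open>The names from the two existential definitions become the parameters of the
    locale, with the tiling complex as Y.\<close>
  interpret realized_complex S G \<Gamma> \<P> \<T> t ty \<tau> A \<iota> f\<^sub>0 proto R \<rho> ?Y "\<lambda>k. restrict_complex ?Y (A k)"
  proof unfold_locales
    show "closedin (ctop ?Y) C \<longleftrightarrow>
          C \<subseteq> topspace (ctop ?Y) \<and> (\<forall>k. closedin (ctop (restrict_complex ?Y (A k))) (C \<inter> A k))" for C
      by (rule A(5) [THEN spec])
    show "proto i \<in> \<P>" for i using proto by blast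
    show "prototile_of G \<Gamma> u = proto (ty (interior (fst u))) \<and>
      (\<exists>g\<in>\<Gamma>. fst u = g ` fst (R (ty (interior (fst u)))) \<and>
        (\<forall>c\<in>cells (tile S (ty (interior (fst u)))). \<tau> (interior (fst u)) ` g ` \<rho> (ty (interior (fst u))) ` c = c))"
      if "u \<in> \<T>" for u using placed that unfolding Let_def by (rule bspec)
  qed (use pre assms(4) A R in blast)+
  show ?thesis by (rule realization_minimal [OF prim assms(3)])
qed

end
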